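(* Let $n\ge1$, $p>1$, let $U\subset\mathbb{R}^n$ be a smooth bounded domain, and let $v_0\in H_0^1(U)$. Assume that $I(v_0)>0$, $J(v_0)<d$, and that $v$ is a global (weak) solution to the problem $$v_t-\Delta v_t-\Delta v=v|v|^{p-1}\log|v| \ \text{ in } U\times\mathbb{R}^+,\qquad v=0 \ \text{ on } \partial U\times\mathbb{R}^+,\qquad v(\cdot,0)=v_0 \ \text{ in } U.$$ Then there exist constants $\mu>0$ and $C>0$ such that $$\|v(\cdot,t)\|_{H_0^1(U)}\le Ce^{-\mu t},\qquad 0\le t<\infty.$$
   Context: Notation: $\|g\|_q=(\int_U|g|^q\,dx)^{1/q}$ for $1\le q<\infty$, $\|\cdot\|=\|\cdot\|_2$, $(h,g)_2=\int_U hg\,dx$ (for vector fields, $(\nabla h,\nabla g)_2=\int_U\nabla h\cdot\nabla g\,dx$), and $\|v\|_{H_0^1(U)}^2=\|v\|^2+\|\nabla v\|^2$. The expressions $|s|^{p+1}\log|s|$ and $s|s|^{p-1}\log|s|$ are taken to be $0$ at $s=0$. Functionals on $H_0^1(U)$: $$J(v)=\tfrac12\|\nabla v\|^2-\tfrac1{1+p}\int_U|v|^{1+p}\log|v|\,dx+\tfrac1{(1+p)^2}\|v\|_{1+p}^{1+p},\qquad I(v)=\|\nabla v\|^2-\int_U|v|^{1+p}\log|v|\,dx.$$ Nehari manifold: $\mathcal N=\{v\in H_0^1(U): I(v)=0,\ \|\nabla v\|^2\neq0\}$. Depth of the well: $d=\inf_{v\in\mathcal N}J(v)$. Weak solution on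 $(0,T)$: a function $v\in L^\infty((0,T);H_0^1(U))$ with $v_t\in L^2((0,T);L^2(U))$ and $v(x,0)=v_0(x)$, satisfying, for all $w\in H_0^1(U)$ and $t\in(0,T)$, $$(v_t,w)_2+(\nabla v_t,\nabla w)_2+(\nabla v,\nabla w)_2=(v|v|^{p-1}\log|v|,w)_2.$$ A global (weak) solution is a weak solution that exists for all $t>0$, i.e. whose maximal existence time is $T=\infty$. *)

theory Defs
  imports "HOL-Analysis.Analysis"
begin

text \<open>Class \<open>C\<^sup>k\<close> on a set \<open>S\<close>, meant for open \<open>S\<close>.\<close>

primrec Ck_on :: "nat \<Rightarrow> 'a::euclidean_space set \<Rightarrow> ('a \<Rightarrow> real) \<Rightarrow> bool" where
  "Ck_on 0 S f \<longleftrightarrow> continuous_on S f"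
| "Ck_on (Suc k) S f \<longleftrightarrow>
     (\<forall>x\<in>S. f differentiable (at x)) \<and>
     (\<forall>b\<in>Basis. Ck_on k S (\<lambda>x. frechet_derivative f (at x) b))"

definition smooth_fun :: "('a::euclidean_space \<Rightarrow> real) \<Rightarrow> bool" where
  "smooth_fun f \<longleftrightarrow> (\<forall>k. Ck_on k UNIV f)"

definition test_functions :: "'a::euclidean_space set \<Rightarrow> ('a \<Rightarrow> real) set" where
  "test_functions U = {\<phi>. smooth_fun \<phi> \<and> (\<exists>K. compact K \<and> K \<subseteq> U \<and> (\<forall>x. x \<notin> K \<longrightarrow> \<phi> x = 0))}"

text \<open>Near each boundary point, \<open>U\<close> lies above the graph of a smooth function over the
  hyperplane orthogonal to a unit vector \<open>e\<close>; only the values of \<open>\<gamma>\<close> on that hyperplane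
  matter.\<close>

definition smooth_bounded_domain :: "'a::euclidean_space set \<Rightarrow> bool" where
  "smooth_bounded_domain U \<longleftrightarrow>
     open U \<and> connected U \<and> U \<noteq> {} \<and> bounded U \<and>
     (\<forall>x0\<in>frontier U. \<exists>r>0. \<exists>e \<gamma>. norm e = 1 \<and> smooth_fun \<gamma> \<and>
        U \<inter> ball x0 r = {x \<in> ball x0 r. x \<bullet> e > \<gamma> (x - (x \<bullet> e) *\<^sub>R e)})"

text \<open>Elements of function spaces are represented by functions on the whole space, of which
  only the values almost everywhere on \<open>U\<close> matter.\<close>

definition Lq_norm :: "real \<Rightarrow> 'a::euclidean_space set \<Rightarrow> ('a \<Rightarrow> 'b::euclidean_space) \<Rightarrow> real" where
  "Lq_norm q U g = (\<integral>x. norm (g x) powr q \<partial>lebesgue_on U) powr (1 / q)"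

definition L2_inner ::
  "'a::euclidean_space set \<Rightarrow> ('a \<Rightarrow> 'b::euclidean_space) \<Rightarrow> ('a \<Rightarrow> 'b) \<Rightarrow> real" where
  "L2_inner U h g = (\<integral>x. h x \<bullet> g x \<partial>lebesgue_on U)"

definition L2_space :: "'a::euclidean_space set \<Rightarrow> ('a \<Rightarrow> 'b::euclidean_space) set" where
  "L2_space U = {g. g \<in> borel_measurable (lebesgue_on U) \<and>
                    integrable (lebesgue_on U) (\<lambda>x. (norm (g x))\<^sup>2)}"

definition weak_gradient ::
  "'a::euclidean_space set \<Rightarrow> ('a \<Rightarrow> real) \<Rightarrow> ('a \<Rightarrow> 'a) \<Rightarrow> bool" where
  "weak_gradient U u g \<longleftrightarrow>
     (\<forall>\<phi>\<in>test_functions U. \<forall>b\<in>Basis.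
        (\<integral>x. u x * frechet_derivative \<phi> (at x) b \<partial>lebesgue_on U)
          = - (\<integral>x. (g x \<bullet> b) * \<phi> x \<partial>lebesgue_on U))"

definition H1 :: "'a::euclidean_space set \<Rightarrow> ('a \<Rightarrow> real) set" where
  "H1 U = {u \<in> L2_space U. \<exists>g\<in>L2_space U. weak_gradient U u g}"

text \<open>Weak gradients are unique only up to null sets, so a representative is chosen.\<close>

definition grad :: "'a::euclidean_space set \<Rightarrow> ('a \<Rightarrow> real) \<Rightarrow> 'a \<Rightarrow> 'a" where
  "grad U u = (SOME g. g \<in> L2_space U \<and> weak_gradient U u g)"

definition H1_norm :: "'a::euclidean_space set \<Rightarrow> ('a \<Rightarrow> real) \<Rightarrow> real" where
  "H1_norm U u = sqrt ((Lq_norm 2 U u)\<^sup>2 + (Lq_norm 2 U (grad U u))\<^sup>2)"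

definition H10 :: "'a::euclidean_space set \<Rightarrow> ('a \<Rightarrow> real) set" where
  "H10 U = {u \<in> H1 U. \<exists>\<phi>. (\<forall>k. \<phi> k \<in> test_functions U) \<and>
                            (\<lambda>k. H1_norm U (\<lambda>x. \<phi> k x - u x)) \<longlonglongrightarrow> 0}"

text \<open>The conventions for \<open>s = 0\<close> hold automatically since \<open>0 powr a = 0\<close>.
  If \<open>\<bar>v\<bar> powr (1 + p) * ln \<bar>v\<bar>\<close> is not integrable (impossible if \<open>H10 U\<close> embeds
  into some \<open>L\<^sup>q(U)\<close> with \<open>q > 1 + p\<close>), its integral is \<open>0\<close> by convention; then \<open>I_fun U p v = \<parallel>\<nabla>v\<parallel>\<^sup>2\<close>, so that such
  \<open>v\<close> is never in the Nehari manifold.  The latter is nonempty and \<open>J_fun U p\<close> is nonnegative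
  on it, so that the infimum over the reals is the intended one.\<close>

definition J_fun :: "'a::euclidean_space set \<Rightarrow> real \<Rightarrow> ('a \<Rightarrow> real) \<Rightarrow> real" where
  "J_fun U p v =
     1 / 2 * (Lq_norm 2 U (grad U v))\<^sup>2
     - 1 / (1 + p) * (\<integral>x. \<bar>v x\<bar> powr (1 + p) * ln \<bar>v x\<bar> \<partial>lebesgue_on U)
     + 1 / (1 + p)\<^sup>2 * (Lq_norm (1 + p) U v) powr (1 + p)"

definition I_fun :: "'a::euclidean_space set \<Rightarrow> real \<Rightarrow> ('a \<Rightarrow> real) \<Rightarrow> real" where
  "I_fun U p v =
     (Lq_norm 2 U (grad U v))\<^sup>2
     - (\<integral>x. \<bar>v x\<bar> powr (1 + p) * ln \<bar>v x\<bar> \<partial>lebesgue_on U)"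

definition nehari :: "'a::euclidean_space set \<Rightarrow> real \<Rightarrow> ('a \<Rightarrow> real) set" where
  "nehari U p = {v \<in> H10 U. I_fun U p v = 0 \<and> (Lq_norm 2 U (grad U v))\<^sup>2 \<noteq> 0}"

definition well_depth :: "'a::euclidean_space set \<Rightarrow> real \<Rightarrow> real" where
  "well_depth U p = (INF v\<in>nehari U p. J_fun U p v)"

text \<open>Strong (Bochner) measurability on \<open>A\<close> of a function with values in the space \<open>X\<close>
  normed by \<open>N\<close>: almost everywhere limit of simple functions.\<close>

definition bochner_measurable ::
  "real set \<Rightarrow> ('a \<Rightarrow> real) set \<Rightarrow> (('a \<Rightarrow> real) \<Rightarrow> real) \<Rightarrow> (real \<Rightarrow> 'a \<Rightarrow> real) \<Rightarrow> bool" where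
  "bochner_measurable A X N u \<longleftrightarrow>
     (AE t in lebesgue_on A. u t \<in> X) \<and>
     (\<exists>s. (\<forall>k. simple_function (lebesgue_on A) (s k) \<and> (\<forall>t\<in>A. s k t \<in> X)) \<and>
          (AE t in lebesgue_on A. (\<lambda>k. N (\<lambda>x. s k t x - u t x)) \<longlonglongrightarrow> 0))"

definition bochner_Linf ::
  "real set \<Rightarrow> ('a \<Rightarrow> real) set \<Rightarrow> (('a \<Rightarrow> real) \<Rightarrow> real) \<Rightarrow> (real \<Rightarrow> 'a \<Rightarrow> real) set" where
  "bochner_Linf A X N =
     {u. bochner_measurable A X N u \<and> (\<exists>M. AE t in lebesgue_on A. N (u t) \<le> M)}"

definition bochner_L2 ::
  "real set \<Rightarrow> ('a \<Rightarrow> real) set \<Rightarrow> (('a \<Rightarrow> real) \<Rightarrow> real) \<Rightarrow> (real \<Rightarrow> 'a \<Rightarrow> real) set" where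
  "bochner_L2 A X N =
     {u. bochner_measurable A X N u \<and> integrable (lebesgue_on A) (\<lambda>t. (N (u t))\<^sup>2)}"

text \<open>Weak derivative in time of \<open>u\<close> as a function with values in \<open>L\<^sup>2(U)\<close>: the identity
  \<open>\<integral> \<phi>' u dt = - \<integral> \<phi> u' dt\<close> between elements of \<open>L\<^sup>2(U)\<close>, expressed by pairing both sides
  with every \<open>w\<close> in \<open>L\<^sup>2(U)\<close>.\<close>

definition weak_time_derivative ::
  "'a::euclidean_space set \<Rightarrow> real \<Rightarrow> (real \<Rightarrow> 'a \<Rightarrow> real) \<Rightarrow> (real \<Rightarrow> 'a \<Rightarrow> real) \<Rightarrow> bool" where
  "weak_time_derivative U T u u' \<longleftrightarrow>
     (\<forall>\<phi>\<in>test_functions {0<..<T}. \<forall>w\<in>L2_space U.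
        (\<integral>t. deriv \<phi> t * L2_inner U (u t) w \<partial>lebesgue_on {0<..<T})
          = - (\<integral>t. \<phi> t * L2_inner U (u' t) w \<partial>lebesgue_on {0<..<T}))"

text \<open>The value \<open>v t\<close> at an individual time, in particular the initial value, is that of the
  representative which is continuous in time with values in \<open>L\<^sup>2(U)\<close>; one exists because
  \<open>v\<close> and its time derivative are square integrable in time with values in \<open>L\<^sup>2(U)\<close>.\<close>

definition L2_continuous_on ::
  "real set \<Rightarrow> 'a::euclidean_space set \<Rightarrow> (real \<Rightarrow> 'a \<Rightarrow> real) \<Rightarrow> bool" where
  "L2_continuous_on A U v \<longleftrightarrow>
     (\<forall>t\<in>A. v t \<in> L2_space U \<and> ((\<lambda>s. Lq_norm 2 U (\<lambda>x. v s x - v t x)) \<longlongrightarrow> 0) (at t within A))"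

text \<open>The time derivative \<open>v'\<close> is determined only for almost every \<open>t\<close>, so the weak equation
  is imposed for almost every \<open>t\<close>.  For its terms to be meaningful, \<open>v' t\<close> must have a weak
  gradient in \<open>L\<^sup>2(U)\<close> and the product of the nonlinearity and \<open>w\<close> must be integrable.\<close>

definition weak_solution ::
  "'a::euclidean_space set \<Rightarrow> real \<Rightarrow> ('a \<Rightarrow> real) \<Rightarrow> real \<Rightarrow> (real \<Rightarrow> 'a \<Rightarrow> real) \<Rightarrow> bool" where
  "weak_solution U p v0 T v \<longleftrightarrow>
     v \<in> bochner_Linf {0<..<T} (H10 U) (H1_norm U) \<and>
     L2_continuous_on {0..<T} U v \<and>
     (AE x in lebesgue_on U. v 0 x = v0 x) \<and>
     (\<exists>v'. v' \<in> bochner_L2 {0<..<T} (L2_space U) (Lq_norm 2 U) \<and>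
           weak_time_derivative U T v v' \<and>
           (AE t in lebesgue_on {0<..<T}. v' t \<in> H1 U \<and>
              (\<forall>w\<in>H10 U.
                 integrable (lebesgue_on U)
                   (\<lambda>x. v t x * \<bar>v t x\<bar> powr (p - 1) * ln \<bar>v t x\<bar> * w x) \<and>
                 L2_inner U (v' t) w + L2_inner U (grad U (v' t)) (grad U w)
                   + L2_inner U (grad U (v t)) (grad U w)
                 = L2_inner U (\<lambda>x. v t x * \<bar>v t x\<bar> powr (p - 1) * ln \<bar>v t x\<bar>) w)))"

text \<open>Maximal existence time \<open>\<infinity>\<close>: a weak solution on every bounded time interval.  No bound
  uniform in \<open>T\<close> is assumed.\<close>

definition global_weak_solution ::
  "'a::euclidean_space set \<Rightarrow> real \<Rightarrow> ('a \<Rightarrow> real) \<Rightarrow> (real \<Rightarrow> 'a \<Rightarrow> real) \<Rightarrow> bool" where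
  "global_weak_solution U p v0 v \<longleftrightarrow> (\<forall>T>0. weak_solution U p v0 T v)"

end

theory Submission
  imports Defs
begin

text \<open>
  Write \<open>\<parallel>\<cdot>\<parallel>\<close> for the norm of \<open>H\<^sup>1\<close> and let \<open>F(v)\<close> be the functional
  \<open>w \<mapsto> (v|v|\<^sup>p\<^sup>-\<^sup>1 log |v|, w)\<^sub>2 - (\<nabla>v, \<nabla>w)\<^sub>2\<close> on \<open>H\<^sub>0\<^sup>1(U)\<close>, so that \<open>J' = - F\<close> and
  \<open>I(v) = - F(v)(v)\<close>. The equation says that \<open>v\<close> moves along the gradient flow of \<open>J\<close> with respect to
  the inner product of \<open>H\<^sup>1\<close>.

  From \<open>I(v0) > 0\<close> one gets \<open>0 < J(v0) < d\<close>, and the positivity of \<open>d\<close> replaces the Sobolev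
  embedding: by rescaling onto the Nehari manifold it yields \<open>I \<ge> 0\<close> on a ball, hence
  bounds for the integral of \<open>|v|\<^sup>p\<^sup>+\<^sup>1 log |v|\<close> on bounded sets, hence local Lipschitz continuity of \<open>F\<close>. The only other inequality needed is that of Poincare.

  So \<open>v\<close> is Lipschitz continuous in time with values in \<open>H\<^sub>0\<^sup>1(U)\<close>, and up to errors of order
  \<open>(t - s)\<^sup>2\<close> the increment of \<open>J(v)\<close> on \<open>[s, t]\<close> is at most \<open>0\<close> and that of \<open>\<parallel>v\<parallel>\<^sup>2\<close> is
  \<open>- 2 (t - s) I(v(s))\<close>. Hence \<open>J(v)\<close> does not increase, \<open>v\<close> cannot cross the Nehari manifold, and
  \<open>I(v) \<ge> c \<parallel>v\<parallel>\<^sup>2\<close> because \<open>\<kappa>v\<close> still satisfies \<open>I \<ge> 0\<close> for \<open>\<kappa> = (d / J(v0))\<^sup>1\<^sup>/\<^sup>(\<^sup>p\<^sup>+\<^sup>1\<^sup>) > 1\<close>.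
\<close>

section \<open>Square integrable functions\<close>

text \<open>The usual argument tests the equation with v_t and with v and differentiates J(v) and
  the squared norm in time. Here v_t is given only as a function with values in L^2(U). For almost
  every t it has a weak gradient, but neither membership in H_0^1(U) nor integrability of that
  gradient in time is known, so v_t is no admissible test function. The equation is therefore used
  with one fixed w at a time, where it controls a scalar function of t, and a mean value inequality
  for such functions is all that is drawn from it. The increment w = v(t) - v(s) is inserted
  afterwards: (t - s) F(v(s))(w) is at least the squared norm of w up to O((t - s)^3), while
  -F(v(s))(w) is the first order part of the increment of J.

  In the Lipschitz bound for F the role of Hoelder's inequality is taken by a pointwise inequality
  that bounds a product of four factors by a sum of four terms, each controlled on bounded sets.

  The exponent in \<kappa> reflects that J(cu) \<le> c^(p+1) J(u) whenever c \<ge> 1, I(u) \<ge> 0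
  and I(cu) = 0.\<close>

lemma L2_spaceD:
  assumes "f \<in> L2_space U"
  shows "f \<in> borel_measurable (lebesgue_on U)" "integrable (lebesgue_on U) (\<lambda>x. (norm (f x))\<^sup>2)"
  using assms by (auto simp: L2_space_def)

lemma L2_inner_integrable:
  assumes "f \<in> L2_space U" "g \<in> L2_space U"
  shows "integrable (lebesgue_on U) (\<lambda>x. f x \<bullet> g x)"
proof (rule Bochner_Integration.integrable_bound)
  show "integrable (lebesgue_on U) (\<lambda>x. (norm (f x))\<^sup>2 + (norm (g x))\<^sup>2)"
    using assms by (intro Bochner_Integration.integrable_add L2_spaceD)
  show "(\<lambda>x. f x \<bullet> g x) \<in> borel_measurable (lebesgue_on U)"
    using assms by (intro borel_measurable_inner L2_spaceD)
  have "\<bar>f x \<bullet> g x\<bar> \<le> (norm (f x))\<^sup>2 + (norm (g x))\<^sup>2" for x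
  proof -
    have "2 * (norm (f x) * norm (g x)) \<le> (norm (f x))\<^sup>2 + (norm (g x))\<^sup>2"
      using sum_squares_bound[of "norm (f x)" "norm (g x)"] by (simp add: mult.assoc)
    moreover have "0 \<le> norm (f x) * norm (g x)" by simp
    ultimately show ?thesis using Cauchy_Schwarz_ineq2[of "f x" "g x"] by linarith
  qed
  then show "AE x in lebesgue_on U. norm (f x \<bullet> g x) \<le> norm ((norm (f x))\<^sup>2 + (norm (g x))\<^sup>2)"
    by (intro AE_I2) (smt (verit) real_norm_def zero_le_power2)
qed

lemma L2_scaleR: "f \<in> L2_space U \<Longrightarrow> (\<lambda>x. c *\<^sub>R f x) \<in> L2_space U"
  by (auto simp: L2_space_def power_mult_distrib)

lemma L2_zero: "(\<lambda>x. 0) \<in> L2_space U"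
  by (auto simp: L2_space_def)

lemma L2_add:
  assumes "f \<in> L2_space U" "g \<in> L2_space U"
  shows "(\<lambda>x. f x + g x) \<in> L2_space U"
proof -
  have "(\<lambda>x. (norm (f x + g x))\<^sup>2) = (\<lambda>x. (norm (f x))\<^sup>2 + 2 * (f x \<bullet> g x) + (norm (g x))\<^sup>2)"
    by (auto simp: power2_norm_eq_inner inner_simps inner_commute)
  then show ?thesis
    using assms L2_inner_integrable[OF assms] unfolding L2_space_def by auto
qed

lemma L2_diff:
  assumes "f \<in> L2_space U" "g \<in> L2_space U"
  shows "(\<lambda>x. f x - g x) \<in> L2_space U"
  using L2_add[OF assms(1) L2_scaleR[OF assms(2), of "-1"]] by simp

lemma L2_inner_commute: "L2_inner U f g = L2_inner U g f"
  by (simp add: L2_inner_def inner_commute)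

lemma L2_inner_add_left:
  assumes "f \<in> L2_space U" "g \<in> L2_space U" "h \<in> L2_space U"
  shows "L2_inner U (\<lambda>x. f x + g x) h = L2_inner U f h + L2_inner U g h"
  using assms by (simp add: L2_inner_def inner_add_left L2_inner_integrable)

lemma L2_inner_add_right:
  assumes "f \<in> L2_space U" "g \<in> L2_space U" "h \<in> L2_space U"
  shows "L2_inner U h (\<lambda>x. f x + g x) = L2_inner U h f + L2_inner U h g"
  using assms by (simp add: L2_inner_def inner_add_right L2_inner_integrable)

lemma L2_inner_scaleR_right: "L2_inner U f (\<lambda>x. c *\<^sub>R g x) = c * L2_inner U f g"
  by (simp add: L2_inner_def)

lemma L2_inner_scaleR_left: "L2_inner U (\<lambda>x. c *\<^sub>R f x) g = c * L2_inner U f g"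
  by (simp add: L2_inner_def)

lemma L2_inner_diff_left:
  assumes "f \<in> L2_space U" "g \<in> L2_space U" "h \<in> L2_space U"
  shows "L2_inner U (\<lambda>x. f x - g x) h = L2_inner U f h - L2_inner U g h"
  using assms by (simp add: L2_inner_def inner_diff_left L2_inner_integrable)

lemma L2_inner_diff_right:
  assumes "f \<in> L2_space U" "g \<in> L2_space U" "h \<in> L2_space U"
  shows "L2_inner U h (\<lambda>x. f x - g x) = L2_inner U h f - L2_inner U h g"
  using assms by (simp add: L2_inner_def inner_diff_right L2_inner_integrable)

lemma L2_inner_self_nonneg: "0 \<le> L2_inner U f f"
  by (simp add: L2_inner_def)

lemma Lq_norm_2: "Lq_norm 2 U f = sqrt (L2_inner U f f)"
proof -
  have "norm (f x) powr 2 = f x \<bullet> f x" for x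
    by (simp add: power2_norm_eq_inner)
  then show ?thesis
    using L2_inner_self_nonneg[of U f] by (simp add: Lq_norm_def L2_inner_def powr_half_sqrt)
qed

lemma Lq_norm_2_power2: "(Lq_norm 2 U f)\<^sup>2 = L2_inner U f f"
  by (simp add: Lq_norm_2 L2_inner_self_nonneg)

lemma Lq_norm_nonneg: "0 \<le> Lq_norm q U f"
  by (simp add: Lq_norm_def)

lemma L2_Cauchy_Schwarz:
  assumes "f \<in> L2_space U" "g \<in> L2_space U"
  shows "\<bar>L2_inner U f g\<bar> \<le> Lq_norm 2 U f * Lq_norm 2 U g"
proof -
  define a b c where "a = L2_inner U f f" and "b = L2_inner U f g" and "c = L2_inner U g g"
  have q: "0 \<le> a - 2 * t * b + t\<^sup>2 * c" for t
  proof -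
    have g': "(\<lambda>x. t *\<^sub>R g x) \<in> L2_space U" using assms(2) by (rule L2_scaleR)
    have "0 \<le> L2_inner U (\<lambda>x. f x - t *\<^sub>R g x) (\<lambda>x. f x - t *\<^sub>R g x)"
      by (rule L2_inner_self_nonneg)
    also have "\<dots> = L2_inner U f (\<lambda>x. f x - t *\<^sub>R g x) - t * L2_inner U g (\<lambda>x. f x - t *\<^sub>R g x)"
      by (simp add: L2_inner_diff_left assms g' L2_diff L2_inner_scaleR_left)
    also have "\<dots> = a - 2 * t * b + t\<^sup>2 * c"
      by (simp add: L2_inner_diff_right assms g' L2_inner_scaleR_right a_def b_def c_def
            L2_inner_commute[of U g f] power2_eq_square algebra_simps)
    finally show ?thesis .
  qed
  have a0: "a \<ge> 0" and c0: "c \<ge> 0" by (simp_all add: a_def c_def L2_inner_self_nonneg)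
  have "b\<^sup>2 \<le> a * c"
  proof (cases "c = 0")
    case True
    have "b = 0"
    proof (rule ccontr)
      assume "b \<noteq> 0"
      \<comment> \<open>For c = 0 the quadratic is affine in t, and at this t its value is
        -1.\<close>
      with q[of "(a + 1) / (2 * b)"] True show False by simp
    qed
    with a0 c0 show ?thesis by simp
  next
    case False
    with c0 have "c > 0" by simp
    with q[of "b / c"] show ?thesis
      by (simp add: power2_eq_square field_simps)
  qed
  then have "\<bar>b\<bar> \<le> sqrt (a * c)"
    using real_le_rsqrt by (metis power2_abs)
  then show ?thesis by (simp add: Lq_norm_2 a_def b_def c_def real_sqrt_mult)
qed

lemma L2_triangle:
  assumes "f \<in> L2_space U" "g \<in> L2_space U"
  shows "Lq_norm 2 U (\<lambda>x. f x + g x) \<le> Lq_norm 2 U f + Lq_norm 2 U g"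
proof -
  have "(Lq_norm 2 U (\<lambda>x. f x + g x))\<^sup>2 = (Lq_norm 2 U f)\<^sup>2 + 2 * L2_inner U f g + (Lq_norm 2 U g)\<^sup>2"
    unfolding Lq_norm_2_power2
    by (simp add: L2_inner_add_left L2_inner_add_right assms L2_add L2_inner_commute[of U g f])
  also have "\<dots> \<le> (Lq_norm 2 U f + Lq_norm 2 U g)\<^sup>2"
    using L2_Cauchy_Schwarz[OF assms] by (simp add: power2_sum algebra_simps)
  finally show ?thesis
    by (rule power2_le_imp_le) (simp add: Lq_norm_nonneg)
qed

lemma L2_inner_tendsto:
  assumes f: "\<And>k. f k \<in> L2_space U" and l: "l \<in> L2_space U" and h: "h \<in> L2_space U"
    and lim: "((\<lambda>k. Lq_norm 2 U (\<lambda>x. f k x - l x)) \<longlongrightarrow> 0) F"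
  shows "((\<lambda>k. L2_inner U (f k) h) \<longlongrightarrow> L2_inner U l h) F"
proof (rule Lim_null_comparison[THEN LIM_zero_cancel])
  show "\<forall>\<^sub>F k in F. norm (L2_inner U (f k) h - L2_inner U l h) \<le> Lq_norm 2 U (\<lambda>x. f k x - l x) * Lq_norm 2 U h"
    using L2_Cauchy_Schwarz[OF L2_diff[OF f l] h] by (simp add: L2_inner_diff_left f l h)
  show "((\<lambda>k. Lq_norm 2 U (\<lambda>x. f k x - l x) * Lq_norm 2 U h) \<longlongrightarrow> 0) F"
    using tendsto_mult_left_zero[OF lim] .
qed

lemma Lq_norm_2_scaleR: "Lq_norm 2 U (\<lambda>x. c *\<^sub>R f x) = \<bar>c\<bar> * Lq_norm 2 U f"
proof -
  have "L2_inner U (\<lambda>x. c *\<^sub>R f x) (\<lambda>x. c *\<^sub>R f x) = c\<^sup>2 * L2_inner U f f"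
    by (simp add: L2_inner_def power2_eq_square mult.assoc)
  then show ?thesis by (simp add: Lq_norm_2 real_sqrt_mult)
qed

lemma L2_inner_cong_AE:
  assumes "AE x in lebesgue_on U. f x = f' x" "AE x in lebesgue_on U. g x = g' x"
    "f \<in> borel_measurable (lebesgue_on U)" "f' \<in> borel_measurable (lebesgue_on U)"
    "g \<in> borel_measurable (lebesgue_on U)" "g' \<in> borel_measurable (lebesgue_on U)"
  shows "L2_inner U f g = L2_inner U f' g'"
  unfolding L2_inner_def
proof (rule integral_cong_AE)
  show "AE x in lebesgue_on U. f x \<bullet> g x = f' x \<bullet> g' x" using assms(1,2) by eventually_elim auto
qed (use assms in \<open>auto intro!: borel_measurable_inner\<close>)

lemma Lq_norm_2_cong_AE:
  assumes "AE x in lebesgue_on U. f x = g x"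
    "f \<in> borel_measurable (lebesgue_on U)" "g \<in> borel_measurable (lebesgue_on U)"
  shows "Lq_norm 2 U f = Lq_norm 2 U g"
  using L2_inner_cong_AE[OF assms(1) assms(1)] assms by (simp add: Lq_norm_2)

lemma Lq_norm_2_eq_0_AE:
  assumes "f \<in> L2_space U" "Lq_norm 2 U f = 0"
  shows "AE x in lebesgue_on U. f x = 0"
proof -
  have "L2_inner U f f = 0" using assms(2) L2_inner_self_nonneg[of U f] by (simp add: Lq_norm_2)
  then have "AE x in lebesgue_on U. f x \<bullet> f x = 0"
    unfolding L2_inner_def
    using integral_nonneg_eq_0_iff_AE[OF L2_inner_integrable[OF assms(1) assms(1)]] by simp
  then show ?thesis by simp
qed

lemma L2_tendsto_AE_subseq:
  assumes "\<And>k. f k \<in> L2_space U" "g \<in> L2_space U"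
    "(\<lambda>k. Lq_norm 2 U (\<lambda>x. f k x - g x)) \<longlonglongrightarrow> 0"
  obtains r where "strict_mono (r :: nat \<Rightarrow> nat)"
    "AE x in lebesgue_on U. (\<lambda>k. f (r k) x) \<longlonglongrightarrow> g x"
proof -
  have L: "(\<lambda>x. f k x - g x) \<in> L2_space U" for k using assms by (intro L2_diff)
  have "(\<lambda>k. (Lq_norm 2 U (\<lambda>x. f k x - g x))\<^sup>2) \<longlonglongrightarrow> 0"
    using tendsto_power[OF assms(3), of 2] by simp
  then have "(\<lambda>k. \<integral>x. norm ((norm (f k x - g x))\<^sup>2) \<partial>lebesgue_on U) \<longlonglongrightarrow> 0"
    by (simp add: Lq_norm_2_power2 L2_inner_def power2_norm_eq_inner)
  from tendsto_L1_AE_subseq[OF L2_spaceD(2)[OF L] this] obtain r :: "nat \<Rightarrow> nat"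
    where r: "strict_mono r" and
    "AE x in lebesgue_on U. (\<lambda>n. (norm (f (r n) x - g x))\<^sup>2) \<longlonglongrightarrow> 0" by blast
  then have "AE x in lebesgue_on U. (\<lambda>n. f (r n) x) \<longlonglongrightarrow> g x"
  proof (elim eventually_mono)
    fix x assume "(\<lambda>n. (norm (f (r n) x - g x))\<^sup>2) \<longlonglongrightarrow> 0"
    then have "(\<lambda>n. sqrt ((norm (f (r n) x - g x))\<^sup>2)) \<longlonglongrightarrow> sqrt 0" by (rule tendsto_real_sqrt)
    then show "(\<lambda>n. f (r n) x) \<longlonglongrightarrow> g x"
      by (simp add: tendsto_norm_zero_iff LIM_zero_iff)
  qed
  with r show ?thesis by (rule that)
qed

section \<open>Square integrable functions on sets of finite measure; completeness\<close>

lemma L2_const: "U \<in> lmeasurable \<Longrightarrow> (\<lambda>x. c) \<in> L2_space U"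
  by (simp add: L2_space_def finite_measure.integrable_const finite_measure_lebesgue_on)

lemma L2_imp_integrable:
  assumes "U \<in> lmeasurable" "f \<in> L2_space U"
  shows "integrable (lebesgue_on U) f"
proof (rule Bochner_Integration.integrable_bound)
  show "integrable (lebesgue_on U) (\<lambda>x. 1 + (norm (f x))\<^sup>2)"
    using assms L2_spaceD(2)[OF assms(2)]
    by (intro Bochner_Integration.integrable_add finite_measure.integrable_const finite_measure_lebesgue_on) auto
  have "t \<le> 1 + t\<^sup>2" for t :: real
    using sum_squares_bound[of 1 t] by (cases "t \<le> 0") (auto intro: order_trans[of t 0])
  then show "AE x in lebesgue_on U. norm (f x) \<le> norm (1 + (norm (f x))\<^sup>2)"
    by (auto simp: abs_of_nonneg)
qed (use assms in \<open>auto simp: L2_space_def\<close>)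

lemma L1_le_L2:
  assumes "U \<in> lmeasurable" "f \<in> L2_space U"
  shows "(\<integral>x. norm (f x) \<partial>lebesgue_on U) \<le> sqrt (measure lebesgue U) * Lq_norm 2 U f"
proof -
  have f: "(\<lambda>x. norm (f x)) \<in> L2_space U" using assms(2) by (auto simp: L2_space_def)
  have 1: "(\<lambda>x. 1::real) \<in> L2_space U" using assms(1) by (rule L2_const)
  have "(\<integral>x. norm (f x) \<partial>lebesgue_on U) = L2_inner U (\<lambda>x. 1) (\<lambda>x. norm (f x))"
    by (simp add: L2_inner_def)
  also have "\<dots> \<le> Lq_norm 2 U (\<lambda>x. 1::real) * Lq_norm 2 U (\<lambda>x. norm (f x))"
    using L2_Cauchy_Schwarz[OF 1 f] by linarith
  also have "Lq_norm 2 U (\<lambda>x. 1::real) = sqrt (measure lebesgue U)"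
    using assms(1) by (simp add: Lq_norm_2 L2_inner_def measure_restrict_space fmeasurableD space_restrict_space)
  also have "Lq_norm 2 U (\<lambda>x. norm (f x)) = Lq_norm 2 U f" by (simp add: Lq_norm_def)
  finally show ?thesis .
qed

text \<open>Riesz-Fischer. A rapidly Cauchy subsequence has increments whose L^1 norms are summable
  (finite measure bounds L^1 by L^2), so it converges almost everywhere; Fatou's lemma then carries
  the Cauchy estimate of the whole sequence over to the limit.\<close>

lemma L2_complete:
  fixes f :: "nat \<Rightarrow> 'a::euclidean_space \<Rightarrow> 'b::euclidean_space"
  assumes U: "U \<in> lmeasurable" and f: "\<And>k. f k \<in> L2_space U"
    and Cauchy: "\<And>e. e > 0 \<Longrightarrow> \<exists>N. \<forall>m\<ge>N. \<forall>n\<ge>N. Lq_norm 2 U (\<lambda>x. f m x - f n x) < e"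
  obtains g where "g \<in> L2_space U" "(\<lambda>k. Lq_norm 2 U (\<lambda>x. f k x - g x)) \<longlonglongrightarrow> 0"
proof -
  let ?M = "lebesgue_on U"
  have fm [measurable]: "f k \<in> borel_measurable ?M" for k using f by (rule L2_spaceD)
  have fd: "(\<lambda>x. f m x - f n x) \<in> L2_space U" for m n using f by (intro L2_diff)
  obtain N where N: "\<And>k m n. m \<ge> N k \<Longrightarrow> n \<ge> N k \<Longrightarrow> Lq_norm 2 U (\<lambda>x. f m x - f n x) < (1/2)^k"
    using Cauchy[of "(1/2)^k" for k] by (metis half_gt_zero_iff zero_less_one zero_less_power)
  \<comment> \<open>The sum makes r monotone with \<open>r k \<ge> N k\<close>; the summand k makes
    r tend to infinity.\<close>
  define r where "r k = k + (\<Sum>i\<le>k. N i)" for k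
  have rN: "r k \<ge> N k" for k
    using member_le_sum[of k "{..k}" N] by (simp add: r_def)
  have rS: "r (Suc k) \<ge> r k" for k by (simp add: r_def)
  have rk: "r k \<ge> k" for k by (simp add: r_def)
  define D where "D k x = f (r (Suc k)) x - f (r k) x" for k x
  have Dm [measurable]: "D k \<in> borel_measurable ?M" for k unfolding D_def by measurable
  have DL: "D k \<in> L2_space U" for k unfolding D_def by (rule fd)
  have D: "Lq_norm 2 U (D k) < (1/2)^k" for k
    unfolding D_def using N[of k "r (Suc k)" "r k"] rN[of k] rS[of k] by force
  have "AE x in ?M. (\<Sum>k. ennreal (norm (D k x))) \<noteq> \<infinity>"
  proof (rule nn_integral_PInf_AE)
    have "(\<integral>\<^sup>+x. (\<Sum>k. ennreal (norm (D k x))) \<partial>?M) = (\<Sum>k. \<integral>\<^sup>+x. ennreal (norm (D k x)) \<partial>?M)"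
      by (rule nn_integral_suminf) measurable
    also have "\<dots> = (\<Sum>k. ennreal (\<integral>x. norm (D k x) \<partial>?M))"
      using L2_imp_integrable[OF U DL] by (intro suminf_cong nn_integral_eq_integral) auto
    also have "\<dots> \<le> (\<Sum>k. ennreal (sqrt (measure lebesgue U) * (1/2)^k))"
    proof (intro suminf_le ennreal_leI)
      fix k
      have "(\<integral>x. norm (D k x) \<partial>?M) \<le> sqrt (measure lebesgue U) * Lq_norm 2 U (D k)"
        by (rule L1_le_L2[OF U DL])
      also have "\<dots> \<le> sqrt (measure lebesgue U) * (1/2)^k"
        using D[of k] by (intro mult_left_mono) auto
      finally show "(\<integral>x. norm (D k x) \<partial>?M) \<le> sqrt (measure lebesgue U) * (1/2)^k" .
    qed auto
    also have "\<dots> = ennreal (\<Sum>k. sqrt (measure lebesgue U) * (1/2)^k)"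
      by (rule suminf_ennreal2) (auto intro!: summable_mult summable_geometric)
    finally show "(\<integral>\<^sup>+x. (\<Sum>k. ennreal (norm (D k x))) \<partial>?M) \<noteq> \<infinity>"
      by (auto simp: top_unique)
  qed measurable
  then have conv: "AE x in ?M. convergent (\<lambda>n. f (r n) x)"
  proof eventually_elim
    case (elim x)
    then have "summable (\<lambda>k. norm (D k x))"
      by (intro summable_suminf_not_top) auto
    then have "summable (\<lambda>k. D k x)" by (rule summable_norm_cancel)
    then have "convergent (\<lambda>n. \<Sum>k<n. D k x)" by (simp add: summable_iff_convergent)
    then have "convergent (\<lambda>n. f (r n) x - f (r 0) x)"
      unfolding D_def using sum_lessThan_telescope[of "\<lambda>k. f (r k) x"] by simp
    from convergent_add[OF this convergent_const[of "f (r 0) x"]] show ?case by simp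
  qed
  define g where "g x = lim (\<lambda>n. f (r n) x)" for x
  have g [measurable]: "g \<in> borel_measurable ?M"
    unfolding g_def by measurable
  have lim: "AE x in ?M. (\<lambda>n. f (r n) x) \<longlonglongrightarrow> g x"
    using conv by eventually_elim (simp add: g_def convergent_LIMSEQ_iff)
  have bound: "(\<integral>\<^sup>+x. ennreal ((norm (f m x - g x))\<^sup>2) \<partial>?M) \<le> ennreal (e\<^sup>2)"
    if e: "e > 0" and m: "\<And>n. n \<ge> K \<Longrightarrow> Lq_norm 2 U (\<lambda>x. f m x - f n x) < e" for m e K
  proof -
    have "(\<integral>\<^sup>+x. ennreal ((norm (f m x - g x))\<^sup>2) \<partial>?M)
        = (\<integral>\<^sup>+x. liminf (\<lambda>n. ennreal ((norm (f m x - f (r n) x))\<^sup>2)) \<partial>?M)"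
    proof (rule nn_integral_cong_AE)
      show "AE x in ?M. ennreal ((norm (f m x - g x))\<^sup>2)
        = liminf (\<lambda>n. ennreal ((norm (f m x - f (r n) x))\<^sup>2))"
        using lim
      proof eventually_elim
        case (elim x)
        then have "(\<lambda>n. ennreal ((norm (f m x - f (r n) x))\<^sup>2)) \<longlonglongrightarrow> ennreal ((norm (f m x - g x))\<^sup>2)"
          by (intro tendsto_intros)
        from lim_imp_Liminf[OF sequentially_bot this] show ?case by simp
      qed
    qed
    also have "\<dots> \<le> liminf (\<lambda>n. \<integral>\<^sup>+x. ennreal ((norm (f m x - f (r n) x))\<^sup>2) \<partial>?M)"
      by (rule nn_integral_liminf) measurable
    also have "\<dots> \<le> ennreal (e\<^sup>2)"
    proof (rule Liminf_le)
      show "\<forall>\<^sub>F n in sequentially. (\<integral>\<^sup>+x. ennreal ((norm (f m x - f (r n) x))\<^sup>2) \<partial>?M) \<le> ennreal (e\<^sup>2)"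
        using eventually_ge_at_top[of K]
      proof eventually_elim
        case (elim n)
        have "(\<integral>\<^sup>+x. ennreal ((norm (f m x - f (r n) x))\<^sup>2) \<partial>?M)
            = ennreal ((Lq_norm 2 U (\<lambda>x. f m x - f (r n) x))\<^sup>2)"
          using nn_integral_eq_integral[OF L2_spaceD(2)[OF fd]]
          by (simp add: Lq_norm_2_power2 L2_inner_def power2_norm_eq_inner)
        also have "\<dots> \<le> ennreal (e\<^sup>2)"
          using m[of "r n"] rk[of n] elim
          by (intro ennreal_leI power_mono) (auto simp: Lq_norm_nonneg intro: less_imp_le)
        finally show ?case .
      qed
    qed simp
    finally show ?thesis .
  qed
  have L: "(\<lambda>x. f m x - g x) \<in> L2_space U \<and> Lq_norm 2 U (\<lambda>x. f m x - g x) \<le> e"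
    if e: "e > 0" and m: "\<And>n. n \<ge> K \<Longrightarrow> Lq_norm 2 U (\<lambda>x. f m x - f n x) < e" for m e K
  proof -
    have "(\<integral>\<^sup>+x. ennreal ((norm (f m x - g x))\<^sup>2) \<partial>?M) \<le> ennreal (e\<^sup>2)"
      by (rule bound[OF that])
    then have i: "integrable ?M (\<lambda>x. (norm (f m x - g x))\<^sup>2)"
      by (intro integrableI_nonneg) (auto intro: le_less_trans)
    then have "ennreal (\<integral>x. (norm (f m x - g x))\<^sup>2 \<partial>?M) \<le> ennreal (e\<^sup>2)"
      using bound[OF that] by (simp add: nn_integral_eq_integral)
    then have "(\<integral>x. (norm (f m x - g x))\<^sup>2 \<partial>?M) \<le> e\<^sup>2" by (simp add: ennreal_le_iff)
    then have "(Lq_norm 2 U (\<lambda>x. f m x - g x))\<^sup>2 \<le> e\<^sup>2"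
      by (simp add: Lq_norm_2_power2 L2_inner_def power2_norm_eq_inner)
    then have "Lq_norm 2 U (\<lambda>x. f m x - g x) \<le> e"
      by (rule power2_le_imp_le) (use e in simp)
    with i show ?thesis by (simp add: L2_space_def)
  qed
  have gL: "g \<in> L2_space U"
  proof -
    have "(\<lambda>x. f (N 0) x - g x) \<in> L2_space U"
      using L[of 1 "N 0" "N 0"] N[of 0 "N 0"] by simp
    from L2_diff[OF f[of "N 0"] this] show ?thesis by simp
  qed
  have "(\<lambda>k. Lq_norm 2 U (\<lambda>x. f k x - g x)) \<longlonglongrightarrow> 0"
  proof (rule LIMSEQ_I)
    fix e :: real assume "e > 0"
    then obtain K where K: "\<forall>m\<ge>K. \<forall>n\<ge>K. Lq_norm 2 U (\<lambda>x. f m x - f n x) < e / 2"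
      using Cauchy[of "e/2"] by auto
    have "norm (Lq_norm 2 U (\<lambda>x. f m x - g x) - 0) < e" if "m \<ge> K" for m
    proof -
      have "Lq_norm 2 U (\<lambda>x. f m x - g x) \<le> e / 2"
        using L[of "e/2" K m] K \<open>e > 0\<close> that by simp
      then show ?thesis using \<open>e > 0\<close> Lq_norm_nonneg[of 2 U "\<lambda>x. f m x - g x"] by simp
    qed
    then show "\<exists>no. \<forall>n\<ge>no. norm (Lq_norm 2 U (\<lambda>x. f n x - g x) - 0) < e"
      by blast
  qed
  with gL show ?thesis by (rule that)
qed

section \<open>Smooth functions\<close>

text \<open>In the product and chain rules an undifferentiated factor stands beside a derivative, so
  the induction needs it in the lower class as well.\<close>

lemma Ck_on_Suc_imp: "Ck_on (Suc k) UNIV f \<Longrightarrow> Ck_on k UNIV f"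
proof (induction k arbitrary: f)
  case 0
  then show ?case
    by (auto simp: continuous_on_eq_continuous_at intro: differentiable_imp_continuous_within)
next
  case (Suc k)
  then show ?case by simp
qed

lemma
  assumes "smooth_fun f"
  shows smooth_fun_differentiable: "f differentiable (at x)"
    and smooth_fun_continuous: "continuous_on S f"
    and smooth_fun_derivative: "b \<in> Basis \<Longrightarrow> smooth_fun (\<lambda>x. frechet_derivative f (at x) b)"
proof -
  have *: "Ck_on k UNIV f" for k using assms by (simp add: smooth_fun_def)
  show "f differentiable (at x)" using *[of 1] by simp
  show "continuous_on S f" using *[of 0] by (auto intro: continuous_on_subset)
  show "b \<in> Basis \<Longrightarrow> smooth_fun (\<lambda>x. frechet_derivative f (at x) b)"
    using * unfolding smooth_fun_def by (metis Ck_on.simps(2))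
qed

lemma Ck_on_const: "Ck_on k UNIV (\<lambda>x. c)"
  by (induction k arbitrary: c) auto

lemma Ck_on_bounded_linear:
  assumes "bounded_linear f"
  shows "Ck_on k UNIV f"
proof (cases k)
  case 0
  then show ?thesis using assms by (simp add: linear_continuous_on)
next
  case (Suc k')
  have "frechet_derivative f (at x) = f" for x
    using assms by (metis bounded_linear_imp_has_derivative frechet_derivative_at)
  then show ?thesis
    using Suc assms Ck_on_const by (auto intro: bounded_linear_imp_differentiable)
qed

lemma Ck_on_add:
  "Ck_on k UNIV f \<Longrightarrow> Ck_on k UNIV g \<Longrightarrow> Ck_on k UNIV (\<lambda>x. f x + g x)"
proof (induction k arbitrary: f g)
  case 0
  then show ?case by (auto intro: continuous_on_add)
next
  case (Suc k)
  then have d: "frechet_derivative (\<lambda>x. f x + g x) (at x) b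
      = frechet_derivative f (at x) b + frechet_derivative g (at x) b" for x b
    by (subst frechet_derivative_at[OF has_derivative_add, symmetric])
       (auto simp: frechet_derivative_works[symmetric])
  show ?case
    using Suc by (auto simp: d)
qed

lemma Ck_on_mult:
  "Ck_on k UNIV f \<Longrightarrow> Ck_on k UNIV g \<Longrightarrow> Ck_on k UNIV (\<lambda>x. f x * g x)"
proof (induction k arbitrary: f g)
  case 0
  then show ?case by (auto intro: continuous_on_mult)
next
  case (Suc k)
  then have d: "frechet_derivative (\<lambda>x. f x * g x) (at x) b
      = f x * frechet_derivative g (at x) b + frechet_derivative f (at x) b * g x" for x b
    by (subst frechet_derivative_at[OF has_derivative_mult, symmetric])
       (auto simp: frechet_derivative_works[symmetric])
  have "Ck_on k UNIV f" "Ck_on k UNIV g" using Suc.prems by (auto dest: Ck_on_Suc_imp simp del: Ck_on.simps)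
  with Suc show ?case
    by (auto simp: d differentiable_mult intro!: Ck_on_add)
qed

lemma frechet_derivative_compose_real:
  fixes f :: "'a::euclidean_space \<Rightarrow> real" and g :: "real \<Rightarrow> real"
  assumes "f differentiable (at x)" "g differentiable (at (f x))"
  shows "frechet_derivative (\<lambda>x. g (f x)) (at x) b = deriv g (f x) * frechet_derivative f (at x) b"
proof -
  have "(g has_derivative (\<lambda>h. deriv g (f x) * h)) (at (f x))"
    using assms(2) DERIV_deriv_iff_real_differentiable has_field_derivative_def by blast
  from has_derivative_compose[OF assms(1)[unfolded frechet_derivative_works] this]
  show ?thesis by (metis frechet_derivative_at)
qed

lemma frechet_derivative_real:
  fixes g :: "real \<Rightarrow> real"
  assumes "g differentiable (at x)"
  shows "frechet_derivative g (at x) h = deriv g x * h"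
proof -
  have "(g has_derivative (\<lambda>h. deriv g x * h)) (at x)"
    using assms DERIV_deriv_iff_real_differentiable has_field_derivative_def by blast
  then show ?thesis by (metis frechet_derivative_at)
qed

lemma Ck_on_Suc_real:
  fixes g :: "real \<Rightarrow> real"
  shows "Ck_on (Suc k) UNIV g \<longleftrightarrow> (\<forall>x. g differentiable (at x)) \<and> Ck_on k UNIV (deriv g)"
proof -
  have "(\<lambda>x. frechet_derivative g (at x) 1) = deriv g" if "\<forall>x. g differentiable (at x)"
    using that by (auto simp: frechet_derivative_real)
  then show ?thesis by auto
qed

lemma Ck_on_compose:
  fixes f :: "'a::euclidean_space \<Rightarrow> real" and g :: "real \<Rightarrow> real"
  shows "Ck_on k UNIV g \<Longrightarrow> Ck_on k UNIV f \<Longrightarrow> Ck_on k UNIV (\<lambda>x. g (f x))"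
proof (induction k arbitrary: f g)
  case 0
  then show ?case by (auto intro: continuous_on_compose2)
next
  case (Suc k)
  then have g: "\<forall>x. g differentiable (at x)" "Ck_on k UNIV (deriv g)"
    by (auto simp only: Ck_on_Suc_real)
  have f: "\<forall>x. f differentiable (at x)" using Suc by simp
  have d: "frechet_derivative (\<lambda>x. g (f x)) (at x) b = deriv g (f x) * frechet_derivative f (at x) b" for x b
    using f g(1) by (intro frechet_derivative_compose_real) auto
  have "Ck_on k UNIV (\<lambda>x. deriv g (f x))"
    using Suc.IH[OF g(2)] Suc.prems(2) Ck_on_Suc_imp by blast
  moreover have "(\<lambda>x. g (f x)) differentiable (at x)" for x
    using f g(1) by (metis differentiable_compose)
  ultimately show ?case
    using Suc.prems(2) by (auto simp: d intro!: Ck_on_mult)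
qed

lemma smooth_const [intro]: "smooth_fun (\<lambda>x. c)"
  and smooth_add [intro]: "smooth_fun f \<Longrightarrow> smooth_fun g \<Longrightarrow> smooth_fun (\<lambda>x. f x + g x)"
  and smooth_mult [intro]: "smooth_fun f \<Longrightarrow> smooth_fun g \<Longrightarrow> smooth_fun (\<lambda>x. f x * g x)"
  and smooth_bounded_linear: "bounded_linear f \<Longrightarrow> smooth_fun f"
  and smooth_compose: "smooth_fun h \<Longrightarrow> smooth_fun f \<Longrightarrow> smooth_fun (\<lambda>x. h (f x))"
  by (simp_all add: smooth_fun_def Ck_on_const Ck_on_add Ck_on_mult Ck_on_bounded_linear Ck_on_compose)

lemma smooth_diff [intro]:
  assumes "smooth_fun f" "smooth_fun g"
  shows "smooth_fun (\<lambda>x. f x - g x)"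
  using smooth_add[OF assms(1) smooth_mult[OF smooth_const[of "-1"] assms(2)]] by simp

lemma smooth_prod:
  assumes "finite I" "\<And>i. i \<in> I \<Longrightarrow> smooth_fun (f i)"
  shows "smooth_fun (\<lambda>x. \<Prod>i\<in>I. f i x)"
  using assms by (induction I rule: finite_induct) auto

section \<open>The flat function exp(-1/x) and a smooth step\<close>

definition exp_inv :: "real \<Rightarrow> real" where
  "exp_inv x = (if x > 0 then exp (- 1 / x) else 0)"

lemma exp_inv_nonneg: "0 \<le> exp_inv x" and exp_inv_le_1: "exp_inv x \<le> 1"
  and exp_inv_nonpos: "x \<le> 0 \<Longrightarrow> exp_inv x = 0" and exp_inv_pos: "x > 0 \<Longrightarrow> exp_inv x > 0"
  by (auto simp: exp_inv_def)

lemma exp_inv_over_power_tendsto: "((\<lambda>x. exp_inv x / x ^ m) \<longlongrightarrow> 0) (at 0)"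
proof -
  have r: "((\<lambda>x. exp_inv x / x ^ m) \<longlongrightarrow> 0) (at_right 0)"
  proof -
    have "((\<lambda>y::real. y ^ m / exp y) \<longlongrightarrow> 0) at_top" by (rule tendsto_power_div_exp_0)
    then have "((\<lambda>x. (inverse x) ^ m / exp (inverse x)) \<longlongrightarrow> 0) (at_right (0::real))"
      by (rule filterlim_compose) (rule filterlim_inverse_at_top_right)
    then show ?thesis
    proof (rule Lim_transform_eventually)
      show "\<forall>\<^sub>F x in at_right 0. (inverse x) ^ m / exp (inverse x) = exp_inv x / x ^ m"
        unfolding eventually_at_right_field
        by (intro exI[of _ 1]) (auto simp: exp_inv_def exp_minus field_simps power_inverse)
    qed
  qed
  have l: "((\<lambda>x. exp_inv x / x ^ m) \<longlongrightarrow> 0) (at_left 0)"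
  proof (rule Lim_transform_eventually[OF tendsto_const])
    show "\<forall>\<^sub>F x in at_left 0. 0 = exp_inv x / x ^ m"
      unfolding eventually_at_left_field
      by (intro exI[of _ "-1"]) (auto simp: exp_inv_def)
  qed
  from l r show ?thesis by (simp add: filterlim_split_at)
qed

text \<open>The linear span of the functions \<open>exp_inv x / x ^ m\<close> is closed under
  differentiation, so smoothness follows by induction on the class for all m at once. At 0 the
  difference quotient is the member with exponent m + 1, and division by zero gives the right value
  0.\<close>

lemma exp_inv_over_power_deriv:
  "((\<lambda>x. exp_inv x / x ^ m) has_real_derivative
     (- real m * (exp_inv x / x ^ Suc m) + exp_inv x / x ^ (m + 2))) (at x)"
proof -
  consider "x < 0" | "x = 0" | "x > 0" by linarith
  then show ?thesis
  proof cases
    case 1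
    have "((\<lambda>x. 0) has_real_derivative 0) (at x)" by simp
    then have "((\<lambda>x. exp_inv x / x ^ m) has_real_derivative 0) (at x)"
      by (rule has_field_derivative_transform_within_open[of _ _ _ "{..<0}"])
         (use 1 in \<open>auto simp: exp_inv_def\<close>)
    then show ?thesis using 1 by (simp add: exp_inv_def)
  next
    case 2
    have "((\<lambda>h. exp_inv h / h ^ Suc m) \<longlongrightarrow> 0) (at 0)" by (rule exp_inv_over_power_tendsto)
    then have "((\<lambda>h. (exp_inv (0 + h) / (0 + h) ^ m - exp_inv 0 / 0 ^ m) / h) \<longlongrightarrow> 0) (at 0)"
      by (simp add: exp_inv_nonpos mult.commute)
    then show ?thesis using 2 by (simp add: DERIV_def exp_inv_nonpos)
  next
    case 3
    have "((\<lambda>x. exp (- 1 / x) / x ^ m) has_real_derivative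
     (- real m * (exp (- 1 / x) / x ^ Suc m) + exp (- 1 / x) / x ^ (m + 2))) (at x)"
      using 3
      by (auto intro!: derivative_eq_intros simp: field_simps power2_eq_square; cases m; simp add: field_simps)
    then have "((\<lambda>x. exp_inv x / x ^ m) has_real_derivative
     (- real m * (exp (- 1 / x) / x ^ Suc m) + exp (- 1 / x) / x ^ (m + 2))) (at x)"
      by (rule has_field_derivative_transform_within_open[of _ _ _ "{0<..}"])
         (use 3 in \<open>auto simp: exp_inv_def\<close>)
    then show ?thesis using 3 by (simp add: exp_inv_def)
  qed
qed

lemma Ck_on_exp_inv_over_power: "Ck_on k UNIV (\<lambda>x. exp_inv x / x ^ m)"
proof (induction k arbitrary: m)
  case 0
  show ?case
    using DERIV_isCont[OF exp_inv_over_power_deriv] by (auto simp: continuous_on_eq_continuous_at)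
next
  case (Suc k)
  have "deriv (\<lambda>x. exp_inv x / x ^ m)
      = (\<lambda>x. - real m * (exp_inv x / x ^ Suc m) + exp_inv x / x ^ (m + 2))"
    using DERIV_imp_deriv[OF exp_inv_over_power_deriv] by blast
  moreover have "Ck_on k UNIV (\<lambda>x. - real m * (exp_inv x / x ^ Suc m) + exp_inv x / x ^ (m + 2))"
    by (intro Ck_on_add Ck_on_mult Ck_on_const Suc.IH)
  moreover have "(\<lambda>x. exp_inv x / x ^ m) differentiable (at x)" for x
    using exp_inv_over_power_deriv real_differentiable_def by blast
  ultimately show ?case unfolding Ck_on_Suc_real by simp
qed

lemma smooth_exp_inv: "smooth_fun exp_inv"
  using Ck_on_exp_inv_over_power[of _ 0] by (simp add: smooth_fun_def)

lemma exp_inv_mono: "x \<le> y \<Longrightarrow> exp_inv x \<le> exp_inv y"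
  by (auto simp: exp_inv_def field_simps)

lemma exp_inv_scale_tendsto: "x > 0 \<Longrightarrow> (\<lambda>k. exp_inv (real (Suc k) * x)) \<longlonglongrightarrow> 1"
proof -
  assume x: "x > 0"
  have "(\<lambda>k. exp (- (inverse x * inverse (real (Suc k))))) \<longlonglongrightarrow> exp (- (inverse x * 0))"
    by (intro tendsto_intros LIMSEQ_inverse_real_of_nat)
  moreover have "exp_inv (real (Suc k) * x) = exp (- (inverse x * inverse (real (Suc k))))" for k
    using x by (simp add: exp_inv_def zero_less_mult_iff) (simp add: field_simps)
  ultimately show ?thesis by simp
qed

text \<open>\<open>exp_inv (1 - x)\<close> is at least \<open>exp (-1)\<close> for \<open>x \<le> 0\<close> and vanishes for \<open>x \<ge> 1\<close>; the outer
  composition saves a quotient of smooth functions.\<close>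

definition smooth_step :: "real \<Rightarrow> real" where
  "smooth_step x = exp_inv (exp (-1) - exp_inv (1 - x)) / exp_inv (exp (-1))"

lemma smooth_smooth_step: "smooth_fun smooth_step"
proof -
  have 1: "smooth_fun (\<lambda>x. exp_inv (1 - x))"
    by (intro smooth_compose[OF smooth_exp_inv] smooth_diff smooth_const smooth_bounded_linear bounded_linear_ident)
  have "smooth_fun (\<lambda>x. 1 / exp_inv (exp (-1)) * exp_inv (exp (-1) - exp_inv (1 - x)))"
    by (intro smooth_mult smooth_const smooth_compose[OF smooth_exp_inv] smooth_diff 1)
  then show ?thesis by (simp add: smooth_step_def[abs_def])
qed

lemma smooth_step_mono: "x \<le> y \<Longrightarrow> smooth_step x \<le> smooth_step y"
  unfolding smooth_step_def
  by (intro divide_right_mono exp_inv_mono exp_inv_nonneg diff_left_mono) auto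

lemma smooth_step_le_0: "x \<le> 0 \<Longrightarrow> smooth_step x = 0"
proof -
  assume "x \<le> 0"
  then have "exp_inv 1 \<le> exp_inv (1 - x)" by (intro exp_inv_mono) auto
  then show ?thesis by (simp add: smooth_step_def exp_inv_nonpos) (simp add: exp_inv_def)
qed

lemma smooth_step_ge_1: "x \<ge> 1 \<Longrightarrow> smooth_step x = 1"
  using exp_inv_pos[of "exp (-1)"] by (simp add: smooth_step_def exp_inv_nonpos)

section \<open>Test functions\<close>

lemma frechet_derivative_outside:
  fixes f :: "'a::euclidean_space \<Rightarrow> real"
  assumes "closed K" "\<And>x. x \<notin> K \<Longrightarrow> f x = 0" "x \<notin> K"
  shows "frechet_derivative f (at x) b = 0"
proof -
  have "(f has_derivative (\<lambda>h. 0)) (at x)"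
  proof (rule has_derivative_transform_within_open)
    show "((\<lambda>x. 0) has_derivative (\<lambda>h. 0)) (at x)" by simp
    show "open (- K)" using assms(1) by auto
  qed (use assms in auto)
  then show ?thesis by (metis frechet_derivative_at)
qed

lemma bounded_range_of_compact_support:
  fixes f :: "'a::euclidean_space \<Rightarrow> real"
  assumes "continuous_on UNIV f" "compact K" "\<And>x. x \<notin> K \<Longrightarrow> f x = 0"
  obtains B where "B \<ge> 0" "\<And>x. \<bar>f x\<bar> \<le> B"
proof -
  have "compact (f ` K)" using assms(1,2) by (intro compact_continuous_image) (auto intro: continuous_on_subset)
  then obtain B where B: "\<And>x. x \<in> K \<Longrightarrow> \<bar>f x\<bar> \<le> B"
    by (metis bounded_real compact_imp_bounded imageI)
  show ?thesis
  proof (rule that)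
    show "\<bar>f x\<bar> \<le> max B 0" for x using B[of x] assms(3)[of x] by (cases "x \<in> K") auto
  qed simp
qed

lemma integrable_compact_support:
  fixes f :: "'a::euclidean_space \<Rightarrow> real"
  assumes "continuous_on UNIV f" "compact K" "\<And>x. x \<notin> K \<Longrightarrow> f x = 0"
  shows "integrable lborel f"
proof -
  have "integrable lborel (\<lambda>x. indicator K x *\<^sub>R f x)"
    using assms by (intro borel_integrable_compact) (auto intro: continuous_on_subset)
  also have "(\<lambda>x. indicator K x *\<^sub>R f x) = f" using assms(3) by (fastforce simp: indicator_def)
  finally show ?thesis .
qed

lemma integral_lborel_translation:
  fixes f :: "'a::euclidean_space \<Rightarrow> real"
  assumes [measurable]: "f \<in> borel_measurable borel"
  shows "(\<integral>x. f (x + c) \<partial>lborel) = (\<integral>x. f x \<partial>lborel)"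
proof -
  have "(\<integral>x. f x \<partial>lborel) = (\<integral>x. f x \<partial>distr lborel borel ((+) c))" by (simp add: lborel_distr_plus)
  also have "\<dots> = (\<integral>x. f (c + x) \<partial>lborel)" by (rule integral_distr) auto
  finally show ?thesis by (simp add: add.commute)
qed

text \<open>The difference quotients have integral \<open>0\<close> by translation invariance.\<close>

lemma integral_derivative_compact_support:
  fixes F :: "'a::euclidean_space \<Rightarrow> real"
  assumes F: "\<And>x. F differentiable (at x)"
    and cont: "continuous_on UNIV (\<lambda>x. frechet_derivative F (at x) b)"
    and K: "compact K" "\<And>x. x \<notin> K \<Longrightarrow> F x = 0"
  shows "(\<integral>x. frechet_derivative F (at x) b \<partial>lborel) = 0"
proof -
  define D where "D x = frechet_derivative F (at x) b" for x
  have line: "((\<lambda>t. F (x + t *\<^sub>R b)) has_real_derivative D (x + t *\<^sub>R b)) (at t)" for x t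
  proof -
    have 1: "((\<lambda>t. x + t *\<^sub>R b) has_derivative (\<lambda>s. s *\<^sub>R b)) (at t)"
      by (auto intro!: derivative_eq_intros)
    have 2: "(F has_derivative frechet_derivative F (at (x + t *\<^sub>R b))) (at (x + t *\<^sub>R b))"
      using F frechet_derivative_works by blast
    have "((\<lambda>t. F (x + t *\<^sub>R b)) has_derivative (\<lambda>s. frechet_derivative F (at (x + t *\<^sub>R b)) (s *\<^sub>R b))) (at t)"
      by (rule has_derivative_compose[OF 1 2])
    moreover have "frechet_derivative F (at (x + t *\<^sub>R b)) (s *\<^sub>R b) = D (x + t *\<^sub>R b) * s" for s
      using linear_scale[OF linear_frechet_derivative[OF F]] by (simp add: D_def)
    ultimately show ?thesis by (simp add: has_field_derivative_def)
  qed
  have "D x = 0" if "x \<notin> K" for x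
    unfolding D_def using frechet_derivative_outside[OF compact_imp_closed[OF K(1)] K(2) that] .
  then obtain B where B: "B \<ge> 0" "\<And>x. \<bar>D x\<bar> \<le> B"
    using bounded_range_of_compact_support[OF cont K(1)] unfolding D_def by metis
  obtain R where R: "\<And>x. x \<in> K \<Longrightarrow> norm x \<le> R"
    using compact_imp_bounded[OF K(1)] bounded_iff by blast
  have Fc: "continuous_on UNIV F"
    using F by (auto simp: continuous_on_eq_continuous_at intro: differentiable_imp_continuous_within)
  then have Fm [measurable]: "F \<in> borel_measurable borel" by (rule borel_measurable_continuous_onI)
  have Fi: "integrable lborel F" by (rule integrable_compact_support[OF Fc K])
  define q where "q k x = real (Suc k) * (F (x + inverse (real (Suc k)) *\<^sub>R b) - F x)" for k x
  have Fc': "continuous_on UNIV (\<lambda>x. F (x + c))" for c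
    by (rule continuous_on_compose2[OF Fc]) (auto intro!: continuous_intros)
  have Fi': "integrable lborel (\<lambda>x. F (x + c))" for c
  proof (rule integrable_compact_support[OF Fc'])
    show "compact ((\<lambda>x. x - c) ` K)" using K(1) by (intro compact_continuous_image continuous_intros)
    show "F (x + c) = 0" if "x \<notin> (\<lambda>x. x - c) ` K" for x
      using that K(2) by (metis add_diff_cancel_right' image_eqI)
  qed
  have "(\<integral>x. q k x \<partial>lborel) = 0" for k
    unfolding q_def using Fi Fi' by (simp add: integral_lborel_translation)
  moreover have "(\<lambda>k. \<integral>x. q k x \<partial>lborel) \<longlonglongrightarrow> (\<integral>x. D x \<partial>lborel)"
  proof (rule integral_dominated_convergence)
    show "D \<in> borel_measurable lborel" using cont unfolding D_def by (simp add: borel_measurable_continuous_onI)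
    show "q k \<in> borel_measurable lborel" for k unfolding q_def by measurable
    \<comment> \<open>By the mean value theorem the quotients are bounded by B; since the step is at
      most 1, they vanish outside the ball enlarged by \<open>norm b\<close>.\<close>
    show "integrable lborel (\<lambda>x. indicator (cball 0 (R + norm b)) x * B)"
      using emeasure_bounded_finite[OF bounded_cball] by (intro integrable_mult_left integrable_real_indicator) auto
    show "AE x in lborel. norm (q k x) \<le> indicator (cball 0 (R + norm b)) x * B" for k
    proof (rule AE_I2)
      fix x
      let ?h = "inverse (real (Suc k))"
      have h: "0 < ?h" "?h \<le> 1" by (auto simp: field_simps)
      show "norm (q k x) \<le> indicator (cball 0 (R + norm b)) x * B"
      proof (cases "x \<in> cball 0 (R + norm b)")
        case True
        obtain z where "F (x + ?h *\<^sub>R b) - F (x + 0 *\<^sub>R b) = (?h - 0) * D (x + z *\<^sub>R b)"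
          using MVT2[of 0 ?h "\<lambda>t. F (x + t *\<^sub>R b)" "\<lambda>t. D (x + t *\<^sub>R b)"] h line by blast
        then have "q k x = D (x + z *\<^sub>R b)" by (simp add: q_def)
        then show ?thesis using True B by simp
      next
        case False
        then have n: "norm x > R + norm b" by simp
        then have "x \<notin> K" using R[of x] norm_ge_zero[of b] by linarith
        moreover have "x + ?h *\<^sub>R b \<notin> K"
        proof
          assume "x + ?h *\<^sub>R b \<in> K"
          then have "norm (x + ?h *\<^sub>R b) \<le> R" by (rule R)
          moreover have "norm (?h *\<^sub>R b) \<le> norm b" using h by (simp add: mult_left_le_one_le)
          ultimately show False using n norm_triangle_ineq4[of "x + ?h *\<^sub>R b" "?h *\<^sub>R b"] by simp
        qed
        ultimately show ?thesis using B by (simp add: q_def K(2))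
      qed
    qed
    show "AE x in lborel. (\<lambda>k. q k x) \<longlonglongrightarrow> D x"
    proof (rule AE_I2)
      fix x
      have "((\<lambda>h. (F (x + (0 + h) *\<^sub>R b) - F (x + 0 *\<^sub>R b)) / h) \<longlongrightarrow> D (x + 0 *\<^sub>R b)) (at 0)"
        using line[of x 0] unfolding DERIV_def .
      moreover have "filterlim (\<lambda>k. inverse (real (Suc k))) (at 0) sequentially"
        unfolding filterlim_at using LIMSEQ_inverse_real_of_nat by auto
      ultimately have "(\<lambda>k. (F (x + (0 + inverse (real (Suc k))) *\<^sub>R b) - F (x + 0 *\<^sub>R b)) / inverse (real (Suc k)))
         \<longlonglongrightarrow> D (x + 0 *\<^sub>R b)"
        by (rule filterlim_compose)
      then show "(\<lambda>k. q k x) \<longlonglongrightarrow> D x" by (simp add: q_def divide_inverse mult.commute)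
    qed
  qed
  ultimately have "(\<integral>x. D x \<partial>lborel) = 0" by (simp add: LIMSEQ_const_iff)
  then show ?thesis by (simp add: D_def)
qed

lemma test_functionsE:
  assumes "\<phi> \<in> test_functions U"
  obtains K where "smooth_fun \<phi>" "compact K" "K \<subseteq> U" "\<And>x. x \<notin> K \<Longrightarrow> \<phi> x = 0"
  using assms by (auto simp: test_functions_def)

lemma test_functionsI:
  "smooth_fun \<phi> \<Longrightarrow> compact K \<Longrightarrow> K \<subseteq> U \<Longrightarrow> (\<And>x. x \<notin> K \<Longrightarrow> \<phi> x = 0) \<Longrightarrow> \<phi> \<in> test_functions U"
  by (auto simp: test_functions_def)

lemma test_smooth: "\<phi> \<in> test_functions U \<Longrightarrow> smooth_fun \<phi>"
  by (auto simp: test_functions_def)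

lemma test_zero: "(\<lambda>x. 0) \<in> test_functions U"
  by (rule test_functionsI[of _ "{}"]) auto

lemma test_mult_smooth:
  assumes "\<phi> \<in> test_functions U" "smooth_fun \<psi>"
  shows "(\<lambda>x. \<psi> x * \<phi> x) \<in> test_functions U"
  using assms by (elim test_functionsE) (auto intro: test_functionsI)

lemma test_mult: "\<phi> \<in> test_functions U \<Longrightarrow> \<psi> \<in> test_functions U \<Longrightarrow> (\<lambda>x. \<phi> x * \<psi> x) \<in> test_functions U"
  by (rule test_mult_smooth[OF _ test_smooth])

lemma test_add:
  assumes "\<phi> \<in> test_functions U" "\<psi> \<in> test_functions U"
  shows "(\<lambda>x. \<phi> x + \<psi> x) \<in> test_functions U"
proof -
  obtain K where K: "compact K" "K \<subseteq> U" "\<And>x. x \<notin> K \<Longrightarrow> \<phi> x = 0" using assms(1) by (rule test_functionsE) blast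
  obtain L where L: "compact L" "L \<subseteq> U" "\<And>x. x \<notin> L \<Longrightarrow> \<psi> x = 0" using assms(2) by (rule test_functionsE) blast
  show ?thesis
    using K L assms by (intro test_functionsI[of _ "K \<union> L"]) (auto intro: test_smooth)
qed

lemma test_scale: "\<phi> \<in> test_functions U \<Longrightarrow> (\<lambda>x. c * \<phi> x) \<in> test_functions U"
  by (rule test_mult_smooth) auto

lemma test_sum:
  "(\<And>i. i \<in> I \<Longrightarrow> \<phi> i \<in> test_functions U) \<Longrightarrow> (\<lambda>x. \<Sum>i\<in>I. \<phi> i x) \<in> test_functions U"
  by (induction I rule: infinite_finite_induct) (auto intro: test_zero test_add)

lemma test_derivative:
  assumes "\<phi> \<in> test_functions U" "b \<in> Basis"
  shows "(\<lambda>x. frechet_derivative \<phi> (at x) b) \<in> test_functions U"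
  using assms
  by (elim test_functionsE)
     (auto intro!: test_functionsI smooth_fun_derivative frechet_derivative_outside compact_imp_closed)

lemma test_outside: "\<phi> \<in> test_functions U \<Longrightarrow> x \<notin> U \<Longrightarrow> \<phi> x = 0"
  by (auto simp: test_functions_def)

lemma test_continuous: "\<phi> \<in> test_functions U \<Longrightarrow> continuous_on S \<phi>"
  by (auto dest: test_smooth intro: smooth_fun_continuous)

lemma test_bounded:
  assumes "\<phi> \<in> test_functions U"
  obtains B where "B \<ge> 0" "\<And>x. \<bar>\<phi> x\<bar> \<le> B"
  using assms by (metis test_functionsE bounded_range_of_compact_support test_continuous)

lemma test_integrable: "\<phi> \<in> test_functions U \<Longrightarrow> integrable lborel \<phi>"
  using test_continuous by (metis test_functionsE integrable_compact_support)

lemma test_measurable [measurable_dest]: "\<phi> \<in> test_functions U \<Longrightarrow> \<phi> \<in> borel_measurable borel"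
  by (auto intro: borel_measurable_continuous_onI test_continuous)

lemma test_measurable_on: "\<phi> \<in> test_functions U \<Longrightarrow> \<phi> \<in> borel_measurable (lebesgue_on S)"
  by (intro measurable_restrict_space1 measurable_completion) (simp add: test_measurable)

text \<open>Passes from \<open>lebesgue_on U\<close>, in which weak notions are phrased, to
  \<open>lborel\<close>, where translation invariance and compact supports are handled.\<close>

lemma integral_lebesgue_on_vanish:
  fixes f :: "'a::euclidean_space \<Rightarrow> real"
  assumes "U \<in> sets lebesgue" "f \<in> borel_measurable borel" "\<And>x. x \<notin> U \<Longrightarrow> f x = 0"
  shows "(\<integral>x. f x \<partial>lebesgue_on U) = (\<integral>x. f x \<partial>lborel)"
    and "integrable (lebesgue_on U) f \<longleftrightarrow> integrable lborel f"
proof -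
  have *: "(\<lambda>x. indicator U x *\<^sub>R f x) = f" using assms(3) by (fastforce simp: indicator_def)
  show "(\<integral>x. f x \<partial>lebesgue_on U) = (\<integral>x. f x \<partial>lborel)"
    using assms(1,2) * by (simp add: integral_restrict_space integral_completion)
  show "integrable (lebesgue_on U) f \<longleftrightarrow> integrable lborel f"
    using assms(1,2) * by (simp add: integrable_restrict_space integrable_completion)
qed

lemma integral_test:
  assumes "U \<in> sets lebesgue" "\<phi> \<in> test_functions U"
  shows "(\<integral>x. \<phi> x \<partial>lebesgue_on U) = (\<integral>x. \<phi> x \<partial>lborel)"
  by (rule integral_lebesgue_on_vanish) (use assms in \<open>auto intro: test_measurable test_outside\<close>)

lemma test_integrable_on:
  assumes "U \<in> sets lebesgue" "\<phi> \<in> test_functions U"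
  shows "integrable (lebesgue_on U) \<phi>"
  using integral_lebesgue_on_vanish(2)[of U \<phi>] assms
  by (auto intro: test_measurable test_outside test_integrable)

lemma test_L2:
  assumes "U \<in> sets lebesgue" "\<phi> \<in> test_functions U"
  shows "\<phi> \<in> L2_space U"
  using test_integrable_on[OF assms(1) test_mult[OF assms(2,2)]] test_measurable_on[OF assms(2)]
  by (simp add: L2_space_def power2_eq_square)

lemma integral_test_derivative:
  assumes "U \<in> sets lebesgue" "\<phi> \<in> test_functions U" "b \<in> Basis"
  shows "(\<integral>x. frechet_derivative \<phi> (at x) b \<partial>lebesgue_on U) = 0"
proof -
  obtain K where K: "smooth_fun \<phi>" "compact K" "K \<subseteq> U" "\<And>x. x \<notin> K \<Longrightarrow> \<phi> x = 0"
    using assms(2) by (rule test_functionsE) blast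
  have "(\<integral>x. frechet_derivative \<phi> (at x) b \<partial>lborel) = 0"
    using K assms(3)
    by (intro integral_derivative_compact_support[of _ _ K] smooth_fun_differentiable
         smooth_fun_continuous[OF smooth_fun_derivative]) auto
  then show ?thesis using integral_test[OF assms(1) test_derivative[OF assms(2,3)]] by simp
qed

lemma frechet_derivative_mult:
  fixes f g :: "'a::euclidean_space \<Rightarrow> real"
  assumes "f differentiable (at x)" "g differentiable (at x)"
  shows "frechet_derivative (\<lambda>x. f x * g x) (at x) b
      = f x * frechet_derivative g (at x) b + frechet_derivative f (at x) b * g x"
  using assms
  by (subst frechet_derivative_at[OF has_derivative_mult, symmetric])
     (auto simp: frechet_derivative_works[symmetric])

lemma integral_by_parts_test:
  assumes U: "U \<in> sets lebesgue" and \<phi>: "\<phi> \<in> test_functions U" and \<psi>: "\<psi> \<in> test_functions U" and b: "b \<in> Basis"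
  shows "(\<integral>x. \<phi> x * frechet_derivative \<psi> (at x) b \<partial>lebesgue_on U)
       = - (\<integral>x. frechet_derivative \<phi> (at x) b * \<psi> x \<partial>lebesgue_on U)"
proof -
  have i: "integrable (lebesgue_on U) (\<lambda>x. \<phi> x * frechet_derivative \<psi> (at x) b)"
    "integrable (lebesgue_on U) (\<lambda>x. frechet_derivative \<phi> (at x) b * \<psi> x)"
    by (intro test_integrable_on U test_mult \<phi> \<psi> test_derivative b)+
  have "0 = (\<integral>x. frechet_derivative (\<lambda>x. \<phi> x * \<psi> x) (at x) b \<partial>lebesgue_on U)"
    using integral_test_derivative[OF U test_mult[OF \<phi> \<psi>] b] by simp
  also have "\<dots> = (\<integral>x. \<phi> x * frechet_derivative \<psi> (at x) b + frechet_derivative \<phi> (at x) b * \<psi> x \<partial>lebesgue_on U)"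
    using \<phi> \<psi> by (simp add: frechet_derivative_mult test_smooth smooth_fun_differentiable)
  also have "\<dots> = (\<integral>x. \<phi> x * frechet_derivative \<psi> (at x) b \<partial>lebesgue_on U)
       + (\<integral>x. frechet_derivative \<phi> (at x) b * \<psi> x \<partial>lebesgue_on U)"
    using i by simp
  finally show ?thesis by simp
qed

text \<open>A smooth approximation of the indicator of the open box: as k grows, every factor tends
  to 1 where its argument is positive and is 0 elsewhere.\<close>

definition box_bump :: "'a::euclidean_space \<Rightarrow> 'a \<Rightarrow> nat \<Rightarrow> 'a \<Rightarrow> real" where
  "box_bump a b k x = (\<Prod>i\<in>Basis. exp_inv (real (Suc k) * (x \<bullet> i - a \<bullet> i)) * exp_inv (real (Suc k) * (b \<bullet> i - x \<bullet> i)))"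

lemma box_bump_outside: "x \<notin> box a b \<Longrightarrow> box_bump a b k x = 0"
  unfolding box_bump_def
  by (rule prod_zero) (auto simp: mem_box not_less mult_le_0_iff intro!: exp_inv_nonpos bexI)

lemma box_bump_test:
  assumes "cbox a b \<subseteq> U"
  shows "box_bump a b k \<in> test_functions U"
proof (rule test_functionsI)
  show "smooth_fun (box_bump a b k)"
    unfolding box_bump_def
    by (intro smooth_prod smooth_mult smooth_compose[OF smooth_exp_inv] smooth_diff smooth_const
        smooth_bounded_linear bounded_linear_inner_left finite_Basis)
  show "box_bump a b k x = 0" if "x \<notin> cbox a b" for x
    using that box_subset_cbox by (intro box_bump_outside) blast
qed (use assms in auto)

lemma box_bump_le_1: "\<bar>box_bump a b k x\<bar> \<le> 1"
  unfolding box_bump_def abs_prod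
  by (intro prod_le_1) (auto simp: abs_mult exp_inv_nonneg exp_inv_le_1 intro!: mult_le_one)

lemma box_bump_tendsto: "(\<lambda>k. box_bump a b k x) \<longlonglongrightarrow> indicator (box a b) x"
proof (cases "x \<in> box a b")
  case True
  have "(\<lambda>k. box_bump a b k x) \<longlonglongrightarrow> (\<Prod>i\<in>(Basis :: 'a set). 1 * 1)"
    unfolding box_bump_def
    using True by (intro tendsto_prod tendsto_mult exp_inv_scale_tendsto) (auto simp: mem_box)
  then show ?thesis using True by simp
next
  case False
  then show ?thesis by (simp add: box_bump_outside)
qed

section \<open>Weak gradients\<close>

lemma L2_inner_const_right:
  "f \<in> L2_space U \<Longrightarrow> (\<lambda>x. f x \<bullet> b) \<in> L2_space U"
proof -
  assume f: "f \<in> L2_space U"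
  show ?thesis
    unfolding L2_space_def
  proof (intro CollectI conjI)
    show m: "(\<lambda>x. f x \<bullet> b) \<in> borel_measurable (lebesgue_on U)"
      using L2_spaceD(1)[OF f] by auto
    show "integrable (lebesgue_on U) (\<lambda>x. (norm (f x \<bullet> b))\<^sup>2)"
    proof (rule Bochner_Integration.integrable_bound)
      show "integrable (lebesgue_on U) (\<lambda>x. (norm b)\<^sup>2 * (norm (f x))\<^sup>2)"
        using L2_spaceD(2)[OF f] by simp
      have "(norm (f x \<bullet> b))\<^sup>2 \<le> (norm b)\<^sup>2 * (norm (f x))\<^sup>2" for x
        using power_mono[OF Cauchy_Schwarz_ineq2[of "f x" b], of 2]
        by (simp add: power_mult_distrib mult.commute)
      then show "AE x in lebesgue_on U. norm ((norm (f x \<bullet> b))\<^sup>2) \<le> norm ((norm b)\<^sup>2 * (norm (f x))\<^sup>2)"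
        by simp
    qed (use m in measurable)
  qed
qed

text \<open>Open boxes are an intersection-stable generator of the Borel sets, so a Dynkin argument
  extends the hypothesis to all of them; the integral over the whole space, which is not a box, is
  what complements require. The sets where h is positive and where it is negative then finish the
  proof.\<close>

lemma integral_box_eq_0_imp_AE:
  fixes h :: "'a::euclidean_space \<Rightarrow> real"
  assumes h: "integrable lborel h"
    and 0: "\<And>a b. (\<integral>x. indicator (box a b) x * h x \<partial>lborel) = 0"
    and UNIV: "(\<integral>x. h x \<partial>lborel) = 0"
  shows "AE x in lborel. h x = 0"
proof -
  note [measurable] = borel_measurable_integrable[OF h]
  have si: "set_integrable lborel A h" if "A \<in> sets borel" for A
    unfolding set_integrable_def using integrable_mult_indicator[OF _ h, of A] that by simp
  have *: "(\<integral>x. indicator A x * h x \<partial>lborel) = 0" if "A \<in> sets borel" for A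
  proof -
    let ?G = "range (\<lambda>(a, b). box a b :: 'a set)"
    have "Int_stable ?G" "?G \<subseteq> Pow UNIV" "A \<in> sigma_sets UNIV ?G"
      using that by (auto simp: borel_eq_box Int_stable_def box_Int_box)
    then show ?thesis
    proof (induction rule: sigma_sets_induct_disjoint)
      case (basic A)
      then show ?case using 0 by auto
    next
      case empty
      show ?case by simp
    next
      case (compl A)
      then have [measurable]: "A \<in> sets borel" by (simp add: borel_eq_box)
      have "(\<integral>x. indicator (UNIV - A) x * h x \<partial>lborel) = (\<integral>x. h x - indicator A x * h x \<partial>lborel)"
        by (intro Bochner_Integration.integral_cong) (auto simp: indicator_def)
      also have "\<dots> = 0"
        using compl h si[of A] UNIV by (simp add: set_integrable_def)
      finally show ?case .
    next
      case (union A)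
      then have [measurable]: "A i \<in> sets borel" for i by (auto simp: borel_eq_box)
      have "(LINT x:(\<Union>i. A i)|lborel. h x) = (\<Sum>i. (LINT x:(A i)|lborel. h x))"
        using union(1) by (intro lebesgue_integral_countable_add si) (auto simp: disjoint_family_on_def)
      then show ?case using union by (simp add: set_lebesgue_integral_def)
    qed
  qed
  have pos: "AE x in lborel. indicator A x * h x = 0"
    if A: "A \<in> sets borel" "\<And>x. x \<in> A \<Longrightarrow> 0 \<le> s * h x" and s: "s \<noteq> 0" for A s
  proof -
    have "(\<integral>x. s * (indicator A x * h x) \<partial>lborel) = 0" using *[OF A(1)] by simp
    moreover have "integrable lborel (\<lambda>x. s * (indicator A x * h x))"
      using si[OF A(1)] by (auto simp: set_integrable_def)
    moreover have "AE x in lborel. 0 \<le> s * (indicator A x * h x)"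
      using A(2) by (auto simp: indicator_def)
    ultimately have "AE x in lborel. s * (indicator A x * h x) = 0"
      using integral_nonneg_eq_0_iff_AE by blast
    then show ?thesis using s by simp
  qed
  have "AE x in lborel. indicator {x. h x > 0} x * h x = 0"
    by (rule pos[of _ 1]) auto
  moreover have "AE x in lborel. indicator {x. h x < 0} x * h x = 0"
    by (rule pos[of _ "-1"]) auto
  ultimately show ?thesis
    by eventually_elim (auto simp: indicator_def split: if_splits)
qed

text \<open>Bumps give vanishing integrals over boxes whose closure lies in U, and countably many
  such boxes cover U up to null frontiers. As g is only Lebesgue measurable, it is exchanged on each
  box for a Borel function equal to it almost everywhere.\<close>

lemma fundamental_lemma_variations:
  fixes g :: "'a::euclidean_space \<Rightarrow> real"
  assumes U: "open U" and g: "integrable (lebesgue_on U) g"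
    and 0: "\<And>\<phi>. \<phi> \<in> test_functions U \<Longrightarrow> (\<integral>x. g x * \<phi> x \<partial>lebesgue_on U) = 0"
  shows "AE x in lebesgue_on U. g x = 0"
proof -
  have US: "U \<in> sets lebesgue" using U by auto
  define h where "h x = indicator U x * g x" for x
  have h: "integrable lebesgue h"
    using g US by (simp add: integrable_restrict_space h_def[abs_def])
  note [measurable] = borel_measurable_integrable[OF h]
  have boxI: "integrable lebesgue (\<lambda>x. indicator (box a b) x * h x)" for a b
    using integrable_mult_indicator[OF _ h, of "box a b"] by simp
  have box0: "(\<integral>x. indicator (box a b) x * h x \<partial>lebesgue) = 0" if ab: "cbox a b \<subseteq> U" for a b
  proof -
    have "(\<lambda>k. \<integral>x. box_bump a b k x * h x \<partial>lebesgue) \<longlonglongrightarrow> (\<integral>x. indicator (box a b) x * h x \<partial>lebesgue)"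
    proof (rule integral_dominated_convergence)
      show "integrable lebesgue (\<lambda>x. \<bar>h x\<bar>)" using h by simp
      show "(\<lambda>x. box_bump a b k x * h x) \<in> borel_measurable lebesgue" for k
        using test_measurable[OF box_bump_test[OF ab]] by (intro borel_measurable_times) (auto intro: measurable_completion)
      show "AE x in lebesgue. (\<lambda>k. box_bump a b k x * h x) \<longlonglongrightarrow> indicator (box a b) x * h x"
        by (intro AE_I2 tendsto_mult box_bump_tendsto tendsto_const)
      show "AE x in lebesgue. norm (box_bump a b k x * h x) \<le> \<bar>h x\<bar>" for k
        by (intro AE_I2) (simp add: abs_mult mult_left_le_one_le box_bump_le_1)
      show "(\<lambda>x. indicator (box a b) x * h x) \<in> borel_measurable lebesgue"
        using boxI by (rule borel_measurable_integrable)
    qed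
    moreover have "(\<integral>x. box_bump a b k x * h x \<partial>lebesgue) = 0" for k
    proof -
      have "(\<integral>x. box_bump a b k x * h x \<partial>lebesgue) = (\<integral>x. g x * box_bump a b k x \<partial>lebesgue_on U)"
        using US by (simp add: integral_restrict_space h_def mult_ac)
      then show ?thesis using 0[OF box_bump_test[OF ab]] by simp
    qed
    ultimately show ?thesis by (simp add: LIMSEQ_const_iff)
  qed
  have AEbox: "AE x in lebesgue. x \<in> box c d \<longrightarrow> g x = 0" if cd: "cbox c d \<subseteq> U" for c d
  proof -
    define h1 where "h1 x = indicator (box c d) x * h x" for x
    have h1: "integrable lebesgue h1" unfolding h1_def[abs_def] by (rule boxI)
    obtain g1 where g1 [measurable]: "g1 \<in> borel_measurable lborel" and eq: "AE x in lborel. h1 x = g1 x"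
      using completion_ex_borel_measurable_real[OF borel_measurable_integrable[OF h1]] by blast
    have eq': "AE x in lebesgue. g1 x = h1 x"
      using AE_completion[OF eq] by (rule eventually_mono) simp
    have g1': "g1 \<in> borel_measurable lebesgue" using g1 by (rule measurable_completion)
    have "integrable lebesgue g1"
      by (rule integrable_cong_AE_imp[OF h1 g1' AE_completion[OF eq]])
    then have g1i: "integrable lborel g1" using g1 by (simp add: integrable_completion)
    have *: "(\<integral>x. indicator A x * g1 x \<partial>lborel) = (\<integral>x. indicator A x * h1 x \<partial>lebesgue)"
      if [measurable]: "A \<in> sets borel" for A
    proof -
      have "(\<integral>x. indicator A x * g1 x \<partial>lborel) = (\<integral>x. indicator A x * g1 x \<partial>lebesgue)"
        by (rule integral_completion[symmetric]) measurable
      also have "\<dots> = (\<integral>x. indicator A x * h1 x \<partial>lebesgue)"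
        by (rule integral_cong_AE)
           (use that g1' borel_measurable_integrable[OF h1] eq'
            in \<open>auto intro!: borel_measurable_times borel_measurable_indicator\<close>)
      finally show ?thesis .
    qed
    have "AE x in lborel. g1 x = 0"
    proof (rule integral_box_eq_0_imp_AE[OF g1i])
      fix a b :: 'a
      \<comment> \<open>An arbitrary box may leave U; cut with the fixed box it becomes one to which
        \<open>box0\<close> applies.\<close>
      define a' b' where "a' = (\<Sum>i\<in>Basis. max (a \<bullet> i) (c \<bullet> i) *\<^sub>R i)" and "b' = (\<Sum>i\<in>Basis. min (b \<bullet> i) (d \<bullet> i) *\<^sub>R i)"
      have I: "box a b \<inter> box c d = box a' b'" by (simp add: box_Int_box a'_def b'_def)
      have "cbox a' b' \<subseteq> cbox c d" by (auto simp: mem_box a'_def b'_def)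
      then have "(\<integral>x. indicator (box a' b') x * h x \<partial>lebesgue) = 0" using cd by (intro box0) auto
      moreover have "indicator (box a b) x * h1 x = indicator (box a' b') x * h x" for x
        unfolding h1_def I[symmetric] by (simp add: indicator_inter_arith)
      ultimately show "(\<integral>x. indicator (box a b) x * g1 x \<partial>lborel) = 0" by (simp add: *)
    next
      show "(\<integral>x. g1 x \<partial>lborel) = 0"
        using *[of UNIV] box0[OF cd] by (simp add: h1_def)
    qed
    then have "AE x in lebesgue. g1 x = 0" by (rule AE_completion)
    with eq' show ?thesis
    proof eventually_elim
      case (elim x)
      then show ?case using cd box_subset_cbox[of c d] by (auto simp: h1_def h_def indicator_def split: if_splits)
    qed
  qed
  obtain D where D: "countable D" "D \<subseteq> Pow U" "\<And>X. X \<in> D \<Longrightarrow> \<exists>a b. X = cbox a b" "\<Union>D = U"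
    using open_countable_Union_open_cbox[OF U] by metis
  have "AE x in lebesgue. x \<in> X \<longrightarrow> g x = 0" if XD: "X \<in> D" for X
  proof -
    obtain a b where X: "X = cbox a b" using D(3) XD by blast
    have "AE x in lebesgue. x \<notin> cbox a b - box a b"
      using negligible_frontier_interval[of a b] by (intro AE_not_in) (simp only: negligible_iff_null_sets)
    moreover have "AE x in lebesgue. x \<in> box a b \<longrightarrow> g x = 0"
      using X XD D(2) by (intro AEbox) auto
    ultimately show ?thesis unfolding X by eventually_elim auto
  qed
  then have "AE x in lebesgue. \<forall>X\<in>D. x \<in> X \<longrightarrow> g x = 0"
    by (subst AE_ball_countable[OF D(1)]) blast
  then have "AE x in lebesgue. x \<in> U \<longrightarrow> g x = 0"
    by eventually_elim (use D(4) in auto)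
  then show ?thesis using US by (simp add: AE_restrict_space_iff)
qed

section \<open>Weak gradients on a bounded open set\<close>

locale bounded_open_set =
  fixes U :: "'a::euclidean_space set"
  assumes open_U: "open U" and bounded_U: "bounded U"
begin

lemma U_lmeasurable: "U \<in> lmeasurable"
  using open_U bounded_U by (simp add: lmeasurable_open)

lemma U_sets: "U \<in> sets lebesgue"
  using open_U by auto

text \<open>Since \<open>grad\<close> is a choice, every identity about it comes from this
  uniqueness and holds only almost everywhere.\<close>

lemma weak_gradient_unique:
  assumes g: "g \<in> L2_space U" "weak_gradient U u g" and h: "h \<in> L2_space U" "weak_gradient U u h"
  shows "AE x in lebesgue_on U. g x = h x"
proof -
  have "AE x in lebesgue_on U. g x \<bullet> b - h x \<bullet> b = 0" if b: "b \<in> Basis" for b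
  proof (rule fundamental_lemma_variations[OF open_U])
    have L: "(\<lambda>x. g x \<bullet> b) \<in> L2_space U" "(\<lambda>x. h x \<bullet> b) \<in> L2_space U"
      using g h by (auto intro: L2_inner_const_right)
    show "integrable (lebesgue_on U) (\<lambda>x. g x \<bullet> b - h x \<bullet> b)"
      using L by (intro L2_imp_integrable U_lmeasurable L2_diff)
    fix \<phi> assume \<phi>: "\<phi> \<in> test_functions U"
    have i: "integrable (lebesgue_on U) (\<lambda>x. (g x \<bullet> b) * \<phi> x)" "integrable (lebesgue_on U) (\<lambda>x. (h x \<bullet> b) * \<phi> x)"
      using L2_inner_integrable[OF L(1) test_L2[OF U_sets \<phi>]] L2_inner_integrable[OF L(2) test_L2[OF U_sets \<phi>]] by auto
    have "(\<integral>x. (g x \<bullet> b) * \<phi> x \<partial>lebesgue_on U) = (\<integral>x. (h x \<bullet> b) * \<phi> x \<partial>lebesgue_on U)"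
      using g(2)[unfolded weak_gradient_def, rule_format, OF \<phi> b]
        h(2)[unfolded weak_gradient_def, rule_format, OF \<phi> b] by linarith
    then show "(\<integral>x. (g x \<bullet> b - h x \<bullet> b) * \<phi> x \<partial>lebesgue_on U) = 0"
      using i by (simp add: left_diff_distrib)
  qed
  then have "AE x in lebesgue_on U. \<forall>b\<in>Basis. g x \<bullet> b - h x \<bullet> b = 0"
    by (simp add: AE_ball_countable countable_finite)
  then show ?thesis
    by eventually_elim (auto intro: euclidean_eqI)
qed

lemma H1_L2: "u \<in> H1 U \<Longrightarrow> u \<in> L2_space U"
  by (simp add: H1_def)

lemma grad_L2: "u \<in> H1 U \<Longrightarrow> grad U u \<in> L2_space U"
  and weak_gradient_grad: "u \<in> H1 U \<Longrightarrow> weak_gradient U u (grad U u)"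
proof -
  assume "u \<in> H1 U"
  then have "\<exists>g. g \<in> L2_space U \<and> weak_gradient U u g" by (auto simp: H1_def)
  from someI_ex[OF this] show "grad U u \<in> L2_space U" "weak_gradient U u (grad U u)"
    by (auto simp: grad_def)
qed

lemma H1I: "u \<in> L2_space U \<Longrightarrow> g \<in> L2_space U \<Longrightarrow> weak_gradient U u g \<Longrightarrow> u \<in> H1 U"
  by (auto simp: H1_def)

lemma grad_eq_AE:
  assumes "u \<in> L2_space U" "g \<in> L2_space U" "weak_gradient U u g"
  shows "AE x in lebesgue_on U. grad U u x = g x"
  using assms by (intro weak_gradient_unique[of _ u]) (auto intro: grad_L2 weak_gradient_grad H1I)

text \<open>The form u + c w treats sums, differences and multiples together; the linearity lemmas
  that follow keep it.\<close>

lemma weak_gradient_linear: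
  assumes u: "u \<in> L2_space U" "g \<in> L2_space U" "weak_gradient U u g"
    and w: "w \<in> L2_space U" "h \<in> L2_space U" "weak_gradient U w h"
  shows "weak_gradient U (\<lambda>x. u x + c * w x) (\<lambda>x. g x + c *\<^sub>R h x)"
  unfolding weak_gradient_def
proof (intro ballI)
  fix \<phi> :: "'a \<Rightarrow> real" and b :: 'a assume \<phi>: "\<phi> \<in> test_functions U" and b: "b \<in> Basis"
  note T = test_L2[OF U_sets \<phi>] test_L2[OF U_sets test_derivative[OF \<phi> b]]
  note L = L2_inner_const_right[OF u(2), of b] L2_inner_const_right[OF w(2), of b]
  have i: "integrable (lebesgue_on U) (\<lambda>x. u x * frechet_derivative \<phi> (at x) b)"
    "integrable (lebesgue_on U) (\<lambda>x. w x * frechet_derivative \<phi> (at x) b)"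
    "integrable (lebesgue_on U) (\<lambda>x. (g x \<bullet> b) * \<phi> x)"
    "integrable (lebesgue_on U) (\<lambda>x. (h x \<bullet> b) * \<phi> x)"
    using L2_inner_integrable[OF u(1) T(2)] L2_inner_integrable[OF w(1) T(2)]
      L2_inner_integrable[OF L(1) T(1)] L2_inner_integrable[OF L(2) T(1)] by auto
  have "(\<integral>x. (u x + c * w x) * frechet_derivative \<phi> (at x) b \<partial>lebesgue_on U)
    = (\<integral>x. u x * frechet_derivative \<phi> (at x) b \<partial>lebesgue_on U) + c * (\<integral>x. w x * frechet_derivative \<phi> (at x) b \<partial>lebesgue_on U)"
    using i by (simp add: distrib_right mult.assoc)
  also have "\<dots> = - (\<integral>x. (g x \<bullet> b) * \<phi> x \<partial>lebesgue_on U) + c * - (\<integral>x. (h x \<bullet> b) * \<phi> x \<partial>lebesgue_on U)"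
    using u(3) w(3) \<phi> b by (simp add: weak_gradient_def)
  also have "\<dots> = - (\<integral>x. ((g x + c *\<^sub>R h x) \<bullet> b) * \<phi> x \<partial>lebesgue_on U)"
    using i by (simp add: inner_add_left distrib_right mult.assoc)
  finally show "(\<integral>x. (u x + c * w x) * frechet_derivative \<phi> (at x) b \<partial>lebesgue_on U) =
         - (\<integral>x. ((g x + c *\<^sub>R h x) \<bullet> b) * \<phi> x \<partial>lebesgue_on U)" .
qed

lemma H1_linear:
  assumes "u \<in> H1 U" "w \<in> H1 U"
  shows "(\<lambda>x. u x + c * w x) \<in> H1 U"
    and "AE x in lebesgue_on U. grad U (\<lambda>x. u x + c * w x) x = grad U u x + c *\<^sub>R grad U w x"
proof -
  note w = weak_gradient_linear[OF H1_L2 grad_L2 weak_gradient_grad H1_L2 grad_L2 weak_gradient_grad, OF assms(1,1,1,2,2,2)]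
  have L: "(\<lambda>x. u x + c * w x) \<in> L2_space U"
    using L2_add[OF H1_L2[OF assms(1)] L2_scaleR[OF H1_L2[OF assms(2)], of c]] by simp
  have G: "(\<lambda>x. grad U u x + c *\<^sub>R grad U w x) \<in> L2_space U"
    using assms by (intro L2_add L2_scaleR grad_L2)
  show "(\<lambda>x. u x + c * w x) \<in> H1 U" using L G w by (rule H1I)
  show "AE x in lebesgue_on U. grad U (\<lambda>x. u x + c * w x) x = grad U u x + c *\<^sub>R grad U w x"
    using L G w by (rule grad_eq_AE)
qed

definition classical_grad :: "('a \<Rightarrow> real) \<Rightarrow> 'a \<Rightarrow> 'a" where
  "classical_grad \<phi> x = (\<Sum>b\<in>Basis. frechet_derivative \<phi> (at x) b *\<^sub>R b)"

lemma classical_grad_inner: "b \<in> Basis \<Longrightarrow> classical_grad \<phi> x \<bullet> b = frechet_derivative \<phi> (at x) b"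
  by (simp add: classical_grad_def)

lemma classical_grad_L2:
  assumes "\<phi> \<in> test_functions U"
  shows "classical_grad \<phi> \<in> L2_space U"
proof -
  have "(\<lambda>x. \<Sum>b\<in>B. frechet_derivative \<phi> (at x) b *\<^sub>R b) \<in> L2_space U" if "finite B" "B \<subseteq> Basis" for B
    using that
  proof (induction B rule: finite_induct)
    case empty
    show ?case by (simp add: L2_zero)
  next
    case (insert b B)
    have t: "(\<lambda>x. frechet_derivative \<phi> (at x) b) \<in> L2_space U"
      using insert by (intro test_L2[OF U_sets] test_derivative assms) auto
    have "(\<lambda>x. frechet_derivative \<phi> (at x) b *\<^sub>R b) \<in> L2_space U"
      using L2_spaceD[OF t] insert.prems by (simp add: L2_space_def)
    with insert show ?case by (simp add: L2_add)
  qed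
  from this[of Basis] show ?thesis by (simp add: classical_grad_def[abs_def])
qed

lemma weak_gradient_classical:
  assumes "\<phi> \<in> test_functions U"
  shows "weak_gradient U \<phi> (classical_grad \<phi>)"
  unfolding weak_gradient_def
  using integral_by_parts_test[OF U_sets assms] by (simp add: classical_grad_inner)

lemma test_H1: "\<phi> \<in> test_functions U \<Longrightarrow> \<phi> \<in> H1 U"
  using test_L2[OF U_sets] classical_grad_L2 weak_gradient_classical by (blast intro: H1I)

lemma grad_test_AE: "\<phi> \<in> test_functions U \<Longrightarrow> AE x in lebesgue_on U. grad U \<phi> x = classical_grad \<phi> x"
  using test_L2[OF U_sets] classical_grad_L2 weak_gradient_classical by (blast intro: grad_eq_AE)

definition laplacian :: "('a \<Rightarrow> real) \<Rightarrow> 'a \<Rightarrow> real" where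
  "laplacian \<phi> x = (\<Sum>b\<in>Basis. frechet_derivative (\<lambda>y. frechet_derivative \<phi> (at y) b) (at x) b)"

lemma laplacian_test: "\<phi> \<in> test_functions U \<Longrightarrow> laplacian \<phi> \<in> test_functions U"
  unfolding laplacian_def[abs_def] by (intro test_sum test_derivative)

text \<open>Every partial derivative of \<phi> is again a test function against which the weak
  gradient of u may be tested. Thus the pairing of gradients becomes a pairing with u itself, which
  makes sense for the L^2-valued time derivative.\<close>

lemma L2_inner_grad_test:
  assumes u: "u \<in> H1 U" and \<phi>: "\<phi> \<in> test_functions U"
  shows "L2_inner U (grad U u) (grad U \<phi>) = - L2_inner U u (laplacian \<phi>)"
proof -
  have d: "(\<lambda>x. frechet_derivative \<phi> (at x) b) \<in> test_functions U" if "b \<in> Basis" for b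
    using test_derivative[OF \<phi> that] .
  have "L2_inner U (grad U u) (grad U \<phi>) = L2_inner U (grad U u) (classical_grad \<phi>)"
    using grad_L2[OF u] grad_L2[OF test_H1[OF \<phi>]] classical_grad_L2[OF \<phi>] grad_test_AE[OF \<phi>]
    by (intro L2_inner_cong_AE) (auto dest: L2_spaceD)
  also have "\<dots> = (\<integral>x. (\<Sum>b\<in>Basis. (grad U u x \<bullet> b) * frechet_derivative \<phi> (at x) b) \<partial>lebesgue_on U)"
    by (simp add: L2_inner_def classical_grad_def inner_sum_right mult.commute)
  also have "\<dots> = (\<Sum>b\<in>Basis. \<integral>x. (grad U u x \<bullet> b) * frechet_derivative \<phi> (at x) b \<partial>lebesgue_on U)"
  proof (rule Bochner_Integration.integral_sum)
    fix b :: 'a assume "b \<in> Basis"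
    from L2_inner_integrable[OF L2_inner_const_right[OF grad_L2[OF u], of b] test_L2[OF U_sets d[OF this]]]
    show "integrable (lebesgue_on U) (\<lambda>x. (grad U u x \<bullet> b) * frechet_derivative \<phi> (at x) b)" by simp
  qed
  also have "\<dots> = (\<Sum>b\<in>Basis. - (\<integral>x. u x * frechet_derivative (\<lambda>y. frechet_derivative \<phi> (at y) b) (at x) b \<partial>lebesgue_on U))"
  proof (rule sum.cong[OF refl])
    fix b :: 'a assume b: "b \<in> Basis"
    show "(\<integral>x. (grad U u x \<bullet> b) * frechet_derivative \<phi> (at x) b \<partial>lebesgue_on U)
      = - (\<integral>x. u x * frechet_derivative (\<lambda>y. frechet_derivative \<phi> (at y) b) (at x) b \<partial>lebesgue_on U)"
      using weak_gradient_grad[OF u] d[OF b] b unfolding weak_gradient_def by simp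
  qed
  also have "\<dots> = - (\<integral>x. (\<Sum>b\<in>Basis. u x * frechet_derivative (\<lambda>y. frechet_derivative \<phi> (at y) b) (at x) b) \<partial>lebesgue_on U)"
  proof (subst Bochner_Integration.integral_sum)
    fix b :: 'a assume b: "b \<in> Basis"
    from L2_inner_integrable[OF H1_L2[OF u] test_L2[OF U_sets test_derivative[OF d[OF b] b]]]
    show "integrable (lebesgue_on U) (\<lambda>x. u x * frechet_derivative (\<lambda>y. frechet_derivative \<phi> (at y) b) (at x) b)" by simp
  qed (simp add: sum_negf)
  also have "\<dots> = - L2_inner U u (laplacian \<phi>)"
    by (simp add: L2_inner_def laplacian_def sum_distrib_left)
  finally show ?thesis .
qed

section \<open>The space \<open>H\<^sub>0\<^sup>1\<close>\<close>

text \<open>The norm of \<open>H\<^sup>1\<close> is the norm of the jet in \<open>L\<^sup>2\<close>, so that the Cauchy--Schwarz and triangle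
  inequalities carry over.\<close>

definition jet :: "('a \<Rightarrow> real) \<Rightarrow> 'a \<Rightarrow> real \<times> 'a" where
  "jet u x = (u x, grad U u x)"

definition H1_inner :: "('a \<Rightarrow> real) \<Rightarrow> ('a \<Rightarrow> real) \<Rightarrow> real" where
  "H1_inner u w = L2_inner U u w + L2_inner U (grad U u) (grad U w)"

definition dirichlet :: "('a \<Rightarrow> real) \<Rightarrow> real" where
  "dirichlet u = L2_inner U (grad U u) (grad U u)"

lemma dirichlet_eq: "(Lq_norm 2 U (grad U u))\<^sup>2 = dirichlet u"
  by (simp add: dirichlet_def Lq_norm_2_power2)

lemma dirichlet_nonneg: "0 \<le> dirichlet u"
  by (simp add: dirichlet_def L2_inner_self_nonneg)

lemma jet_L2:
  assumes "u \<in> H1 U"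
  shows "jet u \<in> L2_space U"
proof -
  note L = L2_spaceD[OF H1_L2[OF assms]] L2_spaceD[OF grad_L2[OF assms]]
  have "(norm (jet u x))\<^sup>2 = (norm (u x))\<^sup>2 + (norm (grad U u x))\<^sup>2" for x
    by (simp add: jet_def norm_Pair)
  then show ?thesis
    using L by (simp add: L2_space_def jet_def[abs_def] borel_measurable_Pair)
qed

lemma H1_inner_jet:
  assumes "u \<in> H1 U" "w \<in> H1 U"
  shows "H1_inner u w = L2_inner U (jet u) (jet w)"
  using L2_inner_integrable[OF H1_L2 H1_L2, OF assms] L2_inner_integrable[OF grad_L2 grad_L2, OF assms]
  by (simp add: H1_inner_def L2_inner_def jet_def)

lemma H1_norm_power2: "(H1_norm U u)\<^sup>2 = H1_inner u u"
  by (simp add: H1_norm_def H1_inner_def Lq_norm_2_power2 L2_inner_self_nonneg)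

lemma H1_norm_nonneg: "0 \<le> H1_norm U u"
  by (simp add: H1_norm_def)

lemma H1_norm_jet:
  assumes "u \<in> H1 U"
  shows "H1_norm U u = Lq_norm 2 U (jet u)"
  by (metis H1_norm_power2 H1_norm_nonneg H1_inner_jet assms Lq_norm_2_power2 Lq_norm_nonneg power2_eq_iff_nonneg)

lemma H1_inner_commute: "H1_inner u w = H1_inner w u"
  by (simp add: H1_inner_def L2_inner_commute)

lemma jet_linear:
  assumes "u \<in> H1 U" "w \<in> H1 U"
  shows "AE x in lebesgue_on U. jet (\<lambda>x. u x + c * w x) x = jet u x + c *\<^sub>R jet w x"
  using H1_linear(2)[OF assms, of c] by eventually_elim (simp add: jet_def)

lemma H1_diff: "u \<in> H1 U \<Longrightarrow> w \<in> H1 U \<Longrightarrow> (\<lambda>x. u x - w x) \<in> H1 U"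
  using H1_linear(1)[of u w "-1"] by simp

lemma zero_H1: "(\<lambda>x. 0) \<in> H1 U"
  by (rule test_H1[OF test_zero])

lemma H1_scale: "u \<in> H1 U \<Longrightarrow> (\<lambda>x. c * u x) \<in> H1 U"
  using H1_linear(1)[OF zero_H1, of u c] by simp

lemma H1_inner_linear_left:
  assumes u: "u \<in> H1 U" and w: "w \<in> H1 U" and h: "h \<in> H1 U"
  shows "H1_inner (\<lambda>x. u x + c * w x) h = H1_inner u h + c * H1_inner w h"
proof -
  have "H1_inner (\<lambda>x. u x + c * w x) h = L2_inner U (jet (\<lambda>x. u x + c * w x)) (jet h)"
    by (intro H1_inner_jet H1_linear assms)
  also have "\<dots> = L2_inner U (\<lambda>x. jet u x + c *\<^sub>R jet w x) (jet h)"
    using jet_linear[OF u w, of c] L2_spaceD(1)[OF jet_L2[OF H1_linear(1)[OF u w, of c]]]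
      L2_spaceD(1)[OF L2_add[OF jet_L2[OF u] L2_scaleR[OF jet_L2[OF w], of c]]]
      L2_spaceD(1)[OF jet_L2[OF h]]
    by (intro L2_inner_cong_AE) auto
  also have "\<dots> = H1_inner u h + c * H1_inner w h"
    by (simp add: L2_inner_add_left jet_L2 assms L2_scaleR L2_inner_scaleR_left H1_inner_jet)
  finally show ?thesis .
qed

lemma H1_inner_diff_left:
  "u \<in> H1 U \<Longrightarrow> w \<in> H1 U \<Longrightarrow> h \<in> H1 U \<Longrightarrow> H1_inner (\<lambda>x. u x - w x) h = H1_inner u h - H1_inner w h"
  using H1_inner_linear_left[of u w h "-1"] by simp

lemma H1_inner_diff_right:
  "u \<in> H1 U \<Longrightarrow> w \<in> H1 U \<Longrightarrow> h \<in> H1 U \<Longrightarrow> H1_inner h (\<lambda>x. u x - w x) = H1_inner h u - H1_inner h w"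
  using H1_inner_diff_left by (simp add: H1_inner_commute[of h])

lemma H1_Cauchy_Schwarz: "u \<in> H1 U \<Longrightarrow> w \<in> H1 U \<Longrightarrow> \<bar>H1_inner u w\<bar> \<le> H1_norm U u * H1_norm U w"
  using L2_Cauchy_Schwarz[OF jet_L2 jet_L2] by (simp add: H1_inner_jet H1_norm_jet)

lemma H1_norm_linear:
  assumes u: "u \<in> H1 U" and w: "w \<in> H1 U"
  shows "H1_norm U (\<lambda>x. u x + c * w x) \<le> H1_norm U u + \<bar>c\<bar> * H1_norm U w"
proof -
  have "H1_norm U (\<lambda>x. u x + c * w x) = Lq_norm 2 U (jet (\<lambda>x. u x + c * w x))"
    by (intro H1_norm_jet H1_linear assms)
  also have "\<dots> = Lq_norm 2 U (\<lambda>x. jet u x + c *\<^sub>R jet w x)"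
    using jet_linear[OF u w, of c] L2_spaceD(1)[OF jet_L2[OF H1_linear(1)[OF u w, of c]]]
      L2_spaceD(1)[OF L2_add[OF jet_L2[OF u] L2_scaleR[OF jet_L2[OF w], of c]]]
    by (intro Lq_norm_2_cong_AE) auto
  also have "\<dots> \<le> H1_norm U u + \<bar>c\<bar> * H1_norm U w"
    using L2_triangle[OF jet_L2[OF u] L2_scaleR[OF jet_L2[OF w], of c]]
    by (simp add: Lq_norm_2_scaleR H1_norm_jet assms)
  finally show ?thesis .
qed

lemma H1_norm_triangle_add:
  "u \<in> H1 U \<Longrightarrow> w \<in> H1 U \<Longrightarrow> H1_norm U (\<lambda>x. u x + w x) \<le> H1_norm U u + H1_norm U w"
  using H1_norm_linear[of u w 1] by simp

lemma H1_norm_zero: "H1_norm U (\<lambda>x. 0) = 0"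
proof -
  have "AE x in lebesgue_on U. grad U (\<lambda>x. 0) x = 0"
    by (rule grad_eq_AE) (auto simp: L2_zero weak_gradient_def)
  then have "Lq_norm 2 U (grad U (\<lambda>x. 0)) = Lq_norm 2 U (\<lambda>x. 0 :: 'a)"
    using L2_spaceD(1)[OF grad_L2[OF zero_H1]] by (intro Lq_norm_2_cong_AE) auto
  then show ?thesis by (simp add: H1_norm_def Lq_norm_def)
qed

lemma H1_norm_scale:
  assumes "u \<in> H1 U"
  shows "H1_norm U (\<lambda>x. c * u x) = \<bar>c\<bar> * H1_norm U u"
proof -
  have "H1_inner (\<lambda>x. c * u x) h = c * H1_inner u h" if "h \<in> H1 U" for h
    using H1_inner_linear_left[OF zero_H1 assms that, of c] H1_norm_power2[of "\<lambda>x. 0"]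
      H1_Cauchy_Schwarz[OF zero_H1 that] by (simp add: H1_norm_zero)
  then have "H1_inner (\<lambda>x. c * u x) (\<lambda>x. c * u x) = c * (c * H1_inner u u)"
    using assms H1_scale[OF assms, of c] H1_inner_commute[of u "\<lambda>x. c * u x"] by simp
  then have "(H1_norm U (\<lambda>x. c * u x))\<^sup>2 = (\<bar>c\<bar> * H1_norm U u)\<^sup>2"
    by (simp only: power_mult_distrib H1_norm_power2) (simp add: power2_eq_square)
  then show ?thesis by (simp add: H1_norm_nonneg power2_eq_iff_nonneg)
qed

lemma H1_norm_minus_commute:
  assumes "u \<in> H1 U" "w \<in> H1 U"
  shows "H1_norm U (\<lambda>x. u x - w x) = H1_norm U (\<lambda>x. w x - u x)"
  using H1_norm_scale[OF H1_diff[OF assms], of "-1"] by simp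

lemma H1_norm_triangle:
  assumes "u \<in> H1 U" "w \<in> H1 U" "h \<in> H1 U"
  shows "H1_norm U (\<lambda>x. u x - h x) \<le> H1_norm U (\<lambda>x. u x - w x) + H1_norm U (\<lambda>x. w x - h x)"
  using H1_norm_triangle_add[OF H1_diff[OF assms(1,2)] H1_diff[OF assms(2,3)]] by simp

lemma H1_norm_le_add_diff:
  assumes "u \<in> H1 U" "w \<in> H1 U"
  shows "H1_norm U u \<le> H1_norm U w + H1_norm U (\<lambda>x. u x - w x)"
  using H1_norm_triangle_add[OF assms(2) H1_diff[OF assms]] by simp

lemma L2_norm_le_H1_norm: "Lq_norm 2 U u \<le> H1_norm U u"
  and grad_norm_le_H1_norm: "Lq_norm 2 U (grad U u) \<le> H1_norm U u"
  by (auto simp: H1_norm_def intro!: real_le_rsqrt)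

lemma dirichlet_le_H1_norm: "dirichlet u \<le> (H1_norm U u)\<^sup>2"
  using power_mono[OF grad_norm_le_H1_norm[of u] Lq_norm_nonneg, of 2] by (simp add: dirichlet_eq)

lemma dirichlet_scale:
  assumes "u \<in> H1 U"
  shows "dirichlet (\<lambda>x. c * u x) = c\<^sup>2 * dirichlet u"
proof -
  have "(H1_norm U (\<lambda>x. c * u x))\<^sup>2 = c\<^sup>2 * (H1_norm U u)\<^sup>2"
    by (simp add: H1_norm_scale assms power_mult_distrib)
  moreover have "L2_inner U (\<lambda>x. c * u x) (\<lambda>x. c * u x) = c\<^sup>2 * L2_inner U u u"
    using L2_inner_scaleR_left[of U c u "\<lambda>x. c * u x"] L2_inner_scaleR_right[of U u c u]
    by (simp add: power2_eq_square)
  ultimately show ?thesis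
    by (simp add: H1_norm_power2 H1_inner_def dirichlet_def algebra_simps)
qed

lemma dirichlet_inner_linear_left:
  assumes u: "u \<in> H1 U" and w: "w \<in> H1 U" and h: "h \<in> H1 U"
  shows "L2_inner U (grad U (\<lambda>x. u x + c * w x)) (grad U h)
    = L2_inner U (grad U u) (grad U h) + c * L2_inner U (grad U w) (grad U h)"
proof -
  have "L2_inner U (\<lambda>x. u x + c *\<^sub>R w x) h = L2_inner U u h + c * L2_inner U w h"
    by (simp only: L2_inner_add_left L2_scaleR H1_L2 assms L2_inner_scaleR_left)
  with H1_inner_linear_left[OF assms, of c] show ?thesis
    by (simp add: H1_inner_def algebra_simps)
qed

section \<open>The closure of the test functions\<close>

lemma H10_H1: "u \<in> H10 U \<Longrightarrow> u \<in> H1 U"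
  by (simp add: H10_def)

lemma H10_L2: "u \<in> H10 U \<Longrightarrow> u \<in> L2_space U"
  by (simp add: H10_H1 H1_L2)

lemma H10_approx_seq:
  assumes "u \<in> H10 U"
  obtains \<phi> where "\<And>k. \<phi> k \<in> test_functions U" "(\<lambda>k. H1_norm U (\<lambda>x. \<phi> k x - u x)) \<longlonglongrightarrow> 0"
  using assms by (auto simp: H10_def)

lemma H10_iff_approx:
  "u \<in> H10 U \<longleftrightarrow> u \<in> H1 U \<and> (\<forall>e>0. \<exists>\<phi>\<in>test_functions U. H1_norm U (\<lambda>x. \<phi> x - u x) < e)"
proof safe
  fix e :: real assume "u \<in> H10 U" "e > 0"
  then obtain \<phi> where \<phi>: "\<And>k. \<phi> k \<in> test_functions U" "(\<lambda>k. H1_norm U (\<lambda>x. \<phi> k x - u x)) \<longlonglongrightarrow> 0"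
    by (metis H10_approx_seq)
  from order_tendstoD(2)[OF \<phi>(2) \<open>e > 0\<close>] obtain k where "H1_norm U (\<lambda>x. \<phi> k x - u x) < e"
    by (auto simp: eventually_sequentially)
  with \<phi>(1) show "\<exists>\<phi>\<in>test_functions U. H1_norm U (\<lambda>x. \<phi> x - u x) < e" by blast
next
  assume u: "u \<in> H1 U" and *: "\<forall>e>0. \<exists>\<phi>\<in>test_functions U. H1_norm U (\<lambda>x. \<phi> x - u x) < e"
  then have "\<forall>k. \<exists>\<phi>\<in>test_functions U. H1_norm U (\<lambda>x. \<phi> x - u x) < inverse (real (Suc k))" by simp
  then obtain \<phi> where \<phi>: "\<And>k. \<phi> k \<in> test_functions U" "\<And>k. H1_norm U (\<lambda>x. \<phi> k x - u x) < inverse (real (Suc k))"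
    by metis
  have "(\<lambda>k. H1_norm U (\<lambda>x. \<phi> k x - u x)) \<longlonglongrightarrow> 0"
  proof (rule tendsto_sandwich[OF _ _ tendsto_const LIMSEQ_inverse_real_of_nat])
    show "\<forall>\<^sub>F k in sequentially. 0 \<le> H1_norm U (\<lambda>x. \<phi> k x - u x)" by (simp add: H1_norm_nonneg)
    show "\<forall>\<^sub>F k in sequentially. H1_norm U (\<lambda>x. \<phi> k x - u x) \<le> inverse (real (Suc k))"
      using \<phi>(2) by (auto intro!: always_eventually less_imp_le)
  qed
  with u \<phi>(1) show "u \<in> H10 U" by (auto simp: H10_def)
qed (simp add: H10_H1)

lemma test_H10: "\<phi> \<in> test_functions U \<Longrightarrow> \<phi> \<in> H10 U"
  unfolding H10_iff_approx by (auto simp: test_H1 H1_norm_zero intro!: bexI[of _ \<phi>])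

lemma H10_closed:
  assumes u: "u \<in> H1 U" and *: "\<And>e. e > 0 \<Longrightarrow> \<exists>w\<in>H10 U. H1_norm U (\<lambda>x. w x - u x) < e"
  shows "u \<in> H10 U"
  unfolding H10_iff_approx
proof (intro conjI allI impI)
  fix e :: real assume "e > 0"
  then obtain w where w: "w \<in> H10 U" "H1_norm U (\<lambda>x. w x - u x) < e / 2" using *[of "e/2"] by auto
  then obtain \<phi> where \<phi>: "\<phi> \<in> test_functions U" "H1_norm U (\<lambda>x. \<phi> x - w x) < e / 2"
    using \<open>e > 0\<close> unfolding H10_iff_approx by (metis half_gt_zero)
  have "H1_norm U (\<lambda>x. \<phi> x - u x) < e"
    using H1_norm_triangle[OF test_H1[OF \<phi>(1)] H10_H1[OF w(1)] u] w \<phi> by simp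
  with \<phi>(1) show "\<exists>\<phi>\<in>test_functions U. H1_norm U (\<lambda>x. \<phi> x - u x) < e" by blast
qed (rule u)

lemma H10_linear:
  assumes u: "u \<in> H10 U" and w: "w \<in> H10 U"
  shows "(\<lambda>x. u x + c * w x) \<in> H10 U"
  unfolding H10_iff_approx
proof (intro conjI allI impI)
  note H = H10_H1[OF u] H10_H1[OF w]
  show "(\<lambda>x. u x + c * w x) \<in> H1 U" by (intro H1_linear H)
  fix e :: real assume e: "e > 0"
  define d where "d = e / (1 + \<bar>c\<bar>)"
  have d: "d > 0" using e by (simp add: d_def add_pos_nonneg)
  obtain \<phi> where \<phi>: "\<phi> \<in> test_functions U" "H1_norm U (\<lambda>x. \<phi> x - u x) < d"
    using u d unfolding H10_iff_approx by blast
  obtain \<psi> where \<psi>: "\<psi> \<in> test_functions U" "H1_norm U (\<lambda>x. \<psi> x - w x) < d"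
    using w d unfolding H10_iff_approx by blast
  have "H1_norm U (\<lambda>x. (\<phi> x - u x) + c * (\<psi> x - w x))
      \<le> H1_norm U (\<lambda>x. \<phi> x - u x) + \<bar>c\<bar> * H1_norm U (\<lambda>x. \<psi> x - w x)"
    by (intro H1_norm_linear H1_diff test_H1 \<phi> \<psi> H)
  also have "\<dots> < d + \<bar>c\<bar> * d"
    using \<phi> \<psi> by (intro add_less_le_mono mult_left_mono) auto
  also have "\<dots> = d * (1 + \<bar>c\<bar>)" by (simp add: algebra_simps)
  also have "\<dots> = e"
  proof -
    have "1 + \<bar>c\<bar> \<noteq> 0" using abs_ge_zero[of c] by linarith
    then show ?thesis by (simp add: d_def)
  qed
  finally have "H1_norm U (\<lambda>x. (\<phi> x + c * \<psi> x) - (u x + c * w x)) < e"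
    by (simp add: algebra_simps)
  moreover have "(\<lambda>x. \<phi> x + c * \<psi> x) \<in> test_functions U" by (intro test_add test_scale \<phi> \<psi>)
  ultimately show "\<exists>\<phi>\<in>test_functions U. H1_norm U (\<lambda>x. \<phi> x - (u x + c * w x)) < e"
    by (intro bexI[of _ "\<lambda>x. \<phi> x + c * \<psi> x"])
qed

lemma zero_H10: "(\<lambda>x. 0) \<in> H10 U"
  by (rule test_H10[OF test_zero])

lemma H10_diff: "u \<in> H10 U \<Longrightarrow> w \<in> H10 U \<Longrightarrow> (\<lambda>x. u x - w x) \<in> H10 U"
  using H10_linear[of u w "-1"] by simp

lemma H10_scale: "u \<in> H10 U \<Longrightarrow> (\<lambda>x. c * u x) \<in> H10 U"
  using H10_linear[OF zero_H10, of u c] by simp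

text \<open>The gradients converge by completeness, and integration by parts passes to the limit, so
  their limit is a weak gradient of w. This identifies limits of the solution along good times with
  its values, of which only L^2 continuity is known beforehand.\<close>

lemma L2_limit_H10:
  assumes u: "\<And>k. u k \<in> H10 U"
    and Cauchy: "\<And>e. e > 0 \<Longrightarrow> \<exists>N. \<forall>m\<ge>N. \<forall>n\<ge>N. H1_norm U (\<lambda>x. u m x - u n x) < e"
    and w: "w \<in> L2_space U" and lim: "(\<lambda>k. Lq_norm 2 U (\<lambda>x. u k x - w x)) \<longlonglongrightarrow> 0"
  shows "w \<in> H10 U" and "(\<lambda>k. H1_norm U (\<lambda>x. u k x - w x)) \<longlonglongrightarrow> 0"
proof -
  note uH = H10_H1[OF u]
  have diffgrad: "Lq_norm 2 U (\<lambda>x. grad U (u m) x - grad U (u n) x) = Lq_norm 2 U (grad U (\<lambda>x. u m x - u n x))" for m n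
  proof (rule Lq_norm_2_cong_AE)
    show "AE x in lebesgue_on U. grad U (u m) x - grad U (u n) x = grad U (\<lambda>x. u m x - u n x) x"
      using H1_linear(2)[OF uH[of m] uH[of n], of "-1"] by (simp add: eq_commute)
  qed (use L2_spaceD(1)[OF L2_diff[OF grad_L2[OF uH] grad_L2[OF uH]]] L2_spaceD(1)[OF grad_L2[OF H1_diff[OF uH uH]]] in auto)
  obtain g where g: "g \<in> L2_space U" "(\<lambda>k. Lq_norm 2 U (\<lambda>x. grad U (u k) x - g x)) \<longlonglongrightarrow> 0"
  proof (rule L2_complete[OF U_lmeasurable grad_L2[OF uH]])
    fix e :: real assume "e > 0"
    from Cauchy[OF this] show "\<exists>N. \<forall>m\<ge>N. \<forall>n\<ge>N. Lq_norm 2 U (\<lambda>x. grad U (u m) x - grad U (u n) x) < e"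
      unfolding diffgrad using grad_norm_le_H1_norm by (meson le_less_trans)
  qed blast
  have wg: "weak_gradient U w g"
    unfolding weak_gradient_def
  proof (intro ballI)
    fix \<phi> :: "'a \<Rightarrow> real" and b :: 'a assume \<phi>: "\<phi> \<in> test_functions U" and b: "b \<in> Basis"
    have 1: "(\<lambda>k. L2_inner U (u k) (\<lambda>x. frechet_derivative \<phi> (at x) b)) \<longlonglongrightarrow> L2_inner U w (\<lambda>x. frechet_derivative \<phi> (at x) b)"
      by (intro L2_inner_tendsto H10_L2 u w lim test_L2[OF U_sets] test_derivative \<phi> b)
    have "(\<lambda>x. \<phi> x *\<^sub>R b) \<in> L2_space U"
      using L2_spaceD[OF test_L2[OF U_sets \<phi>]] b by (simp add: L2_space_def)
    then have 2: "(\<lambda>k. L2_inner U (grad U (u k)) (\<lambda>x. \<phi> x *\<^sub>R b)) \<longlonglongrightarrow> L2_inner U g (\<lambda>x. \<phi> x *\<^sub>R b)"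
      by (intro L2_inner_tendsto grad_L2 uH g)
    have "L2_inner U (u k) (\<lambda>x. frechet_derivative \<phi> (at x) b) = - L2_inner U (grad U (u k)) (\<lambda>x. \<phi> x *\<^sub>R b)" for k
      using weak_gradient_grad[OF uH[of k]] \<phi> b
      by (simp add: weak_gradient_def L2_inner_def mult.commute)
    then have "(\<lambda>k. L2_inner U (u k) (\<lambda>x. frechet_derivative \<phi> (at x) b)) \<longlonglongrightarrow> - L2_inner U g (\<lambda>x. \<phi> x *\<^sub>R b)"
      using tendsto_minus[OF 2] by simp
    from LIMSEQ_unique[OF 1 this]
    show "(\<integral>x. w x * frechet_derivative \<phi> (at x) b \<partial>lebesgue_on U) = - (\<integral>x. (g x \<bullet> b) * \<phi> x \<partial>lebesgue_on U)"
      by (simp add: L2_inner_def mult.commute)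
  qed
  have wH: "w \<in> H1 U" using w g(1) wg by (rule H1I)
  have gw: "Lq_norm 2 U (\<lambda>x. grad U (u k) x - g x) = Lq_norm 2 U (grad U (\<lambda>x. u k x - w x))" for k
  proof (rule Lq_norm_2_cong_AE)
    show "AE x in lebesgue_on U. grad U (u k) x - g x = grad U (\<lambda>x. u k x - w x) x"
      using H1_linear(2)[OF uH[of k] wH, of "-1"] grad_eq_AE[OF w g(1) wg]
      by eventually_elim simp
  qed (use L2_spaceD(1)[OF L2_diff[OF grad_L2[OF uH] g(1)]] L2_spaceD(1)[OF grad_L2[OF H1_diff[OF uH wH]]] in auto)
  show lim': "(\<lambda>k. H1_norm U (\<lambda>x. u k x - w x)) \<longlonglongrightarrow> 0"
  proof -
    have "(\<lambda>k. sqrt ((Lq_norm 2 U (\<lambda>x. u k x - w x))\<^sup>2 + (Lq_norm 2 U (grad U (\<lambda>x. u k x - w x)))\<^sup>2)) \<longlonglongrightarrow> sqrt (0\<^sup>2 + 0\<^sup>2)"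
      using lim g(2)[unfolded gw] by (intro tendsto_intros)
    then show ?thesis by (simp add: H1_norm_def)
  qed
  show "w \<in> H10 U"
  proof (rule H10_closed[OF wH])
    fix e :: real assume "e > 0"
    from order_tendstoD(2)[OF lim' this] obtain k where "H1_norm U (\<lambda>x. u k x - w x) < e"
      by (auto simp: eventually_sequentially)
    with u show "\<exists>w'\<in>H10 U. H1_norm U (\<lambda>x. w' x - w x) < e" by blast
  qed
qed

lemma H1_inner_test:
  assumes u: "u \<in> H1 U" and \<phi>: "\<phi> \<in> test_functions U"
  shows "H1_inner u \<phi> = L2_inner U u (\<lambda>x. \<phi> x - laplacian \<phi> x)"
  by (simp add: H1_inner_def L2_inner_grad_test[OF u \<phi>] L2_inner_diff_right H1_L2[OF u]
      test_L2[OF U_sets \<phi>] test_L2[OF U_sets laplacian_test[OF \<phi>]])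

lemma L2_norm_triangle_diff:
  assumes "u \<in> H1 U" "w \<in> H1 U"
  shows "Lq_norm 2 U u \<le> Lq_norm 2 U w + H1_norm U (\<lambda>x. u x - w x)"
  using L2_triangle[OF H1_L2[OF assms(2)] H1_L2[OF H1_diff[OF assms]]]
    L2_norm_le_H1_norm[of "\<lambda>x. u x - w x"] by simp

lemma grad_norm_triangle_diff:
  assumes "u \<in> H1 U" "w \<in> H1 U"
  shows "Lq_norm 2 U (grad U u) \<le> Lq_norm 2 U (grad U w) + H1_norm U (\<lambda>x. u x - w x)"
proof -
  let ?d = "\<lambda>x. u x - w x"
  have d: "?d \<in> H1 U" using assms by (rule H1_diff)
  have "Lq_norm 2 U (grad U u) = Lq_norm 2 U (\<lambda>x. grad U w x + grad U ?d x)"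
  proof (rule Lq_norm_2_cong_AE)
    show "AE x in lebesgue_on U. grad U u x = grad U w x + grad U ?d x"
      using H1_linear(2)[OF assms, of "-1"] by eventually_elim simp
  qed (use L2_spaceD(1)[OF grad_L2[OF assms(1)]] L2_spaceD(1)[OF L2_add[OF grad_L2[OF assms(2)] grad_L2[OF d]]] in auto)
  also have "\<dots> \<le> Lq_norm 2 U (grad U w) + Lq_norm 2 U (grad U ?d)"
    by (intro L2_triangle grad_L2 assms d)
  finally show ?thesis using grad_norm_le_H1_norm[of ?d] by simp
qed

section \<open>The Poincare inequality\<close>

lemma dirichlet_test_ge:
  assumes \<phi>: "\<phi> \<in> test_functions U" and b: "b \<in> Basis"
  shows "(\<integral>x. (frechet_derivative \<phi> (at x) b)\<^sup>2 \<partial>lebesgue_on U) \<le> dirichlet \<phi>"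
proof -
  have "dirichlet \<phi> = L2_inner U (classical_grad \<phi>) (classical_grad \<phi>)"
    unfolding dirichlet_def
    using grad_L2[OF test_H1[OF \<phi>]] classical_grad_L2[OF \<phi>] grad_test_AE[OF \<phi>]
    by (intro L2_inner_cong_AE) (auto dest: L2_spaceD)
  moreover have "(\<integral>x. (frechet_derivative \<phi> (at x) b)\<^sup>2 \<partial>lebesgue_on U) \<le> \<dots>"
    unfolding L2_inner_def
  proof (rule integral_mono)
    show "integrable (lebesgue_on U) (\<lambda>x. (frechet_derivative \<phi> (at x) b)\<^sup>2)"
      using L2_inner_integrable[OF test_L2[OF U_sets test_derivative[OF \<phi> b]] test_L2[OF U_sets test_derivative[OF \<phi> b]]]
      by (simp add: power2_eq_square)
    show "integrable (lebesgue_on U) (\<lambda>x. classical_grad \<phi> x \<bullet> classical_grad \<phi> x)"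
      by (intro L2_inner_integrable classical_grad_L2 \<phi>)
    fix x
    have "\<bar>classical_grad \<phi> x \<bullet> b\<bar> \<le> norm (classical_grad \<phi> x)"
      using Cauchy_Schwarz_ineq2[of "classical_grad \<phi> x" b] b by simp
    then have "(classical_grad \<phi> x \<bullet> b)\<^sup>2 \<le> (norm (classical_grad \<phi> x))\<^sup>2"
      by (metis abs_le_square_iff abs_norm_cancel)
    then show "(frechet_derivative \<phi> (at x) b)\<^sup>2 \<le> classical_grad \<phi> x \<bullet> classical_grad \<phi> x"
      using b by (simp add: classical_grad_inner power2_norm_eq_inner)
  qed
  ultimately show ?thesis by simp
qed

text \<open>The derivative of (x . b) \<phi>^2 in direction b has integral 0, which expresses the
  integral of \<phi>^2 by that of -2 (x . b) \<phi> times the derivative of \<phi>. Young's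
  inequality is weighted so that half of the left side is absorbed.\<close>

lemma Poincare_test:
  assumes \<phi>: "\<phi> \<in> test_functions U" and D: "\<And>x. x \<in> U \<Longrightarrow> norm x \<le> D" and b: "(b::'a) \<in> Basis"
  shows "L2_inner U \<phi> \<phi> \<le> 4 * D\<^sup>2 * dirichlet \<phi>"
proof -
  let ?M = "lebesgue_on U" and ?d = "\<lambda>x. frechet_derivative \<phi> (at x) b"
  have s: "smooth_fun (\<lambda>x::'a. x \<bullet> b)" by (intro smooth_bounded_linear bounded_linear_inner_left)
  have \<phi>2: "(\<lambda>x. \<phi> x * \<phi> x) \<in> test_functions U" by (intro test_mult \<phi>)
  have d: "?d \<in> test_functions U" by (intro test_derivative \<phi> b)
  have i: "integrable ?M (\<lambda>x. \<phi> x * \<phi> x)" "integrable ?M (\<lambda>x. ?d x * ?d x)"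
    "integrable ?M (\<lambda>x. (x \<bullet> b) * (\<phi> x * ?d x))"
    by (intro test_integrable_on[OF U_sets] test_mult_smooth[OF _ s] test_mult \<phi> d)+
  have fd: "frechet_derivative (\<lambda>x. (x \<bullet> b) * (\<phi> x * \<phi> x)) (at x) b = 2 * ((x \<bullet> b) * (\<phi> x * ?d x)) + \<phi> x * \<phi> x" for x
  proof -
    have "((\<lambda>x. x \<bullet> b) has_derivative (\<lambda>x. x \<bullet> b)) (at x)"
      by (intro bounded_linear_imp_has_derivative bounded_linear_inner_left)
    then have "frechet_derivative (\<lambda>x. x \<bullet> b) (at x) b = 1"
      using b by (metis frechet_derivative_at inner_same_Basis)
    then show ?thesis
      using \<phi> \<phi>2 s by (simp add: frechet_derivative_mult test_smooth smooth_fun_differentiable algebra_simps)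
  qed
  have "0 = (\<integral>x. 2 * ((x \<bullet> b) * (\<phi> x * ?d x)) + \<phi> x * \<phi> x \<partial>?M)"
    using integral_test_derivative[OF U_sets test_mult_smooth[OF \<phi>2 s] b] by (simp add: fd)
  also have "\<dots> = 2 * (\<integral>x. (x \<bullet> b) * (\<phi> x * ?d x) \<partial>?M) + (\<integral>x. \<phi> x * \<phi> x \<partial>?M)"
    using i by simp
  finally have 1: "(\<integral>x. \<phi> x * \<phi> x \<partial>?M) = (\<integral>x. - 2 * ((x \<bullet> b) * (\<phi> x * ?d x)) \<partial>?M)" by simp
  also have "\<dots> \<le> (\<integral>x. 1 / 2 * (\<phi> x * \<phi> x) + 2 * D\<^sup>2 * (?d x * ?d x) \<partial>?M)"
  proof (rule integral_mono)
    fix x assume "x \<in> space ?M"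
    then have "norm x \<le> D" using D by (simp add: space_restrict_space)
    then have xb: "\<bar>x \<bullet> b\<bar> \<le> \<bar>D\<bar>" using Cauchy_Schwarz_ineq2[of x b] b by simp
    have "0 \<le> (\<phi> x + 2 * ((x \<bullet> b) * ?d x))\<^sup>2" by simp
    then have "- 2 * ((x \<bullet> b) * (\<phi> x * ?d x)) \<le> 1 / 2 * (\<phi> x * \<phi> x) + 2 * ((x \<bullet> b)\<^sup>2 * (?d x * ?d x))"
      by (simp add: power2_eq_square algebra_simps)
    also have "(x \<bullet> b)\<^sup>2 * (?d x * ?d x) \<le> D\<^sup>2 * (?d x * ?d x)"
      using xb by (intro mult_right_mono) (auto simp: abs_le_square_iff)
    finally show "- 2 * ((x \<bullet> b) * (\<phi> x * ?d x)) \<le> 1 / 2 * (\<phi> x * \<phi> x) + 2 * D\<^sup>2 * (?d x * ?d x)"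
      by (simp add: mult_left_mono)
  qed (use i in auto)
  also have "\<dots> = 1 / 2 * (\<integral>x. \<phi> x * \<phi> x \<partial>?M) + 2 * D\<^sup>2 * (\<integral>x. ?d x * ?d x \<partial>?M)"
    using i by simp
  finally have "(\<integral>x. \<phi> x * \<phi> x \<partial>?M) \<le> 4 * D\<^sup>2 * (\<integral>x. ?d x * ?d x \<partial>?M)" by simp
  also have "\<dots> \<le> 4 * D\<^sup>2 * dirichlet \<phi>"
    using dirichlet_test_ge[OF \<phi> b] by (intro mult_left_mono) (auto simp: power2_eq_square)
  finally show ?thesis by (simp add: L2_inner_def)
qed

lemma Poincare:
  obtains C where "C > 0" "\<And>u. u \<in> H10 U \<Longrightarrow> L2_inner U u u \<le> C * dirichlet u"
proof -
  obtain D where D: "\<And>x. x \<in> U \<Longrightarrow> norm x \<le> D" "D > 0" using bounded_U bounded_pos by metis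
  obtain b :: 'a where b: "b \<in> Basis" using nonempty_Basis by blast
  define K where "K = 2 * D"
  have K: "K > 0" using D by (simp add: K_def)
  have t: "Lq_norm 2 U \<phi> \<le> K * Lq_norm 2 U (grad U \<phi>)" if "\<phi> \<in> test_functions U" for \<phi>
  proof (rule power2_le_imp_le)
    show "(Lq_norm 2 U \<phi>)\<^sup>2 \<le> (K * Lq_norm 2 U (grad U \<phi>))\<^sup>2"
      using Poincare_test[OF that D(1) b] by (simp add: power_mult_distrib Lq_norm_2_power2 dirichlet_eq K_def dirichlet_def)
  qed (use K in \<open>auto simp: Lq_norm_nonneg\<close>)
  have "Lq_norm 2 U u \<le> K * Lq_norm 2 U (grad U u)" if u: "u \<in> H10 U" for u
  proof (rule field_le_epsilon)
    fix e :: real assume e: "e > 0"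
    \<comment> \<open>The approximation error enters with factor K through the gradient and with
      factor 1 through the function.\<close>
    then have "e / (K + 1) > 0" using K by simp
    then obtain \<phi> where \<phi>: "\<phi> \<in> test_functions U" "H1_norm U (\<lambda>x. \<phi> x - u x) < e / (K + 1)"
      using u unfolding H10_iff_approx by blast
    let ?d = "H1_norm U (\<lambda>x. \<phi> x - u x)"
    have "Lq_norm 2 U u \<le> Lq_norm 2 U \<phi> + ?d"
      using L2_norm_triangle_diff[OF H10_H1[OF u] test_H1[OF \<phi>(1)]] H1_norm_minus_commute[OF H10_H1[OF u] test_H1[OF \<phi>(1)]] by simp
    also have "Lq_norm 2 U \<phi> \<le> K * Lq_norm 2 U (grad U \<phi>)" by (rule t[OF \<phi>(1)])
    also have "\<dots> \<le> K * (Lq_norm 2 U (grad U u) + ?d)"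
      using grad_norm_triangle_diff[OF test_H1[OF \<phi>(1)] H10_H1[OF u]] K by (intro mult_left_mono) auto
    also have "\<dots> + ?d = K * Lq_norm 2 U (grad U u) + (K + 1) * ?d" by (simp add: algebra_simps)
    also have "(K + 1) * ?d \<le> e" using \<phi>(2) K by (simp add: field_simps)
    finally show "Lq_norm 2 U u \<le> K * Lq_norm 2 U (grad U u) + e" by simp
  qed
  then have "L2_inner U u u \<le> K\<^sup>2 * dirichlet u" if "u \<in> H10 U" for u
    using power_mono[OF _ Lq_norm_nonneg, of 2 U u _ 2] that
    by (metis (no_types, lifting) Lq_norm_2_power2 dirichlet_eq power_mult_distrib)
  then show ?thesis using K by (intro that[of "K\<^sup>2"]) auto
qed

end

section \<open>The logarithmic nonlinearity\<close>

definition log_nonlin :: "real \<Rightarrow> real \<Rightarrow> real" where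
  "log_nonlin p s = s * \<bar>s\<bar> powr (p - 1) * ln \<bar>s\<bar>"

text \<open>The primitive of \<open>log_nonlin p\<close> that vanishes at 0. Its two terms are the
  integrands of J beside the gradient, which explains the last term of J.\<close>

definition log_primitive :: "real \<Rightarrow> real \<Rightarrow> real" where
  "log_primitive p s = \<bar>s\<bar> powr (1 + p) * ln \<bar>s\<bar> / (1 + p) - \<bar>s\<bar> powr (1 + p) / (1 + p)\<^sup>2"

text \<open>A majorant for powers times logarithms that is increasing and, thanks to the shift by 2,
  bounded away from 0 on s \<ge> 0. The exponent p - 1 belongs to the derivative of the
  nonlinearity; p + 1 arises after multiplication by two more factors.\<close>

definition log_weight :: "real \<Rightarrow> real \<Rightarrow> real" where
  "log_weight q s = (2 + s) powr q * ln (2 + s)"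

text \<open>This is ln x \<le> x - 1 at x = \<open>y powr (- a)\<close>.\<close>

lemma powr_mult_neg_ln_le:
  fixes y a :: real
  assumes "0 < y" "0 < a"
  shows "y powr a * - ln y \<le> 1 / a"
proof -
  have "ln (y powr (- a)) \<le> y powr (- a) - 1" using assms by (intro ln_le_minus_one) simp
  then have "a * - ln y \<le> y powr (- a)" using assms by (simp add: ln_powr)
  then have "y powr a * (a * - ln y) \<le> y powr a * y powr (- a)"
    by (rule mult_left_mono) simp
  also have "\<dots> = 1" using assms by (simp add: powr_add[symmetric])
  finally show ?thesis using assms by (simp add: field_simps)
qed

text \<open>The integrand of I changes sign at 1; after adding 1 it is nonnegative, as Fatou's lemma
  and the comparisons below require.\<close>

lemma powr_mult_ln_ge:
  fixes s :: real
  assumes "s \<ge> 0" "q \<ge> 1"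
  shows "s powr q * ln s \<ge> - 1"
proof (cases "s = 0")
  case False
  then have "s powr q * - ln s \<le> 1 / q" using assms by (intro powr_mult_neg_ln_le) auto
  also have "\<dots> \<le> 1" using assms by simp
  finally show ?thesis by simp
qed simp

lemma powr_mult_ln_tendsto_0:
  fixes a :: real
  assumes "a > 0"
  shows "((\<lambda>y. \<bar>y\<bar> powr a * ln \<bar>y\<bar>) \<longlongrightarrow> 0) (at 0)"
proof (rule Lim_null_comparison)
  have "((\<lambda>y. 2 / a * \<bar>y\<bar> powr (a / 2)) \<longlongrightarrow> 2 / a * \<bar>0\<bar> powr (a / 2)) (at (0::real))"
    using assms by (intro tendsto_intros) auto
  then show "((\<lambda>y. 2 / a * \<bar>y\<bar> powr (a / 2)) \<longlongrightarrow> 0) (at (0::real))" by simp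
  show "\<forall>\<^sub>F y in at 0. norm (\<bar>y\<bar> powr a * ln \<bar>y\<bar>) \<le> 2 / a * \<bar>y\<bar> powr (a / 2)"
    unfolding eventually_at
  proof (intro exI[of _ 1] conjI ballI impI)
    fix y :: real assume "y \<noteq> 0 \<and> dist y 0 < 1"
    then have y: "0 < \<bar>y\<bar>" "\<bar>y\<bar> < 1" by auto
    have "\<bar>y\<bar> powr a * - ln \<bar>y\<bar> = \<bar>y\<bar> powr (a / 2) * (\<bar>y\<bar> powr (a / 2) * - ln \<bar>y\<bar>)"
      by (simp add: powr_add[symmetric] mult.assoc[symmetric])
    \<comment> \<open>Half of the power absorbs the logarithm; the other half still tends to
      0.\<close>
    also have "\<dots> \<le> \<bar>y\<bar> powr (a / 2) * (1 / (a / 2))"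
      using powr_mult_neg_ln_le[of "\<bar>y\<bar>" "a / 2"] y assms by (intro mult_left_mono) auto
    finally show "norm (\<bar>y\<bar> powr a * ln \<bar>y\<bar>) \<le> 2 / a * \<bar>y\<bar> powr (a / 2)"
      using y by (simp add: abs_mult abs_of_neg mult.commute)
  qed simp
qed

text \<open>Carries a derivative from the positive to the negative half line, with c = 1 for even
  and c = -1 for odd functions.\<close>

lemma DERIV_even_odd:
  fixes f g :: "real \<Rightarrow> real"
  assumes f: "\<And>s. f (- s) = c * f s" and c: "c\<^sup>2 = 1"
    and d: "\<And>s. s > 0 \<Longrightarrow> (f has_real_derivative g s) (at s)" and s: "s < 0"
  shows "(f has_real_derivative - c * g (- s)) (at s)"
proof -
  have "((\<lambda>s. f (- s)) has_real_derivative g (- s) * - 1) (at s)"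
    using d[of "- s"] s by (intro DERIV_chain2[of f "g (- s)" uminus s "- 1"]) (auto intro!: derivative_eq_intros)
  then have "((\<lambda>s. c * f (- s)) has_real_derivative c * (g (- s) * - 1)) (at s)"
    by (rule DERIV_cmult)
  moreover have "c * f (- s) = f s" for s using f[of s] c by (simp add: power2_eq_square mult.assoc[symmetric])
  ultimately show ?thesis by simp
qed

lemma log_weight_nonneg: "s \<ge> 0 \<Longrightarrow> 0 \<le> log_weight q s"
  by (simp add: log_weight_def)

lemma log_weight_mono: "0 \<le> q \<Longrightarrow> 0 \<le> s \<Longrightarrow> s \<le> t \<Longrightarrow> log_weight q s \<le> log_weight q t"
  unfolding log_weight_def by (intro mult_mono powr_mono2) auto

lemma abs_diff_le_DERIV_bound:
  fixes f :: "real \<Rightarrow> real"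
  assumes "\<And>x. (f has_real_derivative f' x) (at x)"
    and "\<And>x. x \<in> closed_segment a b \<Longrightarrow> \<bar>f' x\<bar> \<le> B"
  shows "\<bar>f a - f b\<bar> \<le> B * \<bar>a - b\<bar>"
  using field_differentiable_bound[of "closed_segment a b" f f' B a b] assms
  by (auto intro: has_field_derivative_at_within)

lemma abs_closed_segment_le:
  fixes x a b :: real
  assumes "x \<in> closed_segment a b" "\<bar>a\<bar> \<le> R" "\<bar>b\<bar> \<le> R"
  shows "\<bar>x\<bar> \<le> R" "\<bar>x - b\<bar> \<le> \<bar>a - b\<bar>"
  using assms by (auto simp: closed_segment_eq_real_ivl split: if_splits)

context
  fixes p :: real
  assumes p: "p > 1"
begin

lemma log_nonlin_DERIV:
  "(log_nonlin p has_real_derivative p * (\<bar>s\<bar> powr (p - 1) * ln \<bar>s\<bar>) + \<bar>s\<bar> powr (p - 1)) (at s)"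
proof -
  have pos: "(log_nonlin p has_real_derivative p * (\<bar>s\<bar> powr (p - 1) * ln \<bar>s\<bar>) + \<bar>s\<bar> powr (p - 1)) (at s)"
    if s: "s > 0" for s
  proof -
    have e: "s powr (p - 1) = s * s powr (p - 2)" if "s > 0" for s :: real
      using that powr_add[of s 1 "p - 2"] by simp
    have "((\<lambda>s. s * s powr (p - 1) * ln s) has_real_derivative
        p * (s powr (p - 1) * ln s) + s powr (p - 1)) (at s)"
      using s by (auto intro!: derivative_eq_intros simp: e field_simps)
    then have "(log_nonlin p has_real_derivative p * (s powr (p - 1) * ln s) + s powr (p - 1)) (at s)"
      by (rule has_field_derivative_transform_within_open[of _ _ _ "{0<..}"])
         (use s in \<open>auto simp: log_nonlin_def\<close>)
    then show ?thesis using s by simp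
  qed
  consider "s > 0" | "s = 0" | "s < 0" by linarith
  then show ?thesis
  proof cases
    case 1
    then show ?thesis by (rule pos)
  next
    case 2
    \<comment> \<open>This is the difference quotient at 0; it tends to 0 because p > 1, and the
      claimed formula also gives 0 there since 0 to any power is 0.\<close>
    have "((\<lambda>y. \<bar>y\<bar> powr (p - 1) * ln \<bar>y\<bar>) \<longlongrightarrow> 0) (at 0)"
      using p by (intro powr_mult_ln_tendsto_0) simp
    then have "((\<lambda>h. (log_nonlin p (0 + h) - log_nonlin p 0) / h) \<longlongrightarrow> 0) (at 0)"
      by (rule Lim_transform_eventually) (auto simp: log_nonlin_def eventually_at_filter)
    then show ?thesis using 2 by (simp add: DERIV_def)
  next
    case 3
    have "(log_nonlin p has_real_derivative
      - (-1) * (p * (\<bar>- s\<bar> powr (p - 1) * ln \<bar>- s\<bar>) + \<bar>- s\<bar> powr (p - 1))) (at s)"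
      by (rule DERIV_even_odd[OF _ _ pos 3]) (auto simp: log_nonlin_def)
    then show ?thesis by simp
  qed
qed

lemma log_primitive_DERIV: "(log_primitive p has_real_derivative log_nonlin p s) (at s)"
proof -
  have pos: "(log_primitive p has_real_derivative log_nonlin p s) (at s)" if s: "s > 0" for s
  proof -
    have e: "s powr (1 + p) = s * s powr p" "s powr p = s * s powr (p - 1)" if "s > 0" for s :: real
      using that powr_add[of s 1 p] powr_add[of s 1 "p - 1"] by simp_all
    define c where "c = 1 / (1 + p)"
    have c: "c * (1 + p) = 1" using p by (simp add: c_def)
    have "((\<lambda>s. c * (s powr (1 + p) * ln s) - c * c * s powr (1 + p)) has_real_derivative
        c * ((1 + p) * s powr p * ln s + s powr p) - c * c * ((1 + p) * s powr p)) (at s)"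
      using s by (auto intro!: derivative_eq_intros simp: e(1))
    moreover have "c * ((1 + p) * s powr p * ln s + s powr p) - c * c * ((1 + p) * s powr p)
        = (c * (1 + p)) * (s powr p * ln s) + c * s powr p - (c * (1 + p)) * (c * s powr p)"
      by (simp add: algebra_simps)
    ultimately have "((\<lambda>s. s powr (1 + p) * ln s / (1 + p) - s powr (1 + p) / (1 + p)\<^sup>2) has_real_derivative
        s * s powr (p - 1) * ln s) (at s)"
      using s by (simp add: c e(2)) (simp add: c_def power2_eq_square mult_ac)
    then have "(log_primitive p has_real_derivative s * s powr (p - 1) * ln s) (at s)"
      by (rule has_field_derivative_transform_within_open[of _ _ _ "{0<..}"])
         (use s in \<open>auto simp: log_primitive_def\<close>)
    then show ?thesis using s by (simp add: log_nonlin_def)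
  qed
  consider "s > 0" | "s = 0" | "s < 0" by linarith
  then show ?thesis
  proof cases
    case 1
    then show ?thesis by (rule pos)
  next
    case 2
    have 1: "((\<lambda>y. \<bar>y\<bar> powr p * ln \<bar>y\<bar>) \<longlongrightarrow> 0) (at 0)"
      using p by (intro powr_mult_ln_tendsto_0) simp
    have lim2: "((\<lambda>y. \<bar>y\<bar> powr p) \<longlongrightarrow> \<bar>0\<bar> powr p) (at (0::real))"
      using p by (intro tendsto_intros) auto
    have "((\<lambda>y. sgn y * (\<bar>y\<bar> powr p * ln \<bar>y\<bar> / (1 + p) - \<bar>y\<bar> powr p / (1 + p)\<^sup>2)) \<longlongrightarrow> 0) (at 0)"
    proof (rule Lim_null_comparison)
      show "\<forall>\<^sub>F y in at 0. norm (sgn y * (\<bar>y\<bar> powr p * ln \<bar>y\<bar> / (1 + p) - \<bar>y\<bar> powr p / (1 + p)\<^sup>2))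
        \<le> \<bar>\<bar>y\<bar> powr p * ln \<bar>y\<bar> / (1 + p) - \<bar>y\<bar> powr p / (1 + p)\<^sup>2\<bar>"
        by (intro always_eventually allI) (simp add: abs_mult abs_sgn_eq)
      have "((\<lambda>y. \<bar>\<bar>y\<bar> powr p * ln \<bar>y\<bar> / (1 + p) - \<bar>y\<bar> powr p / (1 + p)\<^sup>2\<bar>)
          \<longlongrightarrow> \<bar>0 / (1 + p) - \<bar>0\<bar> powr p / (1 + p)\<^sup>2\<bar>) (at 0)"
        using p by (intro tendsto_intros 1 lim2) auto
      then show "((\<lambda>y. \<bar>\<bar>y\<bar> powr p * ln \<bar>y\<bar> / (1 + p) - \<bar>y\<bar> powr p / (1 + p)\<^sup>2\<bar>) \<longlongrightarrow> 0) (at 0)"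
        by simp
    qed
    then have "((\<lambda>h. (log_primitive p (0 + h) - log_primitive p 0) / h) \<longlongrightarrow> 0) (at 0)"
    proof (rule Lim_transform_eventually)
      have "sgn y * (\<bar>y\<bar> powr p * ln \<bar>y\<bar> / (1 + p) - \<bar>y\<bar> powr p / (1 + p)\<^sup>2)
          = (log_primitive p (0 + y) - log_primitive p 0) / y" if "y \<noteq> 0" for y
      proof -
        have "\<bar>y\<bar> powr (1 + p) = \<bar>y\<bar> * \<bar>y\<bar> powr p" using that by (simp add: powr_add)
        then show ?thesis using that
          by (cases "y > 0") (simp_all add: log_primitive_def diff_divide_distrib)
      qed
      then show "\<forall>\<^sub>F y in at 0. sgn y * (\<bar>y\<bar> powr p * ln \<bar>y\<bar> / (1 + p) - \<bar>y\<bar> powr p / (1 + p)\<^sup>2)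
          = (log_primitive p (0 + y) - log_primitive p 0) / y"
        by (auto simp: eventually_at_filter)
    qed
    then show ?thesis using 2 by (simp add: DERIV_def log_nonlin_def)
  next
    case 3
    have "(log_primitive p has_real_derivative - 1 * log_nonlin p (- s)) (at s)"
      by (rule DERIV_even_odd[OF _ _ pos 3]) (auto simp: log_primitive_def)
    then show ?thesis by (simp add: log_nonlin_def)
  qed
qed

text \<open>Combines two regimes: p + 1 serves \<bar>s\<bar> \<ge> 1, and the bound p / (p - 1) + 1
  for \<bar>s\<bar> < 1 is doubled because the weight is there bounded below only by 1/2.\<close>

definition nonlin_const :: real where
  "nonlin_const = 2 * (p / (p - 1) + 1) + p + 1"

lemma nonlin_const_pos: "nonlin_const > 0"
  using p by (simp add: nonlin_const_def add_pos_pos)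

lemma log_nonlin_derivative_bound:
  "\<bar>p * (\<bar>s\<bar> powr (p - 1) * ln \<bar>s\<bar>) + \<bar>s\<bar> powr (p - 1)\<bar> \<le> nonlin_const * log_weight (p - 1) \<bar>s\<bar>"
proof (cases "\<bar>s\<bar> \<ge> 1")
  case True
  define t where "t = \<bar>s\<bar>"
  have t: "t \<ge> 1" using True by (simp add: t_def)
  have "ln (exp 1) \<le> ln (2 + t)" using t exp_le by (subst ln_le_cancel_iff) auto
  then have l: "1 \<le> ln (2 + t)" by simp
  have "t powr (p - 1) * ln t \<le> log_weight (p - 1) t"
    unfolding log_weight_def using t p by (intro mult_mono powr_mono2) auto
  moreover have "t powr (p - 1) * 1 \<le> log_weight (p - 1) t"
    unfolding log_weight_def using t p l by (intro mult_mono powr_mono2) auto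
  moreover have "0 \<le> t powr (p - 1) * ln t" using t by simp
  ultimately have "\<bar>p * (t powr (p - 1) * ln t) + t powr (p - 1)\<bar> \<le> p * log_weight (p - 1) t + 1 * log_weight (p - 1) t"
    using p by (subst abs_of_nonneg) (auto intro!: add_mono mult_left_mono)
  also have "\<dots> \<le> nonlin_const * log_weight (p - 1) t"
    unfolding distrib_right[symmetric] using p t
    by (intro mult_right_mono log_weight_nonneg) (auto simp: nonlin_const_def)
  finally show ?thesis by (simp add: t_def)
next
  case False
  define t where "t = \<bar>s\<bar>"
  have t: "t \<ge> 0" "t < 1" using False by (auto simp: t_def)
  have k0: "0 \<le> p / (p - 1) + 1" using p by simp
  have 1: "\<bar>p * (t powr (p - 1) * ln t) + t powr (p - 1)\<bar> \<le> p / (p - 1) + 1"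
  proof (cases "t = 0")
    case True
    then show ?thesis using k0 by simp
  next
    case False
    then have t0: "t > 0" using t by simp
    have "t powr (p - 1) * - ln t \<le> 1 / (p - 1)" using t0 p by (intro powr_mult_neg_ln_le) auto
    then have "p * (t powr (p - 1) * - ln t) \<le> p * (1 / (p - 1))" using p by (intro mult_left_mono) auto
    moreover have "0 \<le> p * (t powr (p - 1) * - ln t)" using p t t0 by (intro mult_nonneg_nonneg) auto
    moreover have "t powr (p - 1) \<le> 1" using t t0 p by (intro powr_le1) auto
    moreover have "0 \<le> t powr (p - 1)" by simp
    ultimately show ?thesis
      unfolding abs_le_iff mult_minus_right times_divide_eq_right mult_1_right by linarith
  qed
  have "ln 2 \<ge> (1/2 :: real)" using ln2_ge_two_thirds by simp
  moreover have "ln 2 \<le> ln (2 + t)" using t by simp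
  ultimately have "1 / 2 \<le> ln (2 + t)" by linarith
  then have "1 * (1 / 2) \<le> log_weight (p - 1) t"
    unfolding log_weight_def using t p by (intro mult_mono ge_one_powr_ge_zero) auto
  then have "(p / (p - 1) + 1) * 1 \<le> (p / (p - 1) + 1) * (2 * log_weight (p - 1) t)"
    using k0 by (intro mult_left_mono) auto
  also have "\<dots> \<le> nonlin_const * log_weight (p - 1) t"
  proof -
    have "(p / (p - 1) + 1) * 2 \<le> nonlin_const"
    proof -
      have "X * 2 \<le> 2 * X + p + 1" for X :: real using p by simp
      then show ?thesis unfolding nonlin_const_def .
    qed
    then show ?thesis
      unfolding mult.assoc[symmetric] using t by (intro mult_right_mono log_weight_nonneg)
  qed
  finally show ?thesis using 1 by (simp add: t_def)
qed

lemma log_nonlin_Lipschitz: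
  assumes "\<bar>a\<bar> \<le> R" "\<bar>b\<bar> \<le> R"
  shows "\<bar>log_nonlin p a - log_nonlin p b\<bar> \<le> nonlin_const * log_weight (p - 1) R * \<bar>a - b\<bar>"
proof (rule abs_diff_le_DERIV_bound[OF log_nonlin_DERIV])
  fix x assume "x \<in> closed_segment a b"
  then have "\<bar>x\<bar> \<le> R" using assms by (rule abs_closed_segment_le)
  then have "nonlin_const * log_weight (p - 1) \<bar>x\<bar> \<le> nonlin_const * log_weight (p - 1) R"
    using p nonlin_const_pos by (intro mult_left_mono log_weight_mono) auto
  with log_nonlin_derivative_bound[of x]
  show "\<bar>p * (\<bar>x\<bar> powr (p - 1) * ln \<bar>x\<bar>) + \<bar>x\<bar> powr (p - 1)\<bar> \<le> nonlin_const * log_weight (p - 1) R"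
    by linarith
qed

text \<open>The mean value inequality for the primitive minus its tangent at b: the derivative of
  this difference is \<open>log_nonlin p x - log_nonlin p b\<close>, which is itself Lipschitz
  small.\<close>

lemma log_primitive_expansion:
  assumes "\<bar>a\<bar> \<le> R" "\<bar>b\<bar> \<le> R"
  shows "\<bar>log_primitive p a - log_primitive p b - log_nonlin p b * (a - b)\<bar>
    \<le> nonlin_const * log_weight (p - 1) R * (a - b)\<^sup>2"
proof -
  let ?K = "nonlin_const * log_weight (p - 1) R"
  have "\<bar>(log_primitive p a - log_nonlin p b * a) - (log_primitive p b - log_nonlin p b * b)\<bar>
      \<le> (?K * \<bar>a - b\<bar>) * \<bar>a - b\<bar>"
  proof (rule abs_diff_le_DERIV_bound)
    show "((\<lambda>x. log_primitive p x - log_nonlin p b * x) has_real_derivative log_nonlin p x - log_nonlin p b) (at x)" for x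
      by (auto intro!: derivative_eq_intros log_primitive_DERIV)
    fix x assume x: "x \<in> closed_segment a b"
    have "R \<ge> 0" using assms by linarith
    then have "?K \<ge> 0" using nonlin_const_pos by (simp add: log_weight_nonneg)
    then have "?K * \<bar>x - b\<bar> \<le> ?K * \<bar>a - b\<bar>"
      using abs_closed_segment_le(2)[OF x assms] by (intro mult_left_mono) auto
    with log_nonlin_Lipschitz[of x R b] abs_closed_segment_le(1)[OF x assms] assms
    show "\<bar>log_nonlin p x - log_nonlin p b\<bar> \<le> ?K * \<bar>a - b\<bar>" by linarith
  qed
  also have "\<dots> = ?K * (a - b)\<^sup>2" by (simp add: power2_eq_square)
  finally show ?thesis by (simp add: algebra_simps)
qed

text \<open>Replaces Hoelder's inequality. With M the maximum of the four arguments, c and d are at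
  most 2 + 4 M and raise the exponent from p - 1 to p + 1; a + b \<le> 4 M; and the weight at 4 M is
  one of the four summands.\<close>

lemma log_weight_mult_le:
  assumes "0 \<le> a" "0 \<le> b" "0 \<le> c" "0 \<le> d"
  shows "log_weight (p - 1) (a + b) * c * d
    \<le> log_weight (p + 1) (4 * a) + log_weight (p + 1) (4 * b) + log_weight (p + 1) (4 * c) + log_weight (p + 1) (4 * d)"
proof -
  define M where "M = Max {a, b, c, d}"
  have M: "a \<le> M" "b \<le> M" "c \<le> M" "d \<le> M" by (simp_all add: M_def)
  have "M \<in> {a, b, c, d}" unfolding M_def by (rule Max_in) auto
  have M0: "M \<ge> 0" using M assms by linarith
  have "log_weight (p - 1) (a + b) * c * d \<le> log_weight (p - 1) (4 * M) * (2 + 4 * M) * (2 + 4 * M)"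
    using M M0 assms p by (intro mult_mono log_weight_mono log_weight_nonneg mult_nonneg_nonneg) auto
  also have "\<dots> = (2 + 4 * M) powr (p - 1) * (2 + 4 * M) powr 2 * ln (2 + 4 * M)"
    using M0 by (simp add: log_weight_def power2_eq_square mult_ac)
  also have "\<dots> = log_weight (p + 1) (4 * M)"
    using M0 by (simp add: log_weight_def powr_add[symmetric] add.commute[of p 1] del: powr_numeral)
  also have "\<dots> \<le> log_weight (p + 1) (4 * a) + log_weight (p + 1) (4 * b) + log_weight (p + 1) (4 * c) + log_weight (p + 1) (4 * d)"
    using \<open>M \<in> {a, b, c, d}\<close> log_weight_nonneg[of "4 * a" "p + 1"] log_weight_nonneg[of "4 * b" "p + 1"]
      log_weight_nonneg[of "4 * c" "p + 1"] log_weight_nonneg[of "4 * d" "p + 1"] assms by auto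
  finally show ?thesis .
qed

text \<open>Only after scaling down is the integral of the logarithmic term under control. This
  bounds the weight of the original function by the integrand of the scaled one.\<close>

lemma log_weight_le_scaled:
  assumes c: "0 < c" "c \<le> 1"
  obtains K where "K \<ge> 0" "\<And>s. s \<ge> 0 \<Longrightarrow>
    log_weight (p + 1) s \<le> K * (1 + ((c * s) powr (1 + p) * ln (c * s) + 1))"
proof -
  \<comment> \<open>\<open>K1\<close> serves c s \<ge> 2, where 2 + s \<le> (2 / c) (c s) and the
    constant ln (2 / c) is absorbed by ln (c s) \<ge> ln 2; \<open>K2\<close> bounds the weight
    where c s < 2, that is s \<le> 2 / c.\<close>
  define K1 where "K1 = (2 / c) powr (p + 1) * (1 + ln (2 / c) / ln 2)"
  define K2 where "K2 = log_weight (p + 1) (2 / c)"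
  have l0: "ln (2 / c) \<ge> 0" using c by (intro ln_ge_zero) (simp add: field_simps)
  then have K1: "K1 \<ge> 0" by (simp add: K1_def)
  have K2: "K2 \<ge> 0" using c by (simp add: K2_def log_weight_nonneg)
  have "log_weight (p + 1) s \<le> (K1 + K2) * (1 + ((c * s) powr (1 + p) * ln (c * s) + 1))" if s: "s \<ge> 0" for s
  proof -
    define t where "t = c * s"
    have t: "t \<ge> 0" using c s by (simp add: t_def)
    have g: "t powr (1 + p) * ln t + 1 \<ge> 0" using powr_mult_ln_ge[OF t, of "1 + p"] p by simp
    show ?thesis
    proof (cases "t \<ge> 2")
      case True
      have "2 + s \<le> 2 / c * t"
      proof -
        have "2 + s \<le> (2 + t) / c" using c s by (simp add: t_def field_simps)
        also have "\<dots> \<le> (2 * t) / c" using True c by (intro divide_right_mono) auto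
        finally show ?thesis by simp
      qed
      then have "log_weight (p + 1) s \<le> (2 / c * t) powr (p + 1) * ln (2 / c * t)"
        unfolding log_weight_def using s p True by (intro mult_mono powr_mono2) auto
      also have "\<dots> = (2 / c) powr (p + 1) * t powr (p + 1) * (ln (2 / c) + ln t)"
        using c True by (subst powr_mult) (auto simp: ln_mult ln_div)
      also have "\<dots> \<le> (2 / c) powr (p + 1) * t powr (p + 1) * (ln (2 / c) / ln 2 * ln t + ln t)"
      proof (intro mult_left_mono add_right_mono)
        have "ln (2 / c) * 1 \<le> ln (2 / c) * (ln t / ln 2)"
          using l0 True by (intro mult_left_mono) (auto simp: field_simps)
        then show "ln (2 / c) \<le> ln (2 / c) / ln 2 * ln t" by simp
      qed auto
      also have "\<dots> = K1 * (t powr (1 + p) * ln t)"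
        by (simp add: K1_def algebra_simps)
      also have "\<dots> \<le> (K1 + K2) * (1 + (t powr (1 + p) * ln t + 1))"
        using K1 K2 g True by (intro mult_mono) auto
      finally show ?thesis by (simp add: t_def)
    next
      case False
      then have "s \<le> 2 / c" using c by (simp add: t_def field_simps)
      then have "log_weight (p + 1) s \<le> K2 * 1"
        unfolding K2_def using s p by (simp add: log_weight_mono)
      also have "\<dots> \<le> (K1 + K2) * (1 + (t powr (1 + p) * ln t + 1))"
        using K1 K2 g by (intro mult_mono) auto
      finally show ?thesis by (simp add: t_def)
    qed
  qed
  with K1 K2 show ?thesis by (intro that[of "K1 + K2"]) auto
qed

text \<open>Below the level M two powers are kept for the L^2 norm, above it ln s \<ge> ln M. A
  large M makes the logarithmic contribution small.\<close>

lemma powr_le_truncation: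
  fixes M s :: real
  assumes M: "M > 1" and s: "s \<ge> 0"
  shows "s powr (1 + p) \<le> M powr (p - 1) * s\<^sup>2 + (s powr (1 + p) * ln s + 1) / ln M"
proof -
  have g: "(s powr (1 + p) * ln s + 1) / ln M \<ge> 0"
    using powr_mult_ln_ge[OF s, of "1 + p"] p M by simp
  show ?thesis
  proof (cases "s \<le> M")
    case True
    have "s powr (1 + p) = s powr (p - 1) * s powr 2" by (simp add: powr_add[symmetric] del: powr_numeral)
    also have "\<dots> \<le> M powr (p - 1) * s\<^sup>2"
      using True s p by (intro mult_mono powr_mono2) auto
    finally show ?thesis using g by simp
  next
    case False
    then have "s powr (1 + p) * ln M \<le> s powr (1 + p) * ln s"
      using M by (intro mult_left_mono) auto
    then have "s powr (1 + p) \<le> (s powr (1 + p) * ln s + 1) / ln M"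
      using M by (simp add: pos_le_divide_eq)
    moreover have "0 \<le> M powr (p - 1) * s\<^sup>2" by simp
    ultimately show ?thesis by linarith
  qed
qed

lemma log_nonlin_mult_self: "log_nonlin p s * s = \<bar>s\<bar> powr (1 + p) * ln \<bar>s\<bar>"
proof (cases "s = 0")
  case False
  then have "\<bar>s\<bar> powr (1 + p) = \<bar>s\<bar> powr (p - 1) * \<bar>s\<bar> powr 2"
    by (simp add: powr_add[symmetric] del: powr_numeral)
  then show ?thesis by (simp add: log_nonlin_def power2_eq_square mult_ac)
qed (simp add: log_nonlin_def)

end

section \<open>The potential well\<close>

locale log_functionals = bounded_open_set U
  for U :: "'a::euclidean_space set" +
  fixes p :: real
  assumes p: "p > 1"
begin

definition log_integral :: "('a \<Rightarrow> real) \<Rightarrow> real" where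
  "log_integral u = (\<integral>x. \<bar>u x\<bar> powr (1 + p) * ln \<bar>u x\<bar> \<partial>lebesgue_on U)"

definition power_integral :: "('a \<Rightarrow> real) \<Rightarrow> real" where
  "power_integral u = (\<integral>x. \<bar>u x\<bar> powr (1 + p) \<partial>lebesgue_on U)"

text \<open>Carried as a separate predicate: for elements of H_0^1 it is established only in
  \<open>H10_log_integrable\<close>, whose proof relies on results about functions already known to
  satisfy it.\<close>

definition log_integrable :: "('a \<Rightarrow> real) \<Rightarrow> bool" where
  "log_integrable u \<longleftrightarrow> integrable (lebesgue_on U) (\<lambda>x. \<bar>u x\<bar> powr (1 + p) * ln \<bar>u x\<bar>)"

lemma I_fun_eq: "I_fun U p u = dirichlet u - log_integral u"
  by (simp add: I_fun_def dirichlet_eq log_integral_def)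

lemma power_integral_nonneg: "0 \<le> power_integral u"
  by (simp add: power_integral_def)

lemma J_fun_eq:
  "J_fun U p u = 1 / 2 * dirichlet u - log_integral u / (1 + p) + power_integral u / (1 + p)\<^sup>2"
proof -
  have "Lq_norm (1 + p) U u powr (1 + p) = power_integral u"
    using p power_integral_nonneg[of u] by (simp add: Lq_norm_def powr_powr power_integral_def)
  then show ?thesis by (simp add: J_fun_def dirichlet_eq log_integral_def)
qed

text \<open>Eliminates the logarithmic integral. Beside I only nonnegative terms remain, so J is
  nonnegative on the Nehari manifold, and J controls the gradient wherever I \<ge> 0.\<close>

lemma J_fun_I_fun:
  "J_fun U p u = I_fun U p u / (1 + p) + (p - 1) / (2 * (1 + p)) * dirichlet u + power_integral u / (1 + p)\<^sup>2"
proof -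
  have "1 / 2 * dirichlet u = dirichlet u / (1 + p) + (p - 1) / (2 * (1 + p)) * dirichlet u"
  proof -
    define c where "c = 1 / (1 + p)"
    have "c * (1 + p) = 1" using p by (simp add: c_def)
    moreover have "c + (p - 1) * c / 2 = c * (1 + p) / 2" by (simp add: field_simps)
    ultimately have "c + (p - 1) * c / 2 = 1 / 2" by simp
    then have "1 / 2 * dirichlet u = (c + (p - 1) * c / 2) * dirichlet u" by simp
    then show ?thesis by (simp add: c_def algebra_simps)
  qed
  then show ?thesis by (simp add: J_fun_eq I_fun_eq diff_divide_distrib)
qed

lemma well_depth_le:
  assumes "u \<in> H10 U" "I_fun U p u = 0" "dirichlet u \<noteq> 0"
  shows "well_depth U p \<le> J_fun U p u"
  unfolding well_depth_def
proof (rule cINF_lower)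
  show "bdd_below (J_fun U p ` nehari U p)"
  proof (rule bdd_belowI2)
    fix w assume "w \<in> nehari U p"
    then have "I_fun U p w = 0" by (simp add: nehari_def)
    then show "0 \<le> J_fun U p w"
      using p power_integral_nonneg[of w] dirichlet_nonneg[of w] by (simp add: J_fun_I_fun)
  qed
  show "u \<in> nehari U p" using assms by (simp add: nehari_def dirichlet_eq)
qed

lemma log_integrable_power:
  assumes u: "u \<in> L2_space U" and "log_integrable u"
  shows "integrable (lebesgue_on U) (\<lambda>x. \<bar>u x\<bar> powr (1 + p))"
proof (rule Bochner_Integration.integrable_bound)
  note [measurable] = L2_spaceD(1)[OF u]
  have "integrable (lebesgue_on U) (\<lambda>x. 1::real)"
    by (intro finite_measure.integrable_const finite_measure_lebesgue_on U_lmeasurable)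
  then show "integrable (lebesgue_on U) (\<lambda>x. exp 1 powr (p - 1) * \<bar>u x\<bar>\<^sup>2 + (\<bar>u x\<bar> powr (1 + p) * ln \<bar>u x\<bar> + 1) / ln (exp 1))"
    using L2_spaceD(2)[OF u] assms(2) by (simp add: log_integrable_def)
  show "(\<lambda>x. \<bar>u x\<bar> powr (1 + p)) \<in> borel_measurable (lebesgue_on U)" by measurable
  show "AE x in lebesgue_on U. norm (\<bar>u x\<bar> powr (1 + p))
      \<le> norm (exp 1 powr (p - 1) * \<bar>u x\<bar>\<^sup>2 + (\<bar>u x\<bar> powr (1 + p) * ln \<bar>u x\<bar> + 1) / ln (exp 1))"
  proof (rule AE_I2)
    fix x
    have "\<bar>u x\<bar> powr (1 + p) \<le> exp 1 powr (p - 1) * \<bar>u x\<bar>\<^sup>2 + (\<bar>u x\<bar> powr (1 + p) * ln \<bar>u x\<bar> + 1) / ln (exp 1)"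
      by (rule powr_le_truncation[OF p]) auto
    then show "norm (\<bar>u x\<bar> powr (1 + p))
      \<le> norm (exp 1 powr (p - 1) * \<bar>u x\<bar>\<^sup>2 + (\<bar>u x\<bar> powr (1 + p) * ln \<bar>u x\<bar> + 1) / ln (exp 1))"
      unfolding real_norm_def by (smt (verit) powr_ge_zero)
  qed
qed

lemma scale_integrand:
  assumes c: "c > 0"
  shows "\<bar>c * s\<bar> powr (1 + p) = c powr (1 + p) * \<bar>s\<bar> powr (1 + p)"
    and "\<bar>c * s\<bar> powr (1 + p) * ln \<bar>c * s\<bar> = c powr (1 + p) * (\<bar>s\<bar> powr (1 + p) * ln \<bar>s\<bar> + ln c * \<bar>s\<bar> powr (1 + p))"
proof -
  show 1: "\<bar>c * s\<bar> powr (1 + p) = c powr (1 + p) * \<bar>s\<bar> powr (1 + p)"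
    using c by (simp add: abs_mult powr_mult)
  show "\<bar>c * s\<bar> powr (1 + p) * ln \<bar>c * s\<bar> = c powr (1 + p) * (\<bar>s\<bar> powr (1 + p) * ln \<bar>s\<bar> + ln c * \<bar>s\<bar> powr (1 + p))"
  proof (cases "s = 0")
    case False
    then have "ln \<bar>c * s\<bar> = ln c + ln \<bar>s\<bar>" using c by (simp add: abs_mult ln_mult)
    then show ?thesis unfolding 1 by (simp add: algebra_simps)
  qed simp
qed

lemma log_integrable_scale:
  assumes u: "u \<in> L2_space U" "log_integrable u" and c: "c > 0"
  shows "log_integrable (\<lambda>x. c * u x)"
    and "log_integral (\<lambda>x. c * u x) = c powr (1 + p) * (log_integral u + ln c * power_integral u)"
    and "power_integral (\<lambda>x. c * u x) = c powr (1 + p) * power_integral u"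
proof -
  note i = log_integrable_power[OF u] u(2)[unfolded log_integrable_def]
  show "log_integrable (\<lambda>x. c * u x)"
    "log_integral (\<lambda>x. c * u x) = c powr (1 + p) * (log_integral u + ln c * power_integral u)"
    using i by (simp_all add: log_integrable_def log_integral_def power_integral_def scale_integrand(2)[OF c])
  show "power_integral (\<lambda>x. c * u x) = c powr (1 + p) * power_integral u"
    by (simp add: power_integral_def scale_integrand(1)[OF c])
qed

lemma I_fun_scale:
  assumes u: "u \<in> H1 U" "log_integrable u" and c: "c > 0"
  shows "I_fun U p (\<lambda>x. c * u x) = c\<^sup>2 * dirichlet u - c powr (1 + p) * (log_integral u + ln c * power_integral u)"
  using u c by (simp add: I_fun_eq dirichlet_scale log_integrable_scale H1_L2)

text \<open>Along a ray I is an explicit continuous function of the factor, so a change of sign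
  yields a zero of I.\<close>

lemma I_fun_scale_IVT:
  assumes u: "u \<in> H1 U" "log_integrable u" and a: "0 < a" "a \<le> b"
    and I: "I_fun U p (\<lambda>x. a * u x) \<ge> 0" "I_fun U p (\<lambda>x. b * u x) \<le> 0"
  obtains c where "a \<le> c" "c \<le> b" "I_fun U p (\<lambda>x. c * u x) = 0"
proof -
  define f where "f c = c\<^sup>2 * dirichlet u - c powr (1 + p) * (log_integral u + ln c * power_integral u)" for c
  have f: "f c = I_fun U p (\<lambda>x. c * u x)" if "c > 0" for c
    unfolding f_def using I_fun_scale[OF u that] by simp
  have "continuous_on {a..b} f"
    unfolding f_def using a by (intro continuous_intros) auto
  then obtain c where "a \<le> c" "c \<le> b" "f c = 0"
    using IVT2'[of f b 0 a] I a by (auto simp: f)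
  with a show ?thesis by (intro that[of c]) (auto simp: f)
qed

lemma log_integral_plus_measure:
  assumes "u \<in> H1 U" "log_integrable u"
  shows "integrable (lebesgue_on U) (\<lambda>x. \<bar>u x\<bar> powr (1 + p) * ln \<bar>u x\<bar> + 1)"
    and "(\<integral>x. (\<bar>u x\<bar> powr (1 + p) * ln \<bar>u x\<bar> + 1) \<partial>lebesgue_on U) = log_integral u + measure lebesgue U"
proof -
  have 1: "integrable (lebesgue_on U) (\<lambda>x. 1::real)"
    by (intro finite_measure.integrable_const finite_measure_lebesgue_on U_lmeasurable)
  have m: "measure (lebesgue_on U) U = measure lebesgue U"
    using U_sets by (simp add: measure_restrict_space)
  show "integrable (lebesgue_on U) (\<lambda>x. \<bar>u x\<bar> powr (1 + p) * ln \<bar>u x\<bar> + 1)"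
    using 1 assms(2) by (simp add: log_integrable_def)
  show "(\<integral>x. (\<bar>u x\<bar> powr (1 + p) * ln \<bar>u x\<bar> + 1) \<partial>lebesgue_on U) = log_integral u + measure lebesgue U"
    using 1 assms(2) m by (simp add: log_integrable_def log_integral_def space_restrict_space)
qed

end

locale log_potential_well = log_functionals +
  assumes depth_pos: "well_depth U p > 0"
begin

text \<open>Positivity of the depth of the well replaces the Sobolev embedding: if the conclusion failed
  for arbitrarily small gradients, rescaling down to the Nehari manifold would give functions with
  small \<open>J\<close> there.\<close>

lemma I_fun_nonneg_small:
  obtains \<epsilon> where "\<epsilon> > 0"
    "\<And>u. u \<in> H10 U \<Longrightarrow> log_integrable u \<Longrightarrow> dirichlet u \<le> \<epsilon> \<Longrightarrow> I_fun U p u \<ge> 0"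
proof -
  obtain C where C: "C > 0" "\<And>u. u \<in> H10 U \<Longrightarrow> L2_inner U u u \<le> C * dirichlet u"
    using Poincare by metis
  define d q \<mu> where "d = well_depth U p" and "q = (1 + p)\<^sup>2" and "\<mu> = measure lebesgue U"
  have d: "d > 0" using depth_pos by (simp add: d_def)
  have q: "q > 0" using p by (simp add: q_def)
  have \<mu>: "\<mu> \<ge> 0" by (simp add: \<mu>_def)
  \<comment> \<open>The truncation level is exp m, with m so large that (1 + \<mu>) / m = d q / 4,
    and B is the resulting coefficient of the gradient. Then \<epsilon> makes the gradient term of J
    at most d / 4 and the power integral at most d q / 4 + d q / 4, so that J \<le> 3 d / 4.\<close>
  define m where "m = 4 * (1 + \<mu>) / (d * q)"
  have m: "m > 0" using d q \<mu> by (simp add: m_def add_pos_nonneg)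
  define B where "B = exp m powr (p - 1) * C"
  have B: "B > 0" using C by (simp add: B_def)
  define \<epsilon> where "\<epsilon> = Min {1, d / 4, d * q / (4 * B)}"
  have \<epsilon>0: "\<epsilon> > 0" using d q B by (simp add: \<epsilon>_def)
  have \<epsilon>: "\<epsilon> \<le> 1" "\<epsilon> \<le> d / 4" "\<epsilon> \<le> d * q / (4 * B)" unfolding \<epsilon>_def by (auto intro!: Min_le)
  have "I_fun U p u \<ge> 0" if u: "u \<in> H10 U" "log_integrable u" "dirichlet u \<le> \<epsilon>" for u
  proof (rule ccontr)
    assume "\<not> I_fun U p u \<ge> 0"
    then have neg: "dirichlet u < log_integral u" by (simp add: I_fun_eq)
    note uH = H10_H1[OF u(1)] and uL = H10_L2[OF u(1)]
    have D: "dirichlet u > 0"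
    proof (rule ccontr)
      assume "\<not> dirichlet u > 0"
      then have D0: "dirichlet u = 0" using dirichlet_nonneg[of u] by simp
      then have "L2_inner U u u = 0" using C(2)[OF u(1)] L2_inner_self_nonneg[of U u] by simp
      then have "AE x in lebesgue_on U. u x = 0" by (intro Lq_norm_2_eq_0_AE uL) (simp add: Lq_norm_2)
      then have "log_integral u = 0" unfolding log_integral_def by (intro integral_eq_zero_AE) auto
      with neg D0 show False by simp
    qed
    \<comment> \<open>At this factor the powers \<open>a powr (1 + p)\<close> and
      \<open>a\<^sup>2\<close> balance the logarithmic integral against the gradient; since ln a
      \<le> 0, the remaining term only raises I.\<close>
    define a where "a = (dirichlet u / log_integral u) powr (1 / (p - 1))"
    have a: "0 < a" "a \<le> 1" using D neg p by (auto simp: a_def intro!: powr_le1)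
    have "a powr (p - 1) = dirichlet u / log_integral u" using D neg p by (simp add: a_def powr_powr)
    moreover have "a powr (1 + p) = a\<^sup>2 * a powr (p - 1)"
      using a by (simp add: powr_add[symmetric] flip: powr_numeral)
    ultimately have "a powr (1 + p) * log_integral u = a\<^sup>2 * dirichlet u" using D neg by simp
    moreover have "a powr (1 + p) * (ln a * power_integral u) \<le> 0"
      using a power_integral_nonneg[of u] by (intro mult_nonneg_nonpos[OF powr_ge_zero] mult_nonpos_nonneg) auto
    ultimately have "I_fun U p (\<lambda>x. a * u x) \<ge> 0"
      by (simp add: I_fun_scale[OF uH u(2) a(1)] distrib_left)
    moreover have "I_fun U p (\<lambda>x. 1 * u x) \<le> 0" using neg by (simp add: I_fun_eq)
    ultimately obtain c where c: "a \<le> c" "c \<le> 1" "I_fun U p (\<lambda>x. c * u x) = 0"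
      using I_fun_scale_IVT[OF uH u(2) a] by blast
    define w where "w = (\<lambda>x. c * u x)"
    have w: "w \<in> H10 U" unfolding w_def by (rule H10_scale[OF u(1)])
    have wi: "log_integrable w" unfolding w_def using c a uL u(2) by (intro log_integrable_scale) auto
    have wD: "dirichlet w = c\<^sup>2 * dirichlet u" unfolding w_def by (rule dirichlet_scale[OF uH])
    have "c\<^sup>2 * dirichlet u \<le> 1 * dirichlet u" using a c D by (intro mult_right_mono power_le_one) auto
    then have w\<epsilon>: "dirichlet w \<le> \<epsilon>" using u(3) wD by simp
    have "d \<le> J_fun U p w"
      unfolding d_def using w c wD D a by (intro well_depth_le) (auto simp: w_def)
    also have "\<dots> = (p - 1) / (2 * (1 + p)) * dirichlet w + power_integral w / q"
      using c(3) by (simp add: J_fun_I_fun w_def q_def)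
    also have "(p - 1) / (2 * (1 + p)) * dirichlet w \<le> 1 * (d / 4)"
      using p w\<epsilon> \<epsilon> dirichlet_nonneg[of w] by (intro mult_mono) (auto simp: field_simps)
    also have "power_integral w \<le> d * q / 2"
    proof -
      have wn: "integrable (lebesgue_on U) (\<lambda>x. \<bar>w x\<bar>\<^sup>2)" using L2_spaceD(2)[OF H10_L2[OF w]] by simp
      note li = log_integral_plus_measure[OF H10_H1[OF w] wi]
      have "power_integral w \<le> (\<integral>x. exp m powr (p - 1) * \<bar>w x\<bar>\<^sup>2 + (\<bar>w x\<bar> powr (1 + p) * ln \<bar>w x\<bar> + 1) / ln (exp m) \<partial>lebesgue_on U)"
        unfolding power_integral_def
        using m log_integrable_power[OF H10_L2[OF w] wi] wn li(1)
        by (intro integral_mono powr_le_truncation[OF p]) auto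
      also have "\<dots> = exp m powr (p - 1) * (\<integral>x. \<bar>w x\<bar>\<^sup>2 \<partial>lebesgue_on U)
          + (\<integral>x. (\<bar>w x\<bar> powr (1 + p) * ln \<bar>w x\<bar> + 1) \<partial>lebesgue_on U) / ln (exp m)"
        using wn li(1) by (subst Bochner_Integration.integral_add) auto
      also have "\<dots> = exp m powr (p - 1) * L2_inner U w w + (log_integral w + \<mu>) / m"
        unfolding li(2) by (simp add: L2_inner_def power2_eq_square \<mu>_def)
      also have "log_integral w = dirichlet w" using c(3) by (simp add: I_fun_eq w_def)
      also have "exp m powr (p - 1) * L2_inner U w w \<le> exp m powr (p - 1) * (C * dirichlet w)"
        using C(2)[OF w] by (intro mult_left_mono) auto
      also have "\<dots> = B * dirichlet w" by (simp add: B_def)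
      also have "B * dirichlet w \<le> B * (d * q / (4 * B))" using B w\<epsilon> \<epsilon>(3) by (intro mult_left_mono) auto
      also have "\<dots> = d * q / 4" using B by simp
      also have "(dirichlet w + \<mu>) / m \<le> (1 + \<mu>) / m" using w\<epsilon> \<epsilon>(1) m by (intro divide_right_mono) auto
      also have "\<dots> = d * q / 4" using \<mu> d q by (simp add: m_def field_simps add_nonneg_eq_0_iff)
      finally show ?thesis by simp
    qed
    then have "power_integral w / q \<le> d / 2" using q by (simp add: pos_divide_le_eq mult.commute)
    finally show False using d by simp
  qed
  with \<epsilon>0 show ?thesis by (rule that)
qed

lemma test_log_integrable:
  assumes "\<phi> \<in> test_functions U"
  shows "log_integrable \<phi>"
proof -
  obtain K where K: "compact K" "K \<subseteq> U" "\<And>x. x \<notin> K \<Longrightarrow> \<phi> x = 0" using assms by (rule test_functionsE) blast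
  have c: "continuous_on UNIV (log_nonlin p)"
    using DERIV_isCont[OF log_nonlin_DERIV[OF p]] by (simp add: continuous_on_eq_continuous_at)
  have "continuous_on UNIV (\<lambda>x. log_nonlin p (\<phi> x) * \<phi> x)"
    by (intro continuous_on_mult continuous_on_compose2[OF c] test_continuous[OF assms]) auto
  then have "integrable lborel (\<lambda>x. log_nonlin p (\<phi> x) * \<phi> x)" and "(\<lambda>x. log_nonlin p (\<phi> x) * \<phi> x) \<in> borel_measurable borel"
    using K by (auto intro: integrable_compact_support borel_measurable_continuous_onI)
  then have "integrable (lebesgue_on U) (\<lambda>x. log_nonlin p (\<phi> x) * \<phi> x)"
    using integral_lebesgue_on_vanish(2)[OF U_sets, of "\<lambda>x. log_nonlin p (\<phi> x) * \<phi> x"] assms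
    by (simp add: test_outside)
  then show ?thesis by (simp add: log_integrable_def log_nonlin_mult_self[OF p])
qed

text \<open>After scaling u down, the approximating test functions eventually lie in the ball where
  I \<ge> 0, which bounds their logarithmic integrals by \<epsilon>. Fatou's lemma along an almost
  everywhere convergent subsequence passes this to the limit, and the scaling is undone.\<close>

lemma H10_log_integrable:
  assumes u: "u \<in> H10 U"
  shows "log_integrable u"
proof -
  let ?M = "lebesgue_on U"
  obtain \<epsilon> where \<epsilon>: "\<epsilon> > 0"
    "\<And>u. u \<in> H10 U \<Longrightarrow> log_integrable u \<Longrightarrow> dirichlet u \<le> \<epsilon> \<Longrightarrow> I_fun U p u \<ge> 0"
    using I_fun_nonneg_small by metis
  define g where "g = Lq_norm 2 U (grad U u)"
  have g: "g \<ge> 0" by (simp add: g_def Lq_norm_nonneg)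
  \<comment> \<open>Half of sqrt \<epsilon> is left for the approximation error; g + 1 avoids
    dividing by zero.\<close>
  define c where "c = sqrt \<epsilon> / 2 / (g + 1)"
  have c: "c > 0" using \<epsilon> g by (simp add: c_def)
  define w where "w = (\<lambda>x. c * u x)"
  have w: "w \<in> H10 U" unfolding w_def by (rule H10_scale[OF u])
  note wH = H10_H1[OF w]
  note [measurable] = L2_spaceD(1)[OF H10_L2[OF w]] L2_spaceD(1)[OF H10_L2[OF u]]
  have wg: "Lq_norm 2 U (grad U w) \<le> sqrt \<epsilon> / 2"
  proof (rule power2_le_imp_le)
    have "c * g \<le> sqrt \<epsilon> / 2" using \<epsilon> g by (simp add: c_def field_simps)
    then have "(c * g)\<^sup>2 \<le> (sqrt \<epsilon> / 2)\<^sup>2" using c g by (intro power_mono) auto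
    then show "(Lq_norm 2 U (grad U w))\<^sup>2 \<le> (sqrt \<epsilon> / 2)\<^sup>2"
      by (simp add: dirichlet_eq w_def dirichlet_scale[OF H10_H1[OF u]] power_mult_distrib g_def)
  qed (use \<epsilon> in simp)
  obtain \<psi> where \<psi>: "\<And>k. \<psi> k \<in> test_functions U" and \<psi>l: "(\<lambda>k. H1_norm U (\<lambda>x. \<psi> k x - w x)) \<longlonglongrightarrow> 0"
    using H10_approx_seq[OF w] by metis
  have \<psi>L: "(\<lambda>k. Lq_norm 2 U (\<lambda>x. \<psi> k x - w x)) \<longlonglongrightarrow> 0"
    by (rule tendsto_sandwich[OF _ _ tendsto_const \<psi>l])
       (auto intro!: always_eventually L2_norm_le_H1_norm simp: Lq_norm_nonneg)
  obtain r where r: "strict_mono (r :: nat \<Rightarrow> nat)" and rl: "AE x in ?M. (\<lambda>k. \<psi> (r k) x) \<longlonglongrightarrow> w x"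
    by (rule L2_tendsto_AE_subseq[OF test_L2[OF U_sets \<psi>] H10_L2[OF w] \<psi>L])
  define \<phi> where "\<phi> k = \<psi> (r k)" for k
  have \<phi>: "\<phi> k \<in> test_functions U" for k by (simp add: \<phi>_def \<psi>)
  have \<phi>l: "(\<lambda>k. H1_norm U (\<lambda>x. \<phi> k x - w x)) \<longlonglongrightarrow> 0"
    using LIMSEQ_subseq_LIMSEQ[OF \<psi>l r] by (simp add: \<phi>_def o_def)
  have AE\<phi>: "AE x in ?M. (\<lambda>k. \<phi> k x) \<longlonglongrightarrow> w x" unfolding \<phi>_def by (rule rl)
  have [measurable]: "\<phi> k \<in> borel_measurable ?M" for k by (rule test_measurable_on[OF \<phi>])
  define G where "G s = \<bar>s\<bar> powr (1 + p) * ln \<bar>s\<bar> + 1" for s :: real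
  have G0: "G s \<ge> 0" for s using powr_mult_ln_ge[of "\<bar>s\<bar>" "1 + p"] p by (simp add: G_def)
  have Gc: "isCont G s" for s
  proof -
    have "isCont (\<lambda>s. log_nonlin p s * s + 1) s"
      by (intro isCont_add isCont_mult DERIV_isCont[OF log_nonlin_DERIV[OF p]]) auto
    then show ?thesis by (simp add: log_nonlin_mult_self[OF p] G_def[abs_def])
  qed
  have ev: "\<forall>\<^sub>F k in sequentially. (\<integral>\<^sup>+x. ennreal (G (\<phi> k x)) \<partial>?M) \<le> ennreal (\<epsilon> + measure lebesgue U)"
  proof -
    have "\<forall>\<^sub>F k in sequentially. H1_norm U (\<lambda>x. \<phi> k x - w x) < sqrt \<epsilon> / 2"
      using \<epsilon> by (intro order_tendstoD(2)[OF \<phi>l]) auto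
    then show ?thesis
    proof eventually_elim
      case (elim k)
      have "Lq_norm 2 U (grad U (\<phi> k)) \<le> sqrt \<epsilon>"
        using grad_norm_triangle_diff[OF test_H1[OF \<phi>[of k]] wH] wg elim by simp
      then have D: "dirichlet (\<phi> k) \<le> \<epsilon>"
        using power_mono[of "Lq_norm 2 U (grad U (\<phi> k))" "sqrt \<epsilon>" 2] \<epsilon> by (simp add: Lq_norm_nonneg dirichlet_eq)
      then have "log_integral (\<phi> k) \<le> \<epsilon>"
        using \<epsilon>(2)[OF test_H10[OF \<phi>] test_log_integrable[OF \<phi>] D] by (simp add: I_fun_eq)
      moreover have "(\<integral>\<^sup>+x. ennreal (G (\<phi> k x)) \<partial>?M) = ennreal (log_integral (\<phi> k) + measure lebesgue U)"
        using log_integral_plus_measure[OF test_H1[OF \<phi>[of k]] test_log_integrable[OF \<phi>]] G0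
        by (subst nn_integral_eq_integral) (auto simp: G_def)
      ultimately show ?case by (simp add: ennreal_leI)
    qed
  qed
  have "(\<integral>\<^sup>+x. ennreal (G (w x)) \<partial>?M) = (\<integral>\<^sup>+x. liminf (\<lambda>k. ennreal (G (\<phi> k x))) \<partial>?M)"
  proof (rule nn_integral_cong_AE)
    show "AE x in ?M. ennreal (G (w x)) = liminf (\<lambda>k. ennreal (G (\<phi> k x)))"
      using AE\<phi>
    proof eventually_elim
      case (elim x)
      then have "(\<lambda>k. ennreal (G (\<phi> k x))) \<longlonglongrightarrow> ennreal (G (w x))"
        by (intro tendsto_ennrealI isCont_tendsto_compose[OF Gc])
      from lim_imp_Liminf[OF sequentially_bot this] show ?case by simp
    qed
  qed
  also have "\<dots> \<le> liminf (\<lambda>k. \<integral>\<^sup>+x. ennreal (G (\<phi> k x)) \<partial>?M)"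
    unfolding G_def by (rule nn_integral_liminf) measurable
  also have "\<dots> \<le> ennreal (\<epsilon> + measure lebesgue U)"
    by (rule Liminf_le[OF _ ev]) simp
  finally have "(\<integral>\<^sup>+x. ennreal (G (w x)) \<partial>?M) < \<infinity>" by (rule le_less_trans) simp
  then have "integrable ?M (\<lambda>x. G (w x))"
    using G0 by (intro integrableI_nonneg) (auto simp: G_def)
  then have "integrable ?M (\<lambda>x. G (w x) - 1)"
    by (intro Bochner_Integration.integrable_diff finite_measure.integrable_const finite_measure_lebesgue_on U_lmeasurable)
  then have "log_integrable w" by (simp add: log_integrable_def G_def)
  then have "log_integrable (\<lambda>x. inverse c * w x)"
    using c by (intro log_integrable_scale H10_L2[OF w]) auto
  then show ?thesis using c by (simp add: w_def mult.assoc[symmetric])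
qed

text \<open>A factor depending only on R and \<epsilon> moves the whole ball into the region where I
  \<ge> 0, so the logarithmic integrals of the scaled functions are at most \<epsilon>;
  \<open>log_weight_le_scaled\<close> undoes the scaling. This is the uniform bound that an
  embedding would supply.\<close>

lemma log_weight_integral_bound:
  obtains K where "K \<ge> 0" "\<And>u. u \<in> H10 U \<Longrightarrow> dirichlet u \<le> R \<Longrightarrow>
    integrable (lebesgue_on U) (\<lambda>x. log_weight (p + 1) \<bar>u x\<bar>) \<and>
    (\<integral>x. log_weight (p + 1) \<bar>u x\<bar> \<partial>lebesgue_on U) \<le> K"
proof -
  let ?M = "lebesgue_on U"
  obtain \<epsilon> where \<epsilon>: "\<epsilon> > 0"
    "\<And>u. u \<in> H10 U \<Longrightarrow> log_integrable u \<Longrightarrow> dirichlet u \<le> \<epsilon> \<Longrightarrow> I_fun U p u \<ge> 0"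
    using I_fun_nonneg_small by metis
  define c where "c = min 1 (sqrt (\<epsilon> / (\<bar>R\<bar> + 1)))"
  have R1: "\<bar>R\<bar> + 1 > 0" by linarith
  then have c: "0 < c" "c \<le> 1" using \<epsilon> by (auto simp: c_def)
  have "c\<^sup>2 \<le> (sqrt (\<epsilon> / (\<bar>R\<bar> + 1)))\<^sup>2" using c by (intro power_mono) (auto simp: c_def)
  then have c2: "c\<^sup>2 \<le> \<epsilon> / (\<bar>R\<bar> + 1)" using \<epsilon> R1 by (simp add: real_sqrt_pow2)
  obtain K where K: "K \<ge> 0" "\<And>s. s \<ge> 0 \<Longrightarrow>
    log_weight (p + 1) s \<le> K * (1 + ((c * s) powr (1 + p) * ln (c * s) + 1))"
    using log_weight_le_scaled[OF p c] by metis
  define \<mu> where "\<mu> = measure lebesgue U"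
  have m: "measure ?M U = \<mu>" using U_sets by (simp add: measure_restrict_space \<mu>_def)
  have 1: "integrable ?M (\<lambda>x. 1::real)"
    by (intro finite_measure.integrable_const finite_measure_lebesgue_on U_lmeasurable)
  have "integrable ?M (\<lambda>x. log_weight (p + 1) \<bar>u x\<bar>) \<and> (\<integral>x. log_weight (p + 1) \<bar>u x\<bar> \<partial>?M) \<le> K * (\<mu> + (\<epsilon> + \<mu>))"
    if u: "u \<in> H10 U" "dirichlet u \<le> R" for u
  proof -
    define w where "w = (\<lambda>x. c * u x)"
    have w: "w \<in> H10 U" unfolding w_def by (rule H10_scale[OF u(1)])
    note wi = H10_log_integrable[OF w]
    note li = log_integral_plus_measure[OF H10_H1[OF w] wi]
    note [measurable] = L2_spaceD(1)[OF H10_L2[OF u(1)]]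
    have "dirichlet w = c\<^sup>2 * dirichlet u" unfolding w_def by (rule dirichlet_scale[OF H10_H1[OF u(1)]])
    also have "\<dots> \<le> \<epsilon> / (\<bar>R\<bar> + 1) * (\<bar>R\<bar> + 1)"
      using c2 u(2) \<epsilon> R1 dirichlet_nonneg[of u] by (intro mult_mono) auto
    also have "\<dots> = \<epsilon>" using R1 by simp
    finally have D: "dirichlet w \<le> \<epsilon>" .
    then have L: "log_integral w \<le> \<epsilon>" using \<epsilon>(2)[OF w wi D] by (simp add: I_fun_eq)
    let ?b = "\<lambda>x. K * (1 + (\<bar>w x\<bar> powr (1 + p) * ln \<bar>w x\<bar> + 1))"
    have b: "integrable ?M ?b"
      using Bochner_Integration.integrable_add[OF 1 li(1)] by (rule integrable_mult_right)
    have le: "log_weight (p + 1) \<bar>u x\<bar> \<le> ?b x" for x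
      using K(2)[of "\<bar>u x\<bar>"] c by (simp add: w_def abs_mult)
    have i: "integrable ?M (\<lambda>x. log_weight (p + 1) \<bar>u x\<bar>)"
    proof (rule Bochner_Integration.integrable_bound[OF b])
      show "(\<lambda>x. log_weight (p + 1) \<bar>u x\<bar>) \<in> borel_measurable ?M" unfolding log_weight_def by measurable
      show "AE x in ?M. norm (log_weight (p + 1) \<bar>u x\<bar>) \<le> norm (?b x)"
      proof (rule AE_I2)
        fix x
        show "norm (log_weight (p + 1) \<bar>u x\<bar>) \<le> norm (?b x)"
          using le[of x] log_weight_nonneg[of "\<bar>u x\<bar>" "p + 1"] unfolding real_norm_def by linarith
      qed
    qed
    have "(\<integral>x. log_weight (p + 1) \<bar>u x\<bar> \<partial>?M) \<le> (\<integral>x. ?b x \<partial>?M)"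
      using i b le by (rule integral_mono)
    also have "\<dots> = K * ((\<integral>x. 1 \<partial>?M) + (\<integral>x. (\<bar>w x\<bar> powr (1 + p) * ln \<bar>w x\<bar> + 1) \<partial>?M))"
      using Bochner_Integration.integral_add[OF 1 li(1)] by simp
    also have "\<dots> = K * (\<mu> + (log_integral w + \<mu>))"
      unfolding li(2) using m by (simp add: \<mu>_def space_restrict_space)
    also have "\<dots> \<le> K * (\<mu> + (\<epsilon> + \<mu>))" using K(1) L by (intro mult_left_mono) auto
    finally show ?thesis using i by simp
  qed
  moreover have "K * (\<mu> + (\<epsilon> + \<mu>)) \<ge> 0" using K(1) \<epsilon>(1) by (simp add: \<mu>_def)
  ultimately show ?thesis by (intro that[of "K * (\<mu> + (\<epsilon> + \<mu>))"]) auto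
qed

lemma weighted_product_unit_bound:
  obtains K where "K \<ge> 0" "\<And>u w h k. u \<in> H10 U \<Longrightarrow> w \<in> H10 U \<Longrightarrow> h \<in> H10 U \<Longrightarrow> k \<in> H10 U \<Longrightarrow>
    H1_norm U u \<le> R \<Longrightarrow> H1_norm U w \<le> R \<Longrightarrow> H1_norm U h \<le> 1 \<Longrightarrow> H1_norm U k \<le> 1 \<Longrightarrow>
    integrable (lebesgue_on U) (\<lambda>x. log_weight (p - 1) (\<bar>u x\<bar> + \<bar>w x\<bar>) * \<bar>h x\<bar> * \<bar>k x\<bar>) \<and>
    (\<integral>x. log_weight (p - 1) (\<bar>u x\<bar> + \<bar>w x\<bar>) * \<bar>h x\<bar> * \<bar>k x\<bar> \<partial>lebesgue_on U) \<le> K"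
proof -
  let ?M = "lebesgue_on U"
  \<comment> \<open>One radius for all four functions: h and k lie in the unit ball. The factor 4
    below matches the arguments of the weights in \<open>log_weight_mult_le\<close>.\<close>
  define R' where "R' = max 1 (\<bar>R\<bar>)"
  obtain K where K: "K \<ge> 0" "\<And>u. u \<in> H10 U \<Longrightarrow> dirichlet u \<le> (4 * R')\<^sup>2 \<Longrightarrow>
    integrable ?M (\<lambda>x. log_weight (p + 1) \<bar>u x\<bar>) \<and> (\<integral>x. log_weight (p + 1) \<bar>u x\<bar> \<partial>?M) \<le> K"
    using log_weight_integral_bound by metis
  have *: "integrable ?M (\<lambda>x. log_weight (p + 1) (4 * \<bar>u x\<bar>)) \<and> (\<integral>x. log_weight (p + 1) (4 * \<bar>u x\<bar>) \<partial>?M) \<le> K"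
    if u: "u \<in> H10 U" "H1_norm U u \<le> R'" for u
  proof -
    have "dirichlet (\<lambda>x. 4 * u x) \<le> (H1_norm U (\<lambda>x. 4 * u x))\<^sup>2" by (rule dirichlet_le_H1_norm)
    also have "\<dots> \<le> (4 * R')\<^sup>2"
      using u by (intro power_mono) (auto simp: H1_norm_scale H10_H1 H1_norm_nonneg)
    finally show ?thesis using K(2)[OF H10_scale[OF u(1), of 4]] by (simp add: abs_mult)
  qed
  show ?thesis
  proof (rule that[of "4 * K"])
    fix u w h k
    assume H: "u \<in> H10 U" "w \<in> H10 U" "h \<in> H10 U" "k \<in> H10 U"
      and n: "H1_norm U u \<le> R" "H1_norm U w \<le> R" "H1_norm U h \<le> 1" "H1_norm U k \<le> 1"
    note [measurable] = L2_spaceD(1)[OF H10_L2[OF H(1)]] L2_spaceD(1)[OF H10_L2[OF H(2)]]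
      L2_spaceD(1)[OF H10_L2[OF H(3)]] L2_spaceD(1)[OF H10_L2[OF H(4)]]
    have n': "H1_norm U u \<le> R'" "H1_norm U w \<le> R'" "H1_norm U h \<le> R'" "H1_norm U k \<le> R'"
      using n by (auto simp: R'_def)
    note b = *[OF H(1) n'(1)] *[OF H(2) n'(2)] *[OF H(3) n'(3)] *[OF H(4) n'(4)]
    let ?f = "\<lambda>x. log_weight (p - 1) (\<bar>u x\<bar> + \<bar>w x\<bar>) * \<bar>h x\<bar> * \<bar>k x\<bar>"
    let ?g = "\<lambda>x. log_weight (p + 1) (4 * \<bar>u x\<bar>) + log_weight (p + 1) (4 * \<bar>w x\<bar>)
      + log_weight (p + 1) (4 * \<bar>h x\<bar>) + log_weight (p + 1) (4 * \<bar>k x\<bar>)"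
    have fg: "?f x \<le> ?g x" for x by (intro log_weight_mult_le[OF p]) auto
    have g: "integrable ?M ?g" using b by simp
    have f: "integrable ?M ?f"
    proof (rule Bochner_Integration.integrable_bound[OF g])
      show "?f \<in> borel_measurable ?M" unfolding log_weight_def by measurable
      show "AE x in ?M. norm (?f x) \<le> norm (?g x)"
      proof (rule AE_I2)
        fix x
        have "0 \<le> ?f x" by (simp add: log_weight_nonneg)
        with fg[of x] show "norm (?f x) \<le> norm (?g x)" unfolding real_norm_def by linarith
      qed
    qed
    have "(\<integral>x. ?f x \<partial>?M) \<le> (\<integral>x. ?g x \<partial>?M)" using f g fg by (rule integral_mono)
    also have "\<dots> \<le> 4 * K" using b by simp
    finally show "integrable ?M ?f \<and> (\<integral>x. ?f x \<partial>?M) \<le> 4 * K" using f by simp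
  qed (use K in simp)
qed

lemma H1_norm_0_AE:
  assumes "h \<in> H1 U" "H1_norm U h = 0"
  shows "AE x in lebesgue_on U. h x = 0"
  using assms L2_norm_le_H1_norm[of h] Lq_norm_nonneg[of 2 U h]
  by (intro Lq_norm_2_eq_0_AE H1_L2) auto

text \<open>The integral is homogeneous in h and in k, so the unit ball suffices; a function of norm
  0 vanishes almost everywhere and cannot be normalised.\<close>

lemma weighted_product_bound:
  obtains K where "K \<ge> 0" "\<And>u w h k. u \<in> H10 U \<Longrightarrow> w \<in> H10 U \<Longrightarrow> h \<in> H10 U \<Longrightarrow> k \<in> H10 U \<Longrightarrow>
    H1_norm U u \<le> R \<Longrightarrow> H1_norm U w \<le> R \<Longrightarrow>
    integrable (lebesgue_on U) (\<lambda>x. log_weight (p - 1) (\<bar>u x\<bar> + \<bar>w x\<bar>) * \<bar>h x\<bar> * \<bar>k x\<bar>) \<and>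
    (\<integral>x. log_weight (p - 1) (\<bar>u x\<bar> + \<bar>w x\<bar>) * \<bar>h x\<bar> * \<bar>k x\<bar> \<partial>lebesgue_on U) \<le> K * H1_norm U h * H1_norm U k"
proof -
  let ?M = "lebesgue_on U"
  obtain K where K: "K \<ge> 0" "\<And>u w h k. u \<in> H10 U \<Longrightarrow> w \<in> H10 U \<Longrightarrow> h \<in> H10 U \<Longrightarrow> k \<in> H10 U \<Longrightarrow>
    H1_norm U u \<le> R \<Longrightarrow> H1_norm U w \<le> R \<Longrightarrow> H1_norm U h \<le> 1 \<Longrightarrow> H1_norm U k \<le> 1 \<Longrightarrow>
    integrable ?M (\<lambda>x. log_weight (p - 1) (\<bar>u x\<bar> + \<bar>w x\<bar>) * \<bar>h x\<bar> * \<bar>k x\<bar>) \<and>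
    (\<integral>x. log_weight (p - 1) (\<bar>u x\<bar> + \<bar>w x\<bar>) * \<bar>h x\<bar> * \<bar>k x\<bar> \<partial>?M) \<le> K"
    using weighted_product_unit_bound[of R] by blast
  show ?thesis
  proof (rule that[OF K(1)])
    fix u w h k
    assume H: "u \<in> H10 U" "w \<in> H10 U" "h \<in> H10 U" "k \<in> H10 U" and n: "H1_norm U u \<le> R" "H1_norm U w \<le> R"
    let ?f = "\<lambda>h k x. log_weight (p - 1) (\<bar>u x\<bar> + \<bar>w x\<bar>) * \<bar>h x\<bar> * \<bar>k x\<bar>"
    note [measurable] = L2_spaceD(1)[OF H10_L2[OF H(1)]] L2_spaceD(1)[OF H10_L2[OF H(2)]]
      L2_spaceD(1)[OF H10_L2[OF H(3)]] L2_spaceD(1)[OF H10_L2[OF H(4)]]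
    have fm: "?f h k \<in> borel_measurable ?M" unfolding log_weight_def by measurable
    define a b where "a = H1_norm U h" and "b = H1_norm U k"
    show "integrable ?M (?f h k) \<and> (\<integral>x. ?f h k x \<partial>?M) \<le> K * H1_norm U h * H1_norm U k"
    proof (cases "a = 0 \<or> b = 0")
      case True
      then have "AE x in ?M. h x = 0 \<or> k x = 0"
      proof
        assume "a = 0"
        with H1_norm_0_AE[OF H10_H1[OF H(3)]] show ?thesis by (auto simp: a_def)
      next
        assume "b = 0"
        with H1_norm_0_AE[OF H10_H1[OF H(4)]] show ?thesis by (auto simp: b_def)
      qed
      then have z: "AE x in ?M. ?f h k x = 0" by eventually_elim auto
      have "integrable ?M (?f h k) \<longleftrightarrow> integrable ?M (\<lambda>x. 0::real)"
        using fm z by (intro integrable_cong_AE) auto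
      then have "integrable ?M (?f h k)" by simp
      moreover have "(\<integral>x. ?f h k x \<partial>?M) = 0" using z by (rule integral_eq_zero_AE)
      ultimately show ?thesis using K(1) by (simp add: H1_norm_nonneg)
    next
      case False
      then have ab: "a > 0" "b > 0" using H1_norm_nonneg[of h] H1_norm_nonneg[of k] by (auto simp: a_def b_def)
      define h' k' where "h' = (\<lambda>x. inverse a * h x)" and "k' = (\<lambda>x. inverse b * k x)"
      have H': "h' \<in> H10 U" "k' \<in> H10 U" unfolding h'_def k'_def by (intro H10_scale H)+
      have n': "H1_norm U h' \<le> 1" "H1_norm U k' \<le> 1"
        using ab H by (simp_all add: h'_def k'_def H1_norm_scale H10_H1 flip: a_def b_def)
      note b' = K(2)[OF H(1,2) H' n n']
      have e: "?f h k x = a * b * ?f h' k' x" for x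
        using ab by (simp add: h'_def k'_def abs_mult field_simps)
      have "integrable ?M (?f h k)" unfolding e using b' by simp
      moreover have "(\<integral>x. ?f h k x \<partial>?M) = a * b * (\<integral>x. ?f h' k' x \<partial>?M)"
        unfolding e by simp
      moreover have "a * b * (\<integral>x. ?f h' k' x \<partial>?M) \<le> a * b * K"
        using b' ab by (intro mult_left_mono) auto
      ultimately show ?thesis by (simp add: a_def b_def mult_ac)
    qed
  qed
qed

text \<open>F(u)(h) in the notation of the overview: the equation reads
  \<open>H1_inner (v' t) h = force (v t) h\<close>.\<close>

definition force :: "('a \<Rightarrow> real) \<Rightarrow> ('a \<Rightarrow> real) \<Rightarrow> real" where
  "force u h = L2_inner U (\<lambda>x. log_nonlin p (u x)) h - L2_inner U (grad U u) (grad U h)"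

lemma log_nonlin_measurable [measurable]: "log_nonlin p \<in> borel_measurable borel"
  unfolding log_nonlin_def[abs_def] by measurable

text \<open>The pointwise bounds are applied with radius
  \<open>\<bar>u x\<bar> + \<bar>w x\<bar>\<close>; then one or both of the two free factors in
  \<open>weighted_product_bound\<close> are u - w.\<close>

lemma nonlin_product_bounds:
  obtains K where "K \<ge> 0"
    "\<And>u w h. u \<in> H10 U \<Longrightarrow> w \<in> H10 U \<Longrightarrow> h \<in> H10 U \<Longrightarrow> H1_norm U u \<le> R \<Longrightarrow> H1_norm U w \<le> R \<Longrightarrow>
      integrable (lebesgue_on U) (\<lambda>x. (log_nonlin p (u x) - log_nonlin p (w x)) * h x) \<and>
      \<bar>\<integral>x. (log_nonlin p (u x) - log_nonlin p (w x)) * h x \<partial>lebesgue_on U\<bar>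
        \<le> K * H1_norm U (\<lambda>x. u x - w x) * H1_norm U h"
    "\<And>u w. u \<in> H10 U \<Longrightarrow> w \<in> H10 U \<Longrightarrow> H1_norm U u \<le> R \<Longrightarrow> H1_norm U w \<le> R \<Longrightarrow>
      \<bar>\<integral>x. log_primitive p (u x) - log_primitive p (w x) - log_nonlin p (w x) * (u x - w x) \<partial>lebesgue_on U\<bar>
        \<le> K * (H1_norm U (\<lambda>x. u x - w x))\<^sup>2"
proof -
  let ?M = "lebesgue_on U"
  obtain K where K: "K \<ge> 0" "\<And>u w h k. u \<in> H10 U \<Longrightarrow> w \<in> H10 U \<Longrightarrow> h \<in> H10 U \<Longrightarrow> k \<in> H10 U \<Longrightarrow>
    H1_norm U u \<le> R \<Longrightarrow> H1_norm U w \<le> R \<Longrightarrow>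
    integrable ?M (\<lambda>x. log_weight (p - 1) (\<bar>u x\<bar> + \<bar>w x\<bar>) * \<bar>h x\<bar> * \<bar>k x\<bar>) \<and>
    (\<integral>x. log_weight (p - 1) (\<bar>u x\<bar> + \<bar>w x\<bar>) * \<bar>h x\<bar> * \<bar>k x\<bar> \<partial>?M) \<le> K * H1_norm U h * H1_norm U k"
    using weighted_product_bound[of R] by blast
  define C where "C = nonlin_const p"
  have C: "C > 0" unfolding C_def by (rule nonlin_const_pos[OF p])
  have bound: "integrable ?M f \<and> \<bar>\<integral>x. f x \<partial>?M\<bar> \<le> C * K * H1_norm U h * H1_norm U k"
    if H: "u \<in> H10 U" "w \<in> H10 U" "h \<in> H10 U" "k \<in> H10 U" "H1_norm U u \<le> R" "H1_norm U w \<le> R"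
      and f: "f \<in> borel_measurable ?M"
      and le: "\<And>x. \<bar>f x\<bar> \<le> C * (log_weight (p - 1) (\<bar>u x\<bar> + \<bar>w x\<bar>) * \<bar>h x\<bar> * \<bar>k x\<bar>)" for u w h k f
  proof -
    let ?g = "\<lambda>x. C * (log_weight (p - 1) (\<bar>u x\<bar> + \<bar>w x\<bar>) * \<bar>h x\<bar> * \<bar>k x\<bar>)"
    note b = K(2)[OF H]
    have g: "integrable ?M ?g" using b by simp
    have i: "integrable ?M f"
    proof (rule Bochner_Integration.integrable_bound[OF g f])
      show "AE x in ?M. norm (f x) \<le> norm (?g x)"
      proof (rule AE_I2)
        show "norm (f x) \<le> norm (?g x)" for x
          using le[of x] unfolding real_norm_def by linarith
      qed
    qed
    have "\<bar>\<integral>x. f x \<partial>?M\<bar> \<le> (\<integral>x. \<bar>f x\<bar> \<partial>?M)" by (rule integral_abs_bound)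
    also have "\<dots> \<le> (\<integral>x. ?g x \<partial>?M)" using i g le by (intro integral_mono) auto
    also have "\<dots> \<le> C * (K * H1_norm U h * H1_norm U k)"
      using b C by simp
    finally show ?thesis using i by (simp add: mult.assoc)
  qed
  show ?thesis
  proof (rule that[of "C * K"])
    show "0 \<le> C * K" using C K by simp
  next
    fix u w h assume H: "u \<in> H10 U" "w \<in> H10 U" "h \<in> H10 U" "H1_norm U u \<le> R" "H1_norm U w \<le> R"
    note [measurable] = L2_spaceD(1)[OF H10_L2[OF H(1)]] L2_spaceD(1)[OF H10_L2[OF H(2)]] L2_spaceD(1)[OF H10_L2[OF H(3)]]
    show "integrable ?M (\<lambda>x. (log_nonlin p (u x) - log_nonlin p (w x)) * h x) \<and>
      \<bar>\<integral>x. (log_nonlin p (u x) - log_nonlin p (w x)) * h x \<partial>?M\<bar>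
        \<le> C * K * H1_norm U (\<lambda>x. u x - w x) * H1_norm U h"
    proof (rule bound[OF H(1,2) H10_diff[OF H(1,2)] H(3-5)])
      show "(\<lambda>x. (log_nonlin p (u x) - log_nonlin p (w x)) * h x) \<in> borel_measurable ?M" by measurable
      fix x
      have "\<bar>log_nonlin p (u x) - log_nonlin p (w x)\<bar> \<le> C * log_weight (p - 1) (\<bar>u x\<bar> + \<bar>w x\<bar>) * \<bar>u x - w x\<bar>"
        unfolding C_def by (rule log_nonlin_Lipschitz[OF p]) auto
      from mult_right_mono[OF this abs_ge_zero[of "h x"]]
      show "\<bar>(log_nonlin p (u x) - log_nonlin p (w x)) * h x\<bar> \<le> C * (log_weight (p - 1) (\<bar>u x\<bar> + \<bar>w x\<bar>) * \<bar>u x - w x\<bar> * \<bar>h x\<bar>)"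
        by (simp add: abs_mult mult.assoc)
    qed
  next
    fix u w assume H: "u \<in> H10 U" "w \<in> H10 U" "H1_norm U u \<le> R" "H1_norm U w \<le> R"
    note [measurable] = L2_spaceD(1)[OF H10_L2[OF H(1)]] L2_spaceD(1)[OF H10_L2[OF H(2)]]
    let ?d = "\<lambda>x. u x - w x"
    have "integrable ?M (\<lambda>x. log_primitive p (u x) - log_primitive p (w x) - log_nonlin p (w x) * (u x - w x)) \<and>
      \<bar>\<integral>x. log_primitive p (u x) - log_primitive p (w x) - log_nonlin p (w x) * (u x - w x) \<partial>?M\<bar>
        \<le> C * K * H1_norm U ?d * H1_norm U ?d"
    proof (rule bound[OF H(1,2) H10_diff[OF H(1,2)] H10_diff[OF H(1,2)] H(3-4)])
      show "(\<lambda>x. log_primitive p (u x) - log_primitive p (w x) - log_nonlin p (w x) * (u x - w x)) \<in> borel_measurable ?M"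
        unfolding log_primitive_def by measurable
      fix x
      have "\<bar>log_primitive p (u x) - log_primitive p (w x) - log_nonlin p (w x) * (u x - w x)\<bar>
         \<le> C * log_weight (p - 1) (\<bar>u x\<bar> + \<bar>w x\<bar>) * (u x - w x)\<^sup>2"
        unfolding C_def by (rule log_primitive_expansion[OF p]) auto
      then show "\<bar>log_primitive p (u x) - log_primitive p (w x) - log_nonlin p (w x) * (u x - w x)\<bar>
         \<le> C * (log_weight (p - 1) (\<bar>u x\<bar> + \<bar>w x\<bar>) * \<bar>u x - w x\<bar> * \<bar>u x - w x\<bar>)"
        by (simp add: mult.assoc power2_eq_square)
    qed
    then show "\<bar>\<integral>x. log_primitive p (u x) - log_primitive p (w x) - log_nonlin p (w x) * (u x - w x) \<partial>?M\<bar>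
        \<le> C * K * (H1_norm U ?d)\<^sup>2"
      by (simp add: power2_eq_square mult.assoc)
  qed
qed

text \<open>Comparison with w = 0, where the nonlinearity vanishes.\<close>

lemma nonlin_pair_integrable:
  assumes "u \<in> H10 U" "h \<in> H10 U"
  shows "integrable (lebesgue_on U) (\<lambda>x. log_nonlin p (u x) * h x)"
proof -
  obtain K where "\<And>u w h. u \<in> H10 U \<Longrightarrow> w \<in> H10 U \<Longrightarrow> h \<in> H10 U \<Longrightarrow> H1_norm U u \<le> H1_norm U u' \<Longrightarrow> H1_norm U w \<le> H1_norm U u' \<Longrightarrow>
      integrable (lebesgue_on U) (\<lambda>x. (log_nonlin p (u x) - log_nonlin p (w x)) * h x)" for u'
    by (metis nonlin_product_bounds)
  from this[OF assms(1) zero_H10 assms(2) order_refl] show ?thesis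
    by (simp add: H1_norm_zero H1_norm_nonneg log_nonlin_def)
qed

lemma force_linear:
  assumes "u \<in> H10 U" "h \<in> H10 U" "k \<in> H10 U"
  shows "force u (\<lambda>x. h x + c * k x) = force u h + c * force u k"
proof -
  have "L2_inner U (\<lambda>x. log_nonlin p (u x)) (\<lambda>x. h x + c * k x)
    = L2_inner U (\<lambda>x. log_nonlin p (u x)) h + c * L2_inner U (\<lambda>x. log_nonlin p (u x)) k"
    using nonlin_pair_integrable[OF assms(1,2)] nonlin_pair_integrable[OF assms(1,3)]
    by (simp add: L2_inner_def distrib_left mult.left_commute[of _ c])
  then show ?thesis
    using dirichlet_inner_linear_left[OF H10_H1[OF assms(2)] H10_H1[OF assms(3)] H10_H1[OF assms(1)], of c]
    by (simp add: force_def L2_inner_commute[of U "grad U u"] algebra_simps)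
qed

lemma force_diff:
  "u \<in> H10 U \<Longrightarrow> h \<in> H10 U \<Longrightarrow> k \<in> H10 U \<Longrightarrow> force u (\<lambda>x. h x - k x) = force u h - force u k"
  using force_linear[of u h k "-1"] by simp

lemma I_fun_force: "I_fun U p u = - force u u"
  by (simp add: I_fun_eq force_def dirichlet_def log_integral_def L2_inner_def log_nonlin_mult_self[OF p])

lemma J_fun_log_primitive:
  assumes "u \<in> H10 U"
  shows "J_fun U p u = 1 / 2 * dirichlet u - (\<integral>x. log_primitive p (u x) \<partial>lebesgue_on U)"
    and "integrable (lebesgue_on U) (\<lambda>x. log_primitive p (u x))"
proof -
  note i = H10_log_integrable[OF assms, unfolded log_integrable_def]
    log_integrable_power[OF H10_L2[OF assms] H10_log_integrable[OF assms]]
  show "integrable (lebesgue_on U) (\<lambda>x. log_primitive p (u x))"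
    using i by (simp add: log_primitive_def)
  show "J_fun U p u = 1 / 2 * dirichlet u - (\<integral>x. log_primitive p (u x) \<partial>lebesgue_on U)"
    using i by (simp add: J_fun_eq log_primitive_def log_integral_def power_integral_def)
qed

lemma grad_inner_diff:
  assumes "u \<in> H1 U" "w \<in> H1 U" "h \<in> H1 U"
  shows "L2_inner U (grad U (\<lambda>x. u x - w x)) (grad U h) = L2_inner U (grad U u) (grad U h) - L2_inner U (grad U w) (grad U h)"
  using dirichlet_inner_linear_left[OF assms, of "-1"] by simp

lemma grad_inner_bound:
  assumes "u \<in> H1 U" "w \<in> H1 U"
  shows "\<bar>L2_inner U (grad U u) (grad U w)\<bar> \<le> H1_norm U u * H1_norm U w"
  using L2_Cauchy_Schwarz[OF grad_L2[OF assms(1)] grad_L2[OF assms(2)]]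
    mult_mono[OF grad_norm_le_H1_norm[of u] grad_norm_le_H1_norm[of w] H1_norm_nonneg Lq_norm_nonneg]
  by linarith

text \<open>The second bound is the Taylor expansion of J at w, whose derivative there is
  \<open>- force w\<close>. The summand 1 in the constant pays for the gradient terms: the pairing
  in the first bound, and half of \<open>dirichlet\<close> of u - w in the second.\<close>

lemma force_bounds:
  obtains L where "L \<ge> 0"
    "\<And>u w h. u \<in> H10 U \<Longrightarrow> w \<in> H10 U \<Longrightarrow> h \<in> H10 U \<Longrightarrow> H1_norm U u \<le> R \<Longrightarrow> H1_norm U w \<le> R \<Longrightarrow>
      \<bar>force u h - force w h\<bar> \<le> L * H1_norm U (\<lambda>x. u x - w x) * H1_norm U h"
    "\<And>u w. u \<in> H10 U \<Longrightarrow> w \<in> H10 U \<Longrightarrow> H1_norm U u \<le> R \<Longrightarrow> H1_norm U w \<le> R \<Longrightarrow>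
      \<bar>J_fun U p u - J_fun U p w + force w (\<lambda>x. u x - w x)\<bar> \<le> L * (H1_norm U (\<lambda>x. u x - w x))\<^sup>2"
proof -
  let ?M = "lebesgue_on U"
  obtain K where K: "K \<ge> 0"
    "\<And>u w h. u \<in> H10 U \<Longrightarrow> w \<in> H10 U \<Longrightarrow> h \<in> H10 U \<Longrightarrow> H1_norm U u \<le> R \<Longrightarrow> H1_norm U w \<le> R \<Longrightarrow>
      integrable (lebesgue_on U) (\<lambda>x. (log_nonlin p (u x) - log_nonlin p (w x)) * h x) \<and>
      \<bar>\<integral>x. (log_nonlin p (u x) - log_nonlin p (w x)) * h x \<partial>lebesgue_on U\<bar>
        \<le> K * H1_norm U (\<lambda>x. u x - w x) * H1_norm U h"
    "\<And>u w. u \<in> H10 U \<Longrightarrow> w \<in> H10 U \<Longrightarrow> H1_norm U u \<le> R \<Longrightarrow> H1_norm U w \<le> R \<Longrightarrow>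
      \<bar>\<integral>x. log_primitive p (u x) - log_primitive p (w x) - log_nonlin p (w x) * (u x - w x) \<partial>lebesgue_on U\<bar>
        \<le> K * (H1_norm U (\<lambda>x. u x - w x))\<^sup>2"
    using nonlin_product_bounds[of R] by blast
  show ?thesis
  proof (rule that[of "K + 1"])
    show "K + 1 \<ge> 0" using K(1) by simp
  next
    fix u w h assume H: "u \<in> H10 U" "w \<in> H10 U" "h \<in> H10 U" "H1_norm U u \<le> R" "H1_norm U w \<le> R"
    have "force u h - force w h = (\<integral>x. (log_nonlin p (u x) - log_nonlin p (w x)) * h x \<partial>?M)
        - L2_inner U (grad U (\<lambda>x. u x - w x)) (grad U h)"
      using nonlin_pair_integrable[OF H(1,3)] nonlin_pair_integrable[OF H(2,3)]
      by (simp add: force_def grad_inner_diff H H10_H1 L2_inner_def[of U "\<lambda>x. log_nonlin p (_ x)"] left_diff_distrib)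
    moreover note conjunct2[OF K(2)[OF H]] grad_inner_bound[OF H1_diff[OF H10_H1[OF H(1)] H10_H1[OF H(2)]] H10_H1[OF H(3)]]
    ultimately show "\<bar>force u h - force w h\<bar> \<le> (K + 1) * H1_norm U (\<lambda>x. u x - w x) * H1_norm U h"
      by (simp add: distrib_right)
  next
    fix u w assume H: "u \<in> H10 U" "w \<in> H10 U" "H1_norm U u \<le> R" "H1_norm U w \<le> R"
    note H1 = H10_H1[OF H(1)] H10_H1[OF H(2)]
    let ?d = "\<lambda>x. u x - w x"
    have d: "?d \<in> H10 U" using H by (intro H10_diff)
    have "dirichlet ?d = L2_inner U (grad U u) (grad U ?d) - L2_inner U (grad U w) (grad U ?d)"
      unfolding dirichlet_def by (rule grad_inner_diff[OF H1 H10_H1[OF d]])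
    moreover have "L2_inner U (grad U u) (grad U ?d) = dirichlet u - L2_inner U (grad U w) (grad U u)"
      using grad_inner_diff[OF H1 H1(1)] by (simp add: dirichlet_def L2_inner_commute[of U "grad U u" "grad U ?d"])
    moreover have "L2_inner U (grad U w) (grad U ?d) = L2_inner U (grad U w) (grad U u) - dirichlet w"
      using grad_inner_diff[OF H1 H1(2)]
      by (simp add: dirichlet_def L2_inner_commute[of U "grad U w" "grad U ?d"] L2_inner_commute[of U "grad U u" "grad U w"])
    moreover have "(\<integral>x. log_primitive p (u x) - log_primitive p (w x) - log_nonlin p (w x) * ?d x \<partial>?M)
        = (\<integral>x. log_primitive p (u x) \<partial>?M) - (\<integral>x. log_primitive p (w x) \<partial>?M) - L2_inner U (\<lambda>x. log_nonlin p (w x)) ?d"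
      using J_fun_log_primitive(2)[OF H(1)] J_fun_log_primitive(2)[OF H(2)] nonlin_pair_integrable[OF H(2) d]
      by (simp add: L2_inner_def)
    ultimately have "J_fun U p u - J_fun U p w + force w ?d
        = 1 / 2 * dirichlet ?d - (\<integral>x. log_primitive p (u x) - log_primitive p (w x) - log_nonlin p (w x) * ?d x \<partial>?M)"
      by (simp add: J_fun_log_primitive(1) H force_def)
    with K(3)[OF H] dirichlet_le_H1_norm[of ?d] dirichlet_nonneg[of ?d]
    show "\<bar>J_fun U p u - J_fun U p w + force w ?d\<bar> \<le> (K + 1) * (H1_norm U ?d)\<^sup>2"
      by (simp add: distrib_right abs_le_iff)
  qed
qed

lemma force_zero: "h \<in> H1 U \<Longrightarrow> force (\<lambda>x. 0) h = 0"
proof -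
  assume h: "h \<in> H1 U"
  have "L2_inner U (grad U (\<lambda>x. 0)) (grad U h) = 0"
    using grad_inner_bound[OF zero_H1 h] by (simp add: H1_norm_zero)
  then show ?thesis by (simp add: force_def L2_inner_def log_nonlin_def)
qed

end

section \<open>Weak derivatives in time\<close>

definition step_at :: "real \<Rightarrow> real \<Rightarrow> real \<Rightarrow> real" where
  "step_at \<delta> a x = smooth_step ((x - a) / \<delta>)"

context
  fixes \<delta> :: real
  assumes \<delta>: "\<delta> > 0"
begin

lemma smooth_step_at: "smooth_fun (step_at \<delta> a)"
proof -
  have "smooth_fun (\<lambda>x. inverse \<delta> * (x - a))"
    by (intro smooth_mult smooth_const smooth_diff smooth_bounded_linear bounded_linear_ident)
  from smooth_compose[OF smooth_smooth_step this] show ?thesis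
    by (simp add: step_at_def[abs_def] divide_inverse mult.commute)
qed

lemma step_at_DERIV: "(step_at \<delta> a has_real_derivative deriv (step_at \<delta> a) x) (at x)"
  using smooth_fun_differentiable[OF smooth_step_at] DERIV_deriv_iff_real_differentiable by blast

lemma step_at_mono: "x \<le> y \<Longrightarrow> step_at \<delta> a x \<le> step_at \<delta> a y"
  unfolding step_at_def using \<delta> by (intro smooth_step_mono divide_right_mono) auto

lemma step_at_le: "x \<le> a \<Longrightarrow> step_at \<delta> a x = 0"
  and step_at_ge: "x \<ge> a + \<delta> \<Longrightarrow> step_at \<delta> a x = 1"
  using \<delta> by (auto simp: step_at_def divide_nonpos_pos le_divide_eq intro!: smooth_step_le_0 smooth_step_ge_1)

lemma step_at_deriv_nonneg: "deriv (step_at \<delta> a) x \<ge> 0"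
  by (rule mono_on_imp_deriv_nonneg[of UNIV, OF _ step_at_DERIV]) (auto intro: mono_onI step_at_mono)

lemma step_at_deriv_outside:
  assumes "x \<notin> {a..a + \<delta>}"
  shows "deriv (step_at \<delta> a) x = 0"
proof -
  have "(step_at \<delta> a has_real_derivative 0) (at x)"
  proof (cases "x < a")
    case True
    have "((\<lambda>x. 0) has_real_derivative 0) (at x)" by simp
    then show ?thesis
      by (rule has_field_derivative_transform_within_open[of _ _ _ "{..<a}"])
         (use True in \<open>auto simp: step_at_le\<close>)
  next
    case False
    have "((\<lambda>x. 1) has_real_derivative 0) (at x)" by simp
    then show ?thesis
      by (rule has_field_derivative_transform_within_open[of _ _ _ "{a + \<delta><..}"])
         (use False assms in \<open>auto simp: step_at_ge\<close>)
  qed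
  then show ?thesis by (rule DERIV_imp_deriv)
qed

lemma step_at_deriv_continuous: "continuous_on UNIV (deriv (step_at \<delta> a))"
proof -
  have "Ck_on 1 UNIV (step_at \<delta> a)" using smooth_step_at by (simp add: smooth_fun_def del: One_nat_def)
  then show ?thesis unfolding One_nat_def Ck_on_Suc_real by simp
qed

lemma step_at_deriv_integral:
  "integrable lborel (deriv (step_at \<delta> a))" "(\<integral>x. deriv (step_at \<delta> a) x \<partial>lborel) = 1"
proof -
  show "integrable lborel (deriv (step_at \<delta> a))"
    by (rule integrable_compact_support[OF step_at_deriv_continuous compact_Icc step_at_deriv_outside])
  have "(\<integral>x. deriv (step_at \<delta> a) x * indicator {a..a + \<delta>} x \<partial>lborel) = step_at \<delta> a (a + \<delta>) - step_at \<delta> a a"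
    using \<delta> step_at_DERIV step_at_deriv_continuous
    by (intro integral_FTC_Icc_real) (auto simp: continuous_on_eq_continuous_at)
  moreover have "deriv (step_at \<delta> a) x * indicator {a..a + \<delta>} x = deriv (step_at \<delta> a) x" for x
    using step_at_deriv_outside[of x a] by (auto simp: indicator_def)
  ultimately show "(\<integral>x. deriv (step_at \<delta> a) x \<partial>lborel) = 1"
    using \<delta> by (simp add: step_at_le step_at_ge)
qed

end

text \<open>Testing with \<open>step_at \<delta> a - step_at \<delta> b\<close>, whose derivative approximates the difference of
  the Dirac measures at \<open>a\<close> and \<open>b\<close>.\<close>

lemma weak_derivative_lower_bound_interior:
  fixes h k :: "real \<Rightarrow> real"
  assumes h: "continuous_on {0..<T} h" and k: "integrable (lebesgue_on {0<..<T}) k"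
    and weak: "\<And>\<phi>. \<phi> \<in> test_functions {0<..<T} \<Longrightarrow>
      (\<integral>t. deriv \<phi> t * h t \<partial>lebesgue_on {0<..<T}) = - (\<integral>t. \<phi> t * k t \<partial>lebesgue_on {0<..<T})"
    and ab: "0 \<le> a" "a < a'" "a' < b'" "b' < b" "b \<le> T"
    and A: "AE t in lebesgue_on {0<..<T}. a < t \<and> t < b \<longrightarrow> A \<le> k t"
  shows "A * (b' - a') \<le> h b' - h a'"
proof (rule field_le_epsilon)
  fix e :: real assume e: "e > 0"
  let ?M = "lebesgue_on {0<..<T}"
  have US: "{0<..<T} \<in> sets lebesgue" by auto
  \<comment> \<open>With the line of slope A subtracted, the claim becomes that H does not decrease
    from a' to b', up to e.\<close>
  define H where "H t = h t - A * t" for t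
  have H: "continuous_on {0..<T} H" unfolding H_def by (intro continuous_intros h)
  have near: "\<exists>\<delta>>0. \<forall>t. \<bar>t - c\<bar> \<le> \<delta> \<longrightarrow> \<bar>H t - H c\<bar> \<le> e / 2" if c: "0 < c" "c < T" for c
  proof -
    have "isCont H c"
      using continuous_on_interior[OF H, of c] c by (simp add: interior_atLeastLessThan)
    then obtain d where d: "d > 0" "\<And>t. dist t c < d \<Longrightarrow> dist (H t) (H c) < e / 2"
      using e unfolding continuous_at_eps_delta by (metis half_gt_zero)
    show ?thesis
    proof (intro exI[of _ "d / 2"] conjI allI impI)
      fix t assume "\<bar>t - c\<bar> \<le> d / 2"
      then have "dist t c < d" using d(1) by (simp add: dist_real_def)
      from d(2)[OF this] show "\<bar>H t - H c\<bar> \<le> e / 2" by (simp add: dist_real_def)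
    qed (use d in simp)
  qed
  obtain \<delta>1 where \<delta>1: "\<delta>1 > 0" "\<And>t. \<bar>t - a'\<bar> \<le> \<delta>1 \<Longrightarrow> \<bar>H t - H a'\<bar> \<le> e / 2" using near[of a'] ab by auto
  obtain \<delta>2 where \<delta>2: "\<delta>2 > 0" "\<And>t. \<bar>t - b'\<bar> \<le> \<delta>2 \<Longrightarrow> \<bar>H t - H b'\<bar> \<le> e / 2" using near[of b'] ab by auto
  \<comment> \<open>Keeps H within e / 2 of its values at a' and b' on the two transition layers,
    and the support of the test function inside (a, b).\<close>
  define \<delta> where "\<delta> = min \<delta>1 (min \<delta>2 ((b - b') / 2))"
  have \<delta>: "\<delta> > 0" "\<delta> \<le> \<delta>1" "\<delta> \<le> \<delta>2" "\<delta> \<le> (b - b') / 2"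
  proof -
    show "\<delta> > 0" using \<delta>1(1) \<delta>2(1) ab by (simp add: \<delta>_def)
    show "\<delta> \<le> \<delta>1" unfolding \<delta>_def by (rule min.cobounded1)
    show "\<delta> \<le> \<delta>2" unfolding \<delta>_def by (rule min.coboundedI2[OF min.cobounded1])
    show "\<delta> \<le> (b - b') / 2" unfolding \<delta>_def by (rule min.coboundedI2[OF min.cobounded2])
  qed
  define \<phi> where "\<phi> t = step_at \<delta> a' t - step_at \<delta> b' t" for t
  have \<phi>0: "\<phi> t = 0" if "t \<notin> {a'..b' + \<delta>}" for t
    using that \<delta> ab by (cases "t < a'") (auto simp: \<phi>_def step_at_le step_at_ge)
  have sm: "smooth_fun \<phi>" unfolding \<phi>_def[abs_def] by (intro smooth_diff smooth_step_at \<delta>)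
  have sub: "{a'..b' + \<delta>} \<subseteq> {0<..<T}"
    using ab \<delta> by auto
  have \<phi>: "\<phi> \<in> test_functions {0<..<T}" by (rule test_functionsI[OF sm compact_Icc sub \<phi>0])
  have \<phi>nn: "\<phi> t \<ge> 0" for t
  proof -
    have "step_at \<delta> b' t = step_at \<delta> a' (t - (b' - a'))" by (simp add: step_at_def)
    also have "\<dots> \<le> step_at \<delta> a' t" using ab by (intro step_at_mono \<delta>) auto
    finally show ?thesis by (simp add: \<phi>_def)
  qed
  have d\<phi>: "deriv \<phi> t = deriv (step_at \<delta> a') t - deriv (step_at \<delta> b') t" for t
    unfolding \<phi>_def[abs_def]
    by (intro DERIV_imp_deriv DERIV_diff step_at_DERIV \<delta>)
  have D0: "deriv \<phi> t = 0" if "t \<notin> {a'..b' + \<delta>}" for t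
    using that ab \<delta> by (auto simp: d\<phi> step_at_deriv_outside)
  have D0': "deriv \<phi> t * c = 0" if "t \<notin> {0<..<T}" for t c
  proof -
    have "t \<notin> {a'..b' + \<delta>}" using that sub by blast
    from D0[OF this] show ?thesis by simp
  qed
  have Dc: "continuous_on UNIV (deriv \<phi>)"
    unfolding d\<phi>[abs_def] by (intro continuous_on_diff step_at_deriv_continuous \<delta>)
  have prod: "integrable lborel (\<lambda>t. deriv \<phi> t * f t)" "(\<lambda>t. deriv \<phi> t * f t) \<in> borel_measurable borel"
    "(\<integral>t. deriv \<phi> t * f t \<partial>?M) = (\<integral>t. deriv \<phi> t * f t \<partial>lborel)" if f: "continuous_on {0..<T} f" for f
  proof -
    have "integrable lborel (\<lambda>t. indicator {a'..b' + \<delta>} t *\<^sub>R (deriv \<phi> t * f t))"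
      using sub by (intro borel_integrable_compact continuous_on_mult continuous_on_subset[OF Dc] continuous_on_subset[OF f]) auto
    also have "(\<lambda>t. indicator {a'..b' + \<delta>} t *\<^sub>R (deriv \<phi> t * f t)) = (\<lambda>t. deriv \<phi> t * f t)"
      using D0 by (fastforce simp: indicator_def)
    finally show i: "integrable lborel (\<lambda>t. deriv \<phi> t * f t)" .
    then show m: "(\<lambda>t. deriv \<phi> t * f t) \<in> borel_measurable borel" using borel_measurable_integrable by fastforce
    show "(\<integral>t. deriv \<phi> t * f t \<partial>?M) = (\<integral>t. deriv \<phi> t * f t \<partial>lborel)"
      by (rule integral_lebesgue_on_vanish(1)[OF US m D0'])
  qed
  have cid: "continuous_on {0..<T} (\<lambda>t::real. t)" by (rule continuous_on_id)
  \<comment> \<open>The test function t \<phi>(t) integrates the linear part of H by parts.\<close>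
  have "0 = (\<integral>t. frechet_derivative (\<lambda>t. t * \<phi> t) (at t) 1 \<partial>?M)"
    by (rule integral_test_derivative[symmetric, OF US])
       (auto intro!: test_mult_smooth \<phi> smooth_bounded_linear bounded_linear_ident)
  also have "\<dots> = (\<integral>t. deriv \<phi> t * t + \<phi> t \<partial>?M)"
  proof (rule Bochner_Integration.integral_cong[OF refl])
    fix t
    have d: "\<phi> differentiable at t" by (rule smooth_fun_differentiable[OF sm])
    then show "frechet_derivative (\<lambda>t. t * \<phi> t) (at t) 1 = deriv \<phi> t * t + \<phi> t"
      by (simp add: frechet_derivative_mult frechet_derivative_real)
  qed
  also have "\<dots> = (\<integral>t. deriv \<phi> t * t \<partial>?M) + (\<integral>t. \<phi> t \<partial>?M)"
  proof (rule Bochner_Integration.integral_add)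
    show "integrable ?M (\<lambda>t. deriv \<phi> t * t)"
      using integral_lebesgue_on_vanish(2)[OF US prod(2)[OF cid] D0'] prod(1)[OF cid] by blast
  qed (rule test_integrable_on[OF US \<phi>])
  finally have by_parts: "(\<integral>t. deriv \<phi> t * t \<partial>lborel) = - (\<integral>t. \<phi> t \<partial>?M)" by (simp add: prod(3)[OF cid])
  have ik: "integrable ?M (\<lambda>t. \<phi> t * k t)"
  proof -
    obtain B where B: "\<And>t. \<bar>\<phi> t\<bar> \<le> B" using test_bounded[OF \<phi>] by metis
    show ?thesis
    proof (rule Bochner_Integration.integrable_bound)
      show "integrable ?M (\<lambda>t. B * k t)" using k by simp
      show "AE t in ?M. norm (\<phi> t * k t) \<le> norm (B * k t)"
      proof (rule AE_I2)
        fix t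
        have "\<bar>\<phi> t\<bar> \<le> \<bar>B\<bar>" using B[of t] by linarith
        then show "norm (\<phi> t * k t) \<le> norm (B * k t)" by (simp add: abs_mult mult_right_mono)
      qed
    qed (use test_measurable_on[OF \<phi>] borel_measurable_integrable[OF k] in auto)
  qed
  have "A * (\<integral>t. \<phi> t \<partial>?M) = (\<integral>t. A * \<phi> t \<partial>?M)" by simp
  also have "\<dots> \<le> (\<integral>t. \<phi> t * k t \<partial>?M)"
  proof (rule integral_mono_AE)
    show "integrable ?M (\<lambda>t. A * \<phi> t)" using test_integrable_on[OF US \<phi>] by simp
    show "AE t in ?M. A * \<phi> t \<le> \<phi> t * k t"
      using A
    proof eventually_elim
      case (elim t)
      show ?case
      proof (cases "t \<in> {a'..b' + \<delta>}")
        case True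
        then have "a < t \<and> t < b" using ab \<delta> by (auto simp: field_simps)
        then show ?thesis using elim mult_left_mono[OF _ \<phi>nn[of t], of A "k t"] by (simp add: mult.commute)
      next
        case False
        then show ?thesis using \<phi>0 by simp
      qed
    qed
  qed (rule ik)
  finally have 1: "(\<integral>t. deriv \<phi> t * H t \<partial>lborel) \<le> 0"
    using weak[OF \<phi>] prod(3)[OF h] prod(1)[OF h] prod(1)[OF cid] by_parts
    by (simp add: H_def right_diff_distrib mult.left_commute[of _ A])
  \<comment> \<open>Both step derivatives are nonnegative with integral 1 and live on the layers
    where H is close to H a' and to H b'.\<close>
  have "(H a' - e / 2) - (H b' + e / 2)
      = (\<integral>t. (H a' - e / 2) * deriv (step_at \<delta> a') t - (H b' + e / 2) * deriv (step_at \<delta> b') t \<partial>lborel)"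
    using step_at_deriv_integral[OF \<delta>(1)] by simp
  also have "\<dots> \<le> (\<integral>t. deriv \<phi> t * H t \<partial>lborel)"
  proof (rule integral_mono)
    show "integrable lborel (\<lambda>t. (H a' - e / 2) * deriv (step_at \<delta> a') t - (H b' + e / 2) * deriv (step_at \<delta> b') t)"
      using step_at_deriv_integral[OF \<delta>(1)] by simp
    show "integrable lborel (\<lambda>t. deriv \<phi> t * H t)" by (rule prod(1)[OF H])
    fix t
    have "(H a' - e / 2) * deriv (step_at \<delta> a') t \<le> H t * deriv (step_at \<delta> a') t"
    proof (cases "t \<in> {a'..a' + \<delta>}")
      case True
      then have "\<bar>H t - H a'\<bar> \<le> e / 2" using \<delta> by (intro \<delta>1) auto
      then have "H a' - e / 2 \<le> H t" by linarith
      then show ?thesis by (intro mult_right_mono step_at_deriv_nonneg \<delta>)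
    qed (simp add: step_at_deriv_outside[OF \<delta>(1)])
    moreover have "H t * deriv (step_at \<delta> b') t \<le> (H b' + e / 2) * deriv (step_at \<delta> b') t"
    proof (cases "t \<in> {b'..b' + \<delta>}")
      case True
      then have "\<bar>H t - H b'\<bar> \<le> e / 2" using \<delta> by (intro \<delta>2) auto
      then have "H t \<le> H b' + e / 2" by linarith
      then show ?thesis by (intro mult_right_mono step_at_deriv_nonneg \<delta>)
    qed (simp add: step_at_deriv_outside[OF \<delta>(1)])
    moreover have "deriv \<phi> t * H t = H t * deriv (step_at \<delta> a') t - H t * deriv (step_at \<delta> b') t"
      by (simp add: d\<phi> algebra_simps)
    ultimately show "(H a' - e / 2) * deriv (step_at \<delta> a') t - (H b' + e / 2) * deriv (step_at \<delta> b') t \<le> deriv \<phi> t * H t"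
      by linarith
  qed
  finally show "A * (b' - a') \<le> h b' - h a' + e" using 1 by (simp add: H_def algebra_simps)
qed

text \<open>Inner points tend to a and b. The limit is what admits a = 0, where h is continuous only
  from the right and no test function reaches.\<close>

lemma weak_derivative_lower_bound:
  fixes h k :: "real \<Rightarrow> real"
  assumes h: "continuous_on {0..<T} h" and k: "integrable (lebesgue_on {0<..<T}) k"
    and weak: "\<And>\<phi>. \<phi> \<in> test_functions {0<..<T} \<Longrightarrow>
      (\<integral>t. deriv \<phi> t * h t \<partial>lebesgue_on {0<..<T}) = - (\<integral>t. \<phi> t * k t \<partial>lebesgue_on {0<..<T})"
    and ab: "0 \<le> a" "a < b" "b < T"
    and A: "AE t in lebesgue_on {0<..<T}. a < t \<and> t < b \<longrightarrow> A \<le> k t"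
  shows "A * (b - a) \<le> h b - h a"
proof -
  \<comment> \<open>Thirds keep \<open>\<alpha> k\<close> below \<open>\<beta> k\<close> already for
    k = 0.\<close>
  define \<alpha> \<beta> where "\<alpha> k = a + (b - a) / 3 * inverse (real (Suc k))" and "\<beta> k = b - (b - a) / 3 * inverse (real (Suc k))" for k
  have i: "0 < inverse (real (Suc k))" "inverse (real (Suc k)) \<le> 1" for k
    by (auto simp: field_simps)
  have ab': "a < \<alpha> k" "\<alpha> k < \<beta> k" "\<beta> k < b" for k
  proof -
    have "0 < (b - a) / 3 * inverse (real (Suc k))" using ab i by (intro mult_pos_pos) auto
    moreover have "(b - a) / 3 * inverse (real (Suc k)) \<le> (b - a) / 3 * 1" using ab i by (intro mult_left_mono) auto
    ultimately show "a < \<alpha> k" "\<alpha> k < \<beta> k" "\<beta> k < b"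
      unfolding \<alpha>_def \<beta>_def using ab by argo+
  qed
  have "A * (\<beta> k - \<alpha> k) \<le> h (\<beta> k) - h (\<alpha> k)" for k
    by (rule weak_derivative_lower_bound_interior[OF h _ weak _ ab'[of k] _ A]) (use assms in auto)
  have "\<alpha> \<longlonglongrightarrow> a + (b - a) / 3 * 0" "\<beta> \<longlonglongrightarrow> b - (b - a) / 3 * 0"
    unfolding \<alpha>_def[abs_def] \<beta>_def[abs_def] by (intro tendsto_intros LIMSEQ_inverse_real_of_nat)+
  then have l: "\<alpha> \<longlonglongrightarrow> a" "\<beta> \<longlonglongrightarrow> b" by simp_all
  have r: "\<alpha> k \<in> {0..<T}" "\<beta> k \<in> {0..<T}" for k
    using ab'[of k] ab by (auto intro: order_trans)
  have "(\<lambda>k. h (\<alpha> k)) \<longlonglongrightarrow> h a" "(\<lambda>k. h (\<beta> k)) \<longlonglongrightarrow> h b"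
    using ab r by (auto intro!: continuous_on_tendsto_compose[OF h] l always_eventually)
  then have l1: "(\<lambda>k. h (\<beta> k) - h (\<alpha> k)) \<longlonglongrightarrow> h b - h a" by (intro tendsto_diff)
  have l2: "(\<lambda>k. A * (\<beta> k - \<alpha> k)) \<longlonglongrightarrow> A * (b - a)" by (intro tendsto_intros l)
  show ?thesis by (rule LIMSEQ_le[OF l2 l1]) (use \<open>\<And>k. A * (\<beta> k - \<alpha> k) \<le> h (\<beta> k) - h (\<alpha> k)\<close> in auto)
qed

lemma weak_derivative_mean_value:
  fixes h k :: "real \<Rightarrow> real"
  assumes h: "continuous_on {0..<T} h" and k: "integrable (lebesgue_on {0<..<T}) k"
    and weak: "\<And>\<phi>. \<phi> \<in> test_functions {0<..<T} \<Longrightarrow>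
      (\<integral>t. deriv \<phi> t * h t \<partial>lebesgue_on {0<..<T}) = - (\<integral>t. \<phi> t * k t \<partial>lebesgue_on {0<..<T})"
    and ab: "0 \<le> a" "a < b" "b < T"
    and B: "AE t in lebesgue_on {0<..<T}. a < t \<and> t < b \<longrightarrow> \<bar>k t - c\<bar> \<le> B"
  shows "\<bar>h b - h a - (b - a) * c\<bar> \<le> (b - a) * B"
proof -
  have "(c - B) * (b - a) \<le> h b - h a"
    by (rule weak_derivative_lower_bound[OF h k weak ab]) (use B in \<open>auto elim: eventually_mono\<close>)
  moreover have "(- c - B) * (b - a) \<le> - h b - - h a"
  proof (rule weak_derivative_lower_bound[where k = "\<lambda>t. - k t" and T = T])
    show "(\<integral>t. deriv \<phi> t * - h t \<partial>lebesgue_on {0<..<T}) = - (\<integral>t. \<phi> t * - k t \<partial>lebesgue_on {0<..<T})"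
      if "\<phi> \<in> test_functions {0<..<T}" for \<phi>
      using weak[OF that] by simp
    show "AE t in lebesgue_on {0<..<T}. a < t \<and> t < b \<longrightarrow> - c - B \<le> - k t"
      using B by (auto elim: eventually_mono)
  qed (use ab k h in \<open>auto intro: continuous_on_minus\<close>)
  ultimately show ?thesis by (simp add: abs_le_iff algebra_simps)
qed

section \<open>Measurability and continuity in time\<close>

lemma AE_lebesgue_on_interval_witness:
  fixes T :: real
  assumes "AE t in lebesgue_on {0<..<T}. P t" "0 \<le> a" "a < b" "b \<le> T"
  obtains t where "a < t" "t < b" "P t"
proof -
  have "{0<..<T} \<inter> space lebesgue \<in> sets lebesgue" by simp
  then have "AE t in lebesgue. t \<in> {0<..<T} \<longrightarrow> P t"
    using assms(1) by (rule AE_restrict_space_iff[THEN iffD1])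
  then have "{t. \<not> (t \<in> {0<..<T} \<longrightarrow> P t)} \<in> null_sets lebesgue"
    by (simp add: completion.AE_iff_null_sets)
  moreover have "{a<..<b} \<notin> null_sets lebesgue" using assms by (simp add: null_sets_def)
  ultimately have "\<not> {a<..<b} \<subseteq> {t. \<not> (t \<in> {0<..<T} \<longrightarrow> P t)}"
    using completion.complete2 by blast
  then obtain t where "t \<in> {a<..<b}" "t \<in> {0<..<T} \<longrightarrow> P t" by blast
  then show ?thesis using that[of t] assms(2-4) by simp
qed

text \<open>Holds by completeness of Lebesgue measure; pairings with simple functions converge only
  almost everywhere.\<close>

lemma borel_measurable_lebesgue_on_AE:
  fixes f g :: "'a::euclidean_space \<Rightarrow> real"
  assumes S: "S \<in> sets lebesgue" and f: "f \<in> borel_measurable (lebesgue_on S)"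
    and eq: "AE x in lebesgue_on S. f x = g x"
  shows "g \<in> borel_measurable (lebesgue_on S)"
proof -
  have S': "S \<inter> space lebesgue \<in> sets lebesgue" using S by simp
  have "(\<lambda>x. indicator S x *\<^sub>R f x) \<in> borel_measurable lebesgue"
    using f S' by (simp add: borel_measurable_restrict_space_iff)
  moreover have "AE x in lebesgue. indicator S x *\<^sub>R f x = indicator S x *\<^sub>R g x"
    using eq S by (auto simp: AE_restrict_space_iff indicator_def)
  ultimately have "(\<lambda>x. indicator S x *\<^sub>R g x) \<in> borel_measurable lebesgue"
    by (rule borel_measurable_AE)
  then show ?thesis using S' by (simp add: borel_measurable_restrict_space_iff)
qed

text \<open>Pairing with a fixed w turns strong measurability into measurability of a scalar
  function, which is all that the mean value inequality asks for; Cauchy-Schwarz and the finite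
  measure of A give integrability.\<close>

lemma bochner_L2_inner_integrable:
  fixes u :: "real \<Rightarrow> 'a::euclidean_space \<Rightarrow> real"
  assumes A: "A \<in> lmeasurable" and u: "u \<in> bochner_L2 A (L2_space U) (Lq_norm 2 U)" and w: "w \<in> L2_space U"
  shows "integrable (lebesgue_on A) (\<lambda>t. L2_inner U (u t) w)"
proof -
  let ?M = "lebesgue_on A"
  have int: "integrable ?M (\<lambda>t. (Lq_norm 2 U (u t))\<^sup>2)" and X: "AE t in ?M. u t \<in> L2_space U"
    using u by (auto simp: bochner_L2_def bochner_measurable_def)
  obtain s where s: "\<And>k. simple_function ?M (s k)" "\<And>k t. t \<in> A \<Longrightarrow> s k t \<in> L2_space U"
    and lim: "AE t in ?M. (\<lambda>k. Lq_norm 2 U (\<lambda>x. s k t x - u t x)) \<longlonglongrightarrow> 0"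
    using u unfolding bochner_L2_def bochner_measurable_def by blast
  have [measurable]: "(\<lambda>t. L2_inner U (s k t) w) \<in> borel_measurable ?M" for k
    using simple_function_compose1[OF s(1), of "\<lambda>f. L2_inner U f w" k] by (rule borel_measurable_simple_function)
  have m: "(\<lambda>t. L2_inner U (u t) w) \<in> borel_measurable ?M"
  proof (rule borel_measurable_lebesgue_on_AE)
    show "(\<lambda>t. lim (\<lambda>k. L2_inner U (s k t) w)) \<in> borel_measurable ?M" by measurable
    show "AE t in ?M. lim (\<lambda>k. L2_inner U (s k t) w) = L2_inner U (u t) w"
      using lim X AE_space
    proof eventually_elim
      case (elim t)
      then have "t \<in> A" by (simp add: space_restrict_space)
      then have "(\<lambda>k. L2_inner U (s k t) w) \<longlonglongrightarrow> L2_inner U (u t) w"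
        using elim by (intro L2_inner_tendsto s w) auto
      then show ?case by (rule limI)
    qed
  qed (use A in auto)
  show ?thesis
  proof (rule Bochner_Integration.integrable_bound[OF _ m])
    show "integrable ?M (\<lambda>t. (Lq_norm 2 U (u t))\<^sup>2 + (Lq_norm 2 U w)\<^sup>2)"
      using int A by (intro Bochner_Integration.integrable_add finite_measure.integrable_const finite_measure_lebesgue_on)
    show "AE t in ?M. norm (L2_inner U (u t) w) \<le> norm ((Lq_norm 2 U (u t))\<^sup>2 + (Lq_norm 2 U w)\<^sup>2)"
      using X
    proof eventually_elim
      case (elim t)
      define a b where "a = Lq_norm 2 U (u t)" and "b = Lq_norm 2 U w"
      have "\<bar>L2_inner U (u t) w\<bar> \<le> a * b" unfolding a_def b_def by (rule L2_Cauchy_Schwarz[OF elim w])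
      moreover have "2 * a * b \<le> a\<^sup>2 + b\<^sup>2" by (rule sum_squares_bound)
      moreover have "0 \<le> a * b" by (simp add: a_def b_def Lq_norm_nonneg)
      ultimately show ?case unfolding a_def[symmetric] b_def[symmetric] by simp
    qed
  qed
qed

lemma L2_continuous_inner:
  assumes "L2_continuous_on A U v" "w \<in> L2_space U"
  shows "continuous_on A (\<lambda>t. L2_inner U (v t) w)"
  unfolding continuous_on_def
proof
  fix t assume t: "t \<in> A"
  then have v: "\<And>s. s \<in> A \<Longrightarrow> v s \<in> L2_space U" "((\<lambda>s. Lq_norm 2 U (\<lambda>x. v s x - v t x)) \<longlongrightarrow> 0) (at t within A)"
    using assms(1) by (auto simp: L2_continuous_on_def)
  show "((\<lambda>t. L2_inner U (v t) w) \<longlongrightarrow> L2_inner U (v t) w) (at t within A)"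
  proof (rule Lim_null_comparison[THEN LIM_zero_cancel])
    have "\<forall>\<^sub>F s in at t within A. s \<in> A" by (auto simp: eventually_at_filter)
    then show "\<forall>\<^sub>F s in at t within A. norm (L2_inner U (v s) w - L2_inner U (v t) w)
        \<le> Lq_norm 2 U (\<lambda>x. v s x - v t x) * Lq_norm 2 U w"
    proof eventually_elim
      case (elim s)
      then show ?case
        using L2_Cauchy_Schwarz[OF L2_diff[OF v(1) v(1)] assms(2), of s t] t
        by (simp add: L2_inner_diff_left v(1) assms(2))
    qed
    show "((\<lambda>s. Lq_norm 2 U (\<lambda>x. v s x - v t x) * Lq_norm 2 U w) \<longlongrightarrow> 0) (at t within A)"
      using tendsto_mult_left_zero[OF v(2)] .
  qed
qed

section \<open>Weak solutions\<close>

locale potential_well_solution = log_potential_well U p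
  for U :: "'a::euclidean_space set" and p +
  fixes v0 :: "'a \<Rightarrow> real" and T :: real and v :: "real \<Rightarrow> 'a \<Rightarrow> real"
  assumes T: "T > 0" and sol: "weak_solution U p v0 T v"
begin

lemma v_L2: "0 \<le> t \<Longrightarrow> t < T \<Longrightarrow> v t \<in> L2_space U"
  using sol by (auto simp: weak_solution_def L2_continuous_on_def)

text \<open>An essential bound fixed once, so that \<open>Lip\<close> and \<open>speed\<close> below
  are constants attached to one ball. All three depend on T.\<close>

definition bound :: real where
  "bound = (SOME M. M \<ge> 0 \<and> (AE t in lebesgue_on {0<..<T}. v t \<in> H10 U \<and> H1_norm U (v t) \<le> M))"

lemma bound_nonneg: "bound \<ge> 0"
  and AE_bound: "AE t in lebesgue_on {0<..<T}. v t \<in> H10 U \<and> H1_norm U (v t) \<le> bound"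
proof -
  have b: "v \<in> bochner_Linf {0<..<T} (H10 U) (H1_norm U)" using sol by (simp add: weak_solution_def)
  then obtain M where M: "AE t in lebesgue_on {0<..<T}. H1_norm U (v t) \<le> M" by (auto simp: bochner_Linf_def)
  have "AE t in lebesgue_on {0<..<T}. v t \<in> H10 U"
    using b by (auto simp: bochner_Linf_def bochner_measurable_def)
  with M have "AE t in lebesgue_on {0<..<T}. v t \<in> H10 U \<and> H1_norm U (v t) \<le> max M 0"
    by eventually_elim auto
  then have "\<exists>M. M \<ge> 0 \<and> (AE t in lebesgue_on {0<..<T}. v t \<in> H10 U \<and> H1_norm U (v t) \<le> M)"
    by (intro exI[of _ "max M 0"]) auto
  from someI_ex[OF this, folded bound_def] show "bound \<ge> 0"
    "AE t in lebesgue_on {0<..<T}. v t \<in> H10 U \<and> H1_norm U (v t) \<le> bound"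
    by blast+
qed

definition Lip :: real where
  "Lip = (SOME L. L \<ge> 0 \<and>
    (\<forall>u\<in>H10 U. \<forall>w\<in>H10 U. \<forall>h\<in>H10 U. H1_norm U u \<le> bound \<longrightarrow> H1_norm U w \<le> bound \<longrightarrow>
      \<bar>force u h - force w h\<bar> \<le> L * H1_norm U (\<lambda>x. u x - w x) * H1_norm U h) \<and>
    (\<forall>u\<in>H10 U. \<forall>w\<in>H10 U. H1_norm U u \<le> bound \<longrightarrow> H1_norm U w \<le> bound \<longrightarrow>
      \<bar>J_fun U p u - J_fun U p w + force w (\<lambda>x. u x - w x)\<bar> \<le> L * (H1_norm U (\<lambda>x. u x - w x))\<^sup>2))"

lemma Lip_nonneg: "Lip \<ge> 0"
  and force_Lip: "u \<in> H10 U \<Longrightarrow> w \<in> H10 U \<Longrightarrow> h \<in> H10 U \<Longrightarrow> H1_norm U u \<le> bound \<Longrightarrow> H1_norm U w \<le> bound \<Longrightarrow>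
      \<bar>force u h - force w h\<bar> \<le> Lip * H1_norm U (\<lambda>x. u x - w x) * H1_norm U h"
  and J_fun_Lip: "u \<in> H10 U \<Longrightarrow> w \<in> H10 U \<Longrightarrow> H1_norm U u \<le> bound \<Longrightarrow> H1_norm U w \<le> bound \<Longrightarrow>
      \<bar>J_fun U p u - J_fun U p w + force w (\<lambda>x. u x - w x)\<bar> \<le> Lip * (H1_norm U (\<lambda>x. u x - w x))\<^sup>2"
proof -
  have "\<exists>L. L \<ge> 0 \<and>
    (\<forall>u\<in>H10 U. \<forall>w\<in>H10 U. \<forall>h\<in>H10 U. H1_norm U u \<le> bound \<longrightarrow> H1_norm U w \<le> bound \<longrightarrow>
      \<bar>force u h - force w h\<bar> \<le> L * H1_norm U (\<lambda>x. u x - w x) * H1_norm U h) \<and>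
    (\<forall>u\<in>H10 U. \<forall>w\<in>H10 U. H1_norm U u \<le> bound \<longrightarrow> H1_norm U w \<le> bound \<longrightarrow>
      \<bar>J_fun U p u - J_fun U p w + force w (\<lambda>x. u x - w x)\<bar> \<le> L * (H1_norm U (\<lambda>x. u x - w x))\<^sup>2)"
  proof (rule force_bounds[of bound])
    fix L
    assume L: "L \<ge> 0"
      "\<And>u w h. u \<in> H10 U \<Longrightarrow> w \<in> H10 U \<Longrightarrow> h \<in> H10 U \<Longrightarrow> H1_norm U u \<le> bound \<Longrightarrow> H1_norm U w \<le> bound \<Longrightarrow>
        \<bar>force u h - force w h\<bar> \<le> L * H1_norm U (\<lambda>x. u x - w x) * H1_norm U h"
      "\<And>u w. u \<in> H10 U \<Longrightarrow> w \<in> H10 U \<Longrightarrow> H1_norm U u \<le> bound \<Longrightarrow> H1_norm U w \<le> bound \<Longrightarrow>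
        \<bar>J_fun U p u - J_fun U p w + force w (\<lambda>x. u x - w x)\<bar> \<le> L * (H1_norm U (\<lambda>x. u x - w x))\<^sup>2"
    show ?thesis by (intro exI[of _ L] conjI ballI impI L)
  qed
  note S = someI_ex[OF this, folded Lip_def]
  show "Lip \<ge> 0" by (rule conjunct1[OF S])
  show "u \<in> H10 U \<Longrightarrow> w \<in> H10 U \<Longrightarrow> h \<in> H10 U \<Longrightarrow> H1_norm U u \<le> bound \<Longrightarrow> H1_norm U w \<le> bound \<Longrightarrow>
      \<bar>force u h - force w h\<bar> \<le> Lip * H1_norm U (\<lambda>x. u x - w x) * H1_norm U h"
    by (rule conjunct1[OF conjunct2[OF S], rule_format])
  show "u \<in> H10 U \<Longrightarrow> w \<in> H10 U \<Longrightarrow> H1_norm U u \<le> bound \<Longrightarrow> H1_norm U w \<le> bound \<Longrightarrow>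
      \<bar>J_fun U p u - J_fun U p w + force w (\<lambda>x. u x - w x)\<bar> \<le> Lip * (H1_norm U (\<lambda>x. u x - w x))\<^sup>2"
    by (rule conjunct2[OF conjunct2[OF S], rule_format])
qed

text \<open>As \<open>force\<close> vanishes at 0, its Lipschitz constant times the radius bounds it
  on the ball; by the equation this bounds the velocity of v in H^1.\<close>

definition speed :: real where "speed = Lip * bound"

lemma speed_nonneg: "speed \<ge> 0"
  by (simp add: speed_def Lip_nonneg bound_nonneg)

lemma force_speed:
  assumes "u \<in> H10 U" "H1_norm U u \<le> bound" "h \<in> H10 U"
  shows "\<bar>force u h\<bar> \<le> speed * H1_norm U h"
proof -
  have "\<bar>force u h\<bar> \<le> Lip * H1_norm U u * H1_norm U h"
    using force_Lip[OF assms(1) zero_H10 assms(3,2)]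
    by (simp add: H1_norm_zero bound_nonneg force_zero H10_H1 assms(3))
  also have "\<dots> \<le> speed * H1_norm U h"
    unfolding speed_def using assms(2) Lip_nonneg by (intro mult_right_mono mult_left_mono H1_norm_nonneg)
  finally show ?thesis .
qed

text \<open>Tested with \<open>w - \<Delta>w\<close>, the weak time derivative in \<open>L\<^sup>2(U)\<close> becomes the time derivative
  of the inner product of \<open>H\<^sup>1(U)\<close> with \<open>w\<close>. In particular the boundary values of the time
  derivative play no role.\<close>

lemma mean_value_test:
  assumes st: "0 \<le> s" "s < t" "t < T" and vs: "v s \<in> H10 U" and vt: "v t \<in> H10 U" and w: "w \<in> test_functions U"
    and B: "AE r in lebesgue_on {0<..<T}. s < r \<and> r < t \<longrightarrow> \<bar>force (v r) w - c\<bar> \<le> B"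
  shows "\<bar>H1_inner (\<lambda>x. v t x - v s x) w - (t - s) * c\<bar> \<le> (t - s) * B"
proof -
  let ?M = "lebesgue_on {0<..<T}"
  define \<psi> where "\<psi> x = w x - laplacian w x" for x
  have \<psi>: "\<psi> \<in> L2_space U" unfolding \<psi>_def[abs_def]
    by (intro L2_diff test_L2[OF U_sets] laplacian_test w)
  obtain v' where v': "v' \<in> bochner_L2 {0<..<T} (L2_space U) (Lq_norm 2 U)"
    and wtd: "weak_time_derivative U T v v'"
    and eq: "AE t in ?M. v' t \<in> H1 U \<and>
              (\<forall>w\<in>H10 U.
                 integrable (lebesgue_on U)
                   (\<lambda>x. v t x * \<bar>v t x\<bar> powr (p - 1) * ln \<bar>v t x\<bar> * w x) \<and>
                 L2_inner U (v' t) w + L2_inner U (grad U (v' t)) (grad U w)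
                   + L2_inner U (grad U (v t)) (grad U w)
                 = L2_inner U (\<lambda>x. v t x * \<bar>v t x\<bar> powr (p - 1) * ln \<bar>v t x\<bar>) w)"
    using sol unfolding weak_solution_def by blast
  have "AE r in ?M. L2_inner U (v' r) \<psi> = force (v r) w"
    using eq
  proof eventually_elim
    case (elim r)
    have "L2_inner U (v' r) \<psi> = H1_inner (v' r) w"
      using elim w by (simp add: H1_inner_test \<psi>_def[abs_def])
    also have "\<dots> = force (v r) w"
      using elim test_H10[OF w] by (simp add: H1_inner_def force_def log_nonlin_def[abs_def] algebra_simps)
    finally show ?case .
  qed
  with B have B': "AE r in ?M. s < r \<and> r < t \<longrightarrow> \<bar>L2_inner U (v' r) \<psi> - c\<bar> \<le> B"
    by eventually_elim simp
  have "\<bar>L2_inner U (v t) \<psi> - L2_inner U (v s) \<psi> - (t - s) * c\<bar> \<le> (t - s) * B"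
  proof (rule weak_derivative_mean_value[OF _ _ _ st B'])
    show "continuous_on {0..<T} (\<lambda>r. L2_inner U (v r) \<psi>)"
      using sol \<psi> by (intro L2_continuous_inner) (auto simp: weak_solution_def)
    show "integrable ?M (\<lambda>r. L2_inner U (v' r) \<psi>)"
      by (rule bochner_L2_inner_integrable[OF _ v' \<psi>]) auto
    show "(\<integral>t. deriv \<phi> t * L2_inner U (v t) \<psi> \<partial>?M) = - (\<integral>t. \<phi> t * L2_inner U (v' t) \<psi> \<partial>?M)"
      if "\<phi> \<in> test_functions {0<..<T}" for \<phi>
      using wtd that \<psi> by (simp add: weak_time_derivative_def)
  qed
  moreover have "L2_inner U (v r) \<psi> = H1_inner (v r) w" if "v r \<in> H10 U" for r
    using that w by (simp add: H1_inner_test H10_H1 \<psi>_def[abs_def])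
  ultimately show ?thesis
    using vs vt w by (simp add: H1_inner_diff_left H10_H1 test_H1)
qed

text \<open>Test functions are replaced by their limits: both sides depend continuously on w in the
  H^1 norm, for \<open>force\<close> uniformly in time by \<open>force_speed\<close>.\<close>

lemma mean_value:
  assumes st: "0 \<le> s" "s < t" "t < T" and vs: "v s \<in> H10 U" and vt: "v t \<in> H10 U" and w: "w \<in> H10 U"
    and B: "AE r in lebesgue_on {0<..<T}. s < r \<and> r < t \<longrightarrow> \<bar>force (v r) w - c\<bar> \<le> B"
  shows "\<bar>H1_inner (\<lambda>x. v t x - v s x) w - (t - s) * c\<bar> \<le> (t - s) * B"
proof -
  let ?z = "\<lambda>x. v t x - v s x"
  have z: "?z \<in> H1 U" by (intro H1_diff H10_H1 vs vt)
  obtain \<phi> where \<phi>: "\<And>k. \<phi> k \<in> test_functions U" and lim: "(\<lambda>k. H1_norm U (\<lambda>x. \<phi> k x - w x)) \<longlonglongrightarrow> 0"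
    using H10_approx_seq[OF w] by metis
  have "\<bar>H1_inner ?z (\<phi> k) - (t - s) * c\<bar> \<le> (t - s) * (B + speed * H1_norm U (\<lambda>x. \<phi> k x - w x))" for k
  proof (rule mean_value_test[OF st vs vt \<phi>])
    show "AE r in lebesgue_on {0<..<T}. s < r \<and> r < t \<longrightarrow>
      \<bar>force (v r) (\<phi> k) - c\<bar> \<le> B + speed * H1_norm U (\<lambda>x. \<phi> k x - w x)"
      using B AE_bound
    proof eventually_elim
      case (elim r)
      then have "\<bar>force (v r) (\<lambda>x. \<phi> k x - w x)\<bar> \<le> speed * H1_norm U (\<lambda>x. \<phi> k x - w x)"
        by (intro force_speed[OF _ _ H10_diff[OF test_H10[OF \<phi>] w]]) auto
      then show ?case using elim force_diff[OF _ test_H10[OF \<phi>[of k]] w, of "v r"] by auto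
    qed
  qed
  moreover have "(\<lambda>k. H1_inner ?z (\<phi> k)) \<longlonglongrightarrow> H1_inner ?z w"
  proof (rule Lim_null_comparison[THEN LIM_zero_cancel])
    show "\<forall>\<^sub>F k in sequentially. norm (H1_inner ?z (\<phi> k) - H1_inner ?z w) \<le> H1_norm U ?z * H1_norm U (\<lambda>x. \<phi> k x - w x)"
      using H1_Cauchy_Schwarz[OF z H1_diff[OF test_H1[OF \<phi>] H10_H1[OF w]]]
      by (simp add: H1_inner_diff_right z test_H1 \<phi> H10_H1 w)
    show "(\<lambda>k. H1_norm U ?z * H1_norm U (\<lambda>x. \<phi> k x - w x)) \<longlonglongrightarrow> 0"
      using tendsto_mult_right_zero[OF lim] .
  qed
  then have "(\<lambda>k. \<bar>H1_inner ?z (\<phi> k) - (t - s) * c\<bar>) \<longlonglongrightarrow> \<bar>H1_inner ?z w - (t - s) * c\<bar>"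
    by (intro tendsto_intros)
  moreover have "(\<lambda>k. (t - s) * (B + speed * H1_norm U (\<lambda>x. \<phi> k x - w x))) \<longlonglongrightarrow> (t - s) * (B + speed * 0)"
    by (intro tendsto_intros lim)
  ultimately show ?thesis by (intro LIMSEQ_le[of "\<lambda>k. \<bar>H1_inner ?z (\<phi> k) - (t - s) * c\<bar>"]) auto
qed

text \<open>Almost every time qualifies, but at this stage a given time, in particular 0, need
  not.\<close>

definition regular_times :: "real set" where
  "regular_times = {t. 0 < t \<and> t < T \<and> v t \<in> H10 U \<and> H1_norm U (v t) \<le> bound}"

text \<open>The increment z serves as its own test function with c = 0: the square of its norm is at
  most (t - s) \<open>speed\<close> times its norm, and one factor cancels.\<close>

lemma Lipschitz_regular:
  assumes "s \<in> regular_times" "t \<in> regular_times"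
  shows "H1_norm U (\<lambda>x. v t x - v s x) \<le> speed * \<bar>t - s\<bar>"
proof -
  have *: "H1_norm U (\<lambda>x. v t x - v s x) \<le> speed * (t - s)"
    if st: "s \<in> regular_times" "t \<in> regular_times" "s < t" for s t
  proof -
    define z where "z = (\<lambda>x. v t x - v s x)"
    have H: "v s \<in> H10 U" "v t \<in> H10 U" using st by (auto simp: regular_times_def)
    have z: "z \<in> H10 U" unfolding z_def by (intro H10_diff H)
    have "\<bar>H1_inner z z - (t - s) * 0\<bar> \<le> (t - s) * (speed * H1_norm U z)"
      unfolding z_def
    proof (rule mean_value)
      show "AE r in lebesgue_on {0<..<T}. s < r \<and> r < t \<longrightarrow>
        \<bar>force (v r) (\<lambda>x. v t x - v s x) - 0\<bar> \<le> speed * H1_norm U (\<lambda>x. v t x - v s x)"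
        using AE_bound by eventually_elim (use z force_speed in \<open>auto simp: z_def\<close>)
    qed (use st H z in \<open>auto simp: regular_times_def z_def\<close>)
    then have "H1_norm U z * H1_norm U z \<le> (speed * (t - s)) * H1_norm U z"
      by (simp add: H1_norm_power2[symmetric] power2_eq_square mult_ac)
    then have "H1_norm U z \<le> speed * (t - s)"
    proof (cases "H1_norm U z = 0")
      case True
      then show ?thesis using speed_nonneg st by simp
    next
      case False
      then have "H1_norm U z > 0" using H1_norm_nonneg[of z] by linarith
      then show ?thesis using \<open>H1_norm U z * H1_norm U z \<le> _\<close> by (simp only: mult_le_cancel_right_pos)
    qed
    then show ?thesis by (simp add: z_def)
  qed
  consider "s < t" | "s = t" | "t < s" by linarith
  then show ?thesis
  proof cases
    case 1
    then show ?thesis using *[OF assms] by simp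
  next
    case 2
    then show ?thesis by (simp add: H1_norm_zero)
  next
    case 3
    have "v s \<in> H1 U" "v t \<in> H1 U" using assms by (auto simp: regular_times_def H10_H1)
    then show ?thesis using *[OF assms(2,1) 3] 3 H1_norm_minus_commute[of "v s" "v t"] by simp
  qed
qed

text \<open>Regular times accumulate at every t from the right, which includes t = 0. Along them v
  is Cauchy in H^1 by the Lipschitz bound, and continuity in L^2 identifies the limit with
  \<open>v t\<close>.\<close>

lemma regular_approx:
  assumes t: "0 \<le> t" "t < T"
  shows "\<exists>r. (\<forall>k. r k \<in> regular_times) \<and> r \<longlonglongrightarrow> t \<and> (\<lambda>k. H1_norm U (\<lambda>x. v (r k) x - v t x)) \<longlonglongrightarrow> 0"
    and v_H10: "v t \<in> H10 U"
proof -
  have "\<exists>r. r \<in> regular_times \<and> t < r \<and> r < t + (T - t) * inverse (real (Suc k))" for k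
  proof -
    define q where "q = (T - t) * inverse (real (Suc k))"
    have i: "0 < inverse (real (Suc k))" "inverse (real (Suc k)) \<le> 1" by (auto simp: field_simps)
    have "0 < q" "q \<le> (T - t) * 1"
      unfolding q_def using t i by (auto intro!: mult_pos_pos mult_left_mono)
    then have q: "t < t + q" "t + q \<le> T" by auto
    obtain r where "t < r" "r < t + q" "v r \<in> H10 U \<and> H1_norm U (v r) \<le> bound"
      by (rule AE_lebesgue_on_interval_witness[OF AE_bound t(1) q])
    then show ?thesis using t q unfolding regular_times_def q_def[symmetric]
      by (intro exI[of _ r]) auto
  qed
  then obtain r where r: "\<And>k. r k \<in> regular_times" "\<And>k. t < r k" "\<And>k. r k < t + (T - t) * inverse (real (Suc k))"
    by metis
  have rt: "r \<longlonglongrightarrow> t"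
  proof (rule tendsto_sandwich[OF _ _ tendsto_const])
    show "(\<lambda>k. t + (T - t) * inverse (real (Suc k))) \<longlonglongrightarrow> t"
      using tendsto_add[OF tendsto_const tendsto_mult[OF tendsto_const LIMSEQ_inverse_real_of_nat], of t "T - t"] by simp
  qed (use r in \<open>auto intro!: always_eventually less_imp_le\<close>)
  have rI: "r k \<in> {0..<T}" for k using r(1)[of k] by (auto simp: regular_times_def)
  have L: "(\<lambda>k. Lq_norm 2 U (\<lambda>x. v (r k) x - v t x)) \<longlonglongrightarrow> 0"
  proof -
    have "((\<lambda>s. Lq_norm 2 U (\<lambda>x. v s x - v t x)) \<longlongrightarrow> 0) (at t within {0..<T})"
      using sol t by (auto simp: weak_solution_def L2_continuous_on_def)
    moreover have "filterlim r (at t within {0..<T}) sequentially"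
      unfolding filterlim_at using rt rI r(2) by (auto intro!: always_eventually simp: less_imp_neq[symmetric])
    ultimately show ?thesis by (rule filterlim_compose)
  qed
  have C: "\<exists>N. \<forall>m\<ge>N. \<forall>n\<ge>N. H1_norm U (\<lambda>x. v (r m) x - v (r n) x) < e" if e: "e > 0" for e
  proof -
    have "e / (speed + 1) > 0" using e speed_nonneg by simp
    moreover have "Cauchy r" using rt by (rule LIMSEQ_imp_Cauchy)
    ultimately obtain N where N: "\<And>m n. m \<ge> N \<Longrightarrow> n \<ge> N \<Longrightarrow> \<bar>r m - r n\<bar> < e / (speed + 1)"
      unfolding Cauchy_def dist_real_def by metis
    have "H1_norm U (\<lambda>x. v (r m) x - v (r n) x) < e" if "m \<ge> N" "n \<ge> N" for m n
    proof -
      have "H1_norm U (\<lambda>x. v (r m) x - v (r n) x) \<le> speed * \<bar>r m - r n\<bar>" by (rule Lipschitz_regular[OF r(1) r(1)])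
      also have "\<dots> \<le> (speed + 1) * \<bar>r m - r n\<bar>" by (simp add: mult_right_mono)
      also have "\<dots> < (speed + 1) * (e / (speed + 1))"
        using N[OF that] speed_nonneg by (intro mult_strict_left_mono) auto
      also have "\<dots> = e" using speed_nonneg by simp
      finally show ?thesis .
    qed
    then show ?thesis by blast
  qed
  have rH: "v (r k) \<in> H10 U" for k using r(1)[of k] by (simp add: regular_times_def)
  have lim: "(\<lambda>k. H1_norm U (\<lambda>x. v (r k) x - v t x)) \<longlonglongrightarrow> 0"
    and "v t \<in> H10 U"
    using L2_limit_H10[where u = "\<lambda>k. v (r k)" and w = "v t", OF rH C v_L2[OF t] L] by simp_all
  then show "v t \<in> H10 U" by simp
  show "\<exists>r. (\<forall>k. r k \<in> regular_times) \<and> r \<longlonglongrightarrow> t \<and> (\<lambda>k. H1_norm U (\<lambda>x. v (r k) x - v t x)) \<longlonglongrightarrow> 0"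
    by (intro exI[of _ r] conjI allI r(1) rt lim)
qed

lemma v_bound:
  assumes t: "0 \<le> t" "t < T"
  shows "H1_norm U (v t) \<le> bound"
proof -
  from regular_approx[OF t] obtain r where "\<forall>k. r k \<in> regular_times"
    and r: "(\<lambda>k. H1_norm U (\<lambda>x. v (r k) x - v t x)) \<longlonglongrightarrow> 0"
    by (elim exE conjE)
  then have r1: "r k \<in> regular_times" for k by simp
  note vt = v_H10[OF t]
  have le: "H1_norm U (v t) \<le> bound + H1_norm U (\<lambda>x. v (r k) x - v t x)" for k
  proof -
    have H: "v (r k) \<in> H1 U" "H1_norm U (v (r k)) \<le> bound" using r1[of k] by (auto simp: regular_times_def H10_H1)
    then show ?thesis
      using H1_norm_le_add_diff[OF H10_H1[OF vt] H(1)] H1_norm_minus_commute[OF H10_H1[OF vt] H(1)] by simp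
  qed
  have lim: "(\<lambda>k. bound + H1_norm U (\<lambda>x. v (r k) x - v t x)) \<longlonglongrightarrow> bound + 0"
    by (intro tendsto_intros r)
  have "H1_norm U (v t) \<le> bound + 0"
    by (rule LIMSEQ_le_const[OF lim]) (intro exI[of _ 0] allI impI le)
  then show ?thesis by simp
qed

lemma v_Lipschitz:
  assumes s: "0 \<le> s" "s < T" and t: "0 \<le> t" "t < T"
  shows "H1_norm U (\<lambda>x. v t x - v s x) \<le> speed * \<bar>t - s\<bar>"
proof -
  from regular_approx[OF s] obtain q where q': "\<forall>k. q k \<in> regular_times"
    and q: "q \<longlonglongrightarrow> s" "(\<lambda>k. H1_norm U (\<lambda>x. v (q k) x - v s x)) \<longlonglongrightarrow> 0"
    by (elim exE conjE)
  from regular_approx[OF t] obtain r where r': "\<forall>k. r k \<in> regular_times"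
    and r: "r \<longlonglongrightarrow> t" "(\<lambda>k. H1_norm U (\<lambda>x. v (r k) x - v t x)) \<longlonglongrightarrow> 0"
    by (elim exE conjE)
  have reg: "q k \<in> regular_times" "r k \<in> regular_times" for k using q' r' by simp_all
  have le: "H1_norm U (\<lambda>x. v t x - v s x) \<le> H1_norm U (\<lambda>x. v (r k) x - v t x) + speed * \<bar>r k - q k\<bar> + H1_norm U (\<lambda>x. v (q k) x - v s x)" for k
  proof -
    have H: "v (r k) \<in> H1 U" "v (q k) \<in> H1 U" "v s \<in> H1 U" "v t \<in> H1 U"
      using reg[of k] v_H10[OF s] v_H10[OF t] by (auto simp: regular_times_def H10_H1)
    have "H1_norm U (\<lambda>x. v t x - v s x) \<le> H1_norm U (\<lambda>x. v t x - v (r k) x) + H1_norm U (\<lambda>x. v (r k) x - v s x)"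
      by (rule H1_norm_triangle[OF H(4,1,3)])
    moreover have "H1_norm U (\<lambda>x. v (r k) x - v s x) \<le> H1_norm U (\<lambda>x. v (r k) x - v (q k) x) + H1_norm U (\<lambda>x. v (q k) x - v s x)"
      by (rule H1_norm_triangle[OF H(1,2,3)])
    ultimately show ?thesis
      using Lipschitz_regular[OF reg[of k]] H1_norm_minus_commute[OF H(4,1)] by linarith
  qed
  have lim: "(\<lambda>k. H1_norm U (\<lambda>x. v (r k) x - v t x) + speed * \<bar>r k - q k\<bar> + H1_norm U (\<lambda>x. v (q k) x - v s x))
     \<longlonglongrightarrow> 0 + speed * \<bar>t - s\<bar> + 0"
    by (intro tendsto_intros r q)
  have "H1_norm U (\<lambda>x. v t x - v s x) \<le> 0 + speed * \<bar>t - s\<bar> + 0"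
    by (rule LIMSEQ_le_const[OF lim]) (intro exI[of _ 0] allI impI le)
  then show ?thesis by simp
qed

text \<open>The mean value inequality around the value at s: over [s, t] the functional
  \<open>force (v r)\<close> itself moves by O(t - s), so the error is quadratic.\<close>

lemma force_deviation:
  assumes "0 \<le> s" "s < t" "t < T" "w \<in> H10 U"
  shows "\<bar>H1_inner (\<lambda>x. v t x - v s x) w - (t - s) * force (v s) w\<bar> \<le> (t - s)\<^sup>2 * (Lip * speed * H1_norm U w)"
proof -
  have "\<bar>H1_inner (\<lambda>x. v t x - v s x) w - (t - s) * force (v s) w\<bar> \<le> (t - s) * ((t - s) * (Lip * speed * H1_norm U w))"
  proof (rule mean_value[OF assms(1-3) _ _ assms(4)])
    have "\<bar>force (v r) w - force (v s) w\<bar> \<le> (t - s) * (Lip * speed * H1_norm U w)"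
      if r: "s < r" "r < t" for r
    proof -
      have "\<bar>force (v r) w - force (v s) w\<bar> \<le> Lip * H1_norm U (\<lambda>x. v r x - v s x) * H1_norm U w"
        using assms r by (intro force_Lip v_H10 v_bound) auto
      also have "\<dots> \<le> Lip * (speed * (t - s)) * H1_norm U w"
      proof (intro mult_right_mono mult_left_mono Lip_nonneg H1_norm_nonneg)
        have "H1_norm U (\<lambda>x. v r x - v s x) \<le> speed * \<bar>r - s\<bar>" using assms r by (intro v_Lipschitz) auto
        also have "\<dots> \<le> speed * (t - s)" using r speed_nonneg by (intro mult_left_mono) auto
        finally show "H1_norm U (\<lambda>x. v r x - v s x) \<le> speed * (t - s)" .
      qed
      finally show ?thesis by (simp add: mult_ac)
    qed
    then show "AE r in lebesgue_on {0<..<T}. s < r \<and> r < t \<longrightarrow>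
        \<bar>force (v r) w - force (v s) w\<bar> \<le> (t - s) * (Lip * speed * H1_norm U w)"
      by (intro AE_I2) auto
  qed (use assms in \<open>auto intro: v_H10\<close>)
  then show ?thesis by (simp add: power2_eq_square mult.assoc)
qed

end

section \<open>Exponential decay\<close>

text \<open>Partition \<open>[a, b]\<close> into \<open>n\<close> equal parts and let \<open>n\<close> tend to infinity.\<close>

lemma nonincreasing_if_quadratic_increments:
  fixes j :: "real \<Rightarrow> real"
  assumes inc: "\<And>s t. a \<le> s \<Longrightarrow> s < t \<Longrightarrow> t \<le> b \<Longrightarrow> j t - j s \<le> C * (t - s)\<^sup>2" and ab: "a \<le> b"
  shows "j b \<le> j a"
proof (cases "a = b")
  case False
  then have ab: "a < b" using ab by simp
  have *: "j b - j a \<le> C * (b - a)\<^sup>2 * inverse (real (Suc n))" for n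
  proof -
    define N where "N = real (Suc n)"
    have N: "N > 0" by (simp add: N_def)
    define x where "x i = a + real i * ((b - a) / N)" for i :: nat
    have "j (x (Suc i)) - j (x i) \<le> C * ((b - a) / N)\<^sup>2" if "i < Suc n" for i
    proof -
      have d: "x (Suc i) - x i = (b - a) / N" unfolding x_def of_nat_Suc distrib_right by simp
      have h: "0 < (b - a) / N" using ab N by simp
      have "real (Suc i) * ((b - a) / N) \<le> N * ((b - a) / N)"
        using that h by (intro mult_right_mono) (auto simp: N_def)
      then have "x (Suc i) \<le> b" using N by (simp add: x_def)
      moreover have "0 \<le> real i * ((b - a) / N)" using h by (intro mult_nonneg_nonneg) auto
      then have "a \<le> x i" by (simp add: x_def)
      ultimately show ?thesis using inc[of "x i" "x (Suc i)"] d h by simp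
    qed
    then have "(\<Sum>i<Suc n. j (x (Suc i)) - j (x i)) \<le> (\<Sum>i<Suc n. C * ((b - a) / N)\<^sup>2)"
      by (intro sum_mono) auto
    moreover have "(\<Sum>i<Suc n. j (x (Suc i)) - j (x i)) = j (x (Suc n)) - j (x 0)"
      by (rule sum_lessThan_telescope)
    moreover have "x (Suc n) = b" unfolding x_def N_def[symmetric] using N by simp
    moreover have "x 0 = a" by (simp add: x_def)
    moreover have "(\<Sum>i<Suc n. C * ((b - a) / N)\<^sup>2) = C * (b - a)\<^sup>2 * inverse N"
    proof -
      have "(\<Sum>i<Suc n. C * ((b - a) / N)\<^sup>2) = N * (C * ((b - a) / N)\<^sup>2)" by (simp add: N_def)
      also have "\<dots> = C * (b - a)\<^sup>2 * inverse N" using N by (simp add: power2_eq_square divide_inverse)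
      finally show ?thesis .
    qed
    ultimately have "j b - j a \<le> C * (b - a)\<^sup>2 * inverse N" by (simp only:)
    then show ?thesis by (simp only: N_def)
  qed
  have "(\<lambda>n. C * (b - a)\<^sup>2 * inverse (real (Suc n))) \<longlonglongrightarrow> C * (b - a)\<^sup>2 * 0"
    by (intro tendsto_intros LIMSEQ_inverse_real_of_nat)
  then have "j b - j a \<le> C * (b - a)\<^sup>2 * 0"
    by (rule LIMSEQ_le_const) (intro exI[of _ 0] allI impI *)
  then show ?thesis by simp
qed simp

text \<open>The integrating factor exp (c t) reduces this to the nonincreasing case. By convexity
  its own increment is at most c (t - s) exp (c t), so the first order terms cancel exactly.\<close>

lemma exp_decay_if_quadratic_increments:
  fixes g :: "real \<Rightarrow> real"
  assumes inc: "\<And>s t. 0 \<le> s \<Longrightarrow> s < t \<Longrightarrow> t \<le> b \<Longrightarrow> g t - g s \<le> - c * (t - s) * g s + C * (t - s)\<^sup>2"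
    and g: "\<And>t. g t \<ge> 0" and C: "C \<ge> 0" and c: "c \<ge> 0" and b: "b \<ge> 0"
  shows "g b \<le> g 0 * exp (- c * b)"
proof -
  have "exp (c * b) * g b \<le> exp (c * 0) * g 0"
  proof (rule nonincreasing_if_quadratic_increments[OF _ b])
    fix s t assume st: "0 \<le> s" "s < t" "t \<le> b"
    have "exp (c * t) * g t - exp (c * s) * g s
        = exp (c * t) * (g t - g s) + (exp (c * t) - exp (c * s)) * g s" by (simp add: algebra_simps)
    also have "\<dots> \<le> exp (c * t) * (- c * (t - s) * g s + C * (t - s)\<^sup>2) + (exp (c * t) * (c * (t - s))) * g s"
    proof (intro add_mono mult_left_mono mult_right_mono inc st g)
      have "1 - c * (t - s) \<le> exp (- (c * (t - s)))" using exp_ge_add_one_self[of "- (c * (t - s))"] by simp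
      then have "exp (c * t) * (1 - c * (t - s)) \<le> exp (c * t) * exp (- (c * (t - s)))" by (intro mult_left_mono) auto
      also have "\<dots> = exp (c * s)" by (simp add: exp_add[symmetric] algebra_simps)
      finally show "exp (c * t) - exp (c * s) \<le> exp (c * t) * (c * (t - s))" by (simp add: algebra_simps)
    qed auto
    also have "\<dots> = exp (c * t) * (C * (t - s)\<^sup>2)" by (simp add: algebra_simps)
    also have "\<dots> \<le> exp (c * b) * (C * (t - s)\<^sup>2)"
      using st c C by (intro mult_right_mono) (auto intro: mult_left_mono)
    finally show "exp (c * t) * g t - exp (c * s) * g s \<le> exp (c * b) * C * (t - s)\<^sup>2" by (simp add: mult.assoc)
  qed
  then have "exp (c * b) * g b * exp (- (c * b)) \<le> g 0 * exp (- (c * b))" by (intro mult_right_mono) auto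
  then show ?thesis by (simp add: mult.commute[of _ "g b"] mult.assoc exp_add[symmetric])
qed

section \<open>Coercivity below the depth of the well\<close>

context log_potential_well
begin

text \<open>Once I(\<kappa>u) \<ge> 0 is known, writing it out and discarding the nonnegative ln
  \<kappa> term bounds the logarithmic integral by \<open>\<kappa> powr (1 - p)\<close> times the
  gradient term, a factor below 1 because p > 1.\<close>

lemma I_fun_coercive:
  assumes u: "u \<in> H10 U" and I: "I_fun U p u \<ge> 0" and J: "J_fun U p u \<le> E"
    and E: "0 < E" "E < well_depth U p"
  shows "(1 - ((well_depth U p / E) powr (1 / (1 + p))) powr (1 - p)) * dirichlet u \<le> I_fun U p u"
proof -
  define \<kappa> where "\<kappa> = (well_depth U p / E) powr (1 / (1 + p))"
  have q: "1 + p > 0" using p by simp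
  have \<kappa>: "\<kappa> > 1" unfolding \<kappa>_def using E q by (intro gr_one_powr) auto
  have \<kappa>E: "\<kappa> powr (1 + p) * E = well_depth U p" using E q by (simp add: \<kappa>_def powr_powr)
  note uH = H10_H1[OF u] and ui = H10_log_integrable[OF u]
  have "(1 - \<kappa> powr (1 - p)) * dirichlet u \<le> I_fun U p u"
  proof (cases "dirichlet u = 0")
    case True
    then show ?thesis using I by simp
  next
    case False
    have "I_fun U p (\<lambda>x. \<kappa> * u x) \<ge> 0"
    proof (rule ccontr)
      assume neg: "\<not> I_fun U p (\<lambda>x. \<kappa> * u x) \<ge> 0"
      obtain c where c: "1 \<le> c" "c \<le> \<kappa>" "I_fun U p (\<lambda>x. c * u x) = 0"
        using I_fun_scale_IVT[OF uH ui, of 1 \<kappa>] \<kappa> I neg by auto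
      have "c \<noteq> \<kappa>" using c(3) neg by auto
      then have c\<kappa>: "c < \<kappa>" using c by simp
      \<comment> \<open>For c \<ge> 1 both terms of J on the Nehari manifold grow at most like
        \<open>c powr (1 + p)\<close>; hence a zero of I before \<kappa> would have J below
        \<open>\<kappa> powr (1 + p) * E\<close>, which is the depth.\<close>
      have c2: "c\<^sup>2 \<le> c powr (1 + p)" using powr_mono[of 2 "1 + p" c] c(1) p by simp
      have "well_depth U p \<le> J_fun U p (\<lambda>x. c * u x)"
        using c(1) False by (intro well_depth_le H10_scale[OF u] c(3)) (simp add: dirichlet_scale[OF uH])
      also have "\<dots> = (p - 1) / (2 * (1 + p)) * (c\<^sup>2 * dirichlet u) + c powr (1 + p) * power_integral u / (1 + p)\<^sup>2"
        using c by (simp add: J_fun_I_fun dirichlet_scale[OF uH] log_integrable_scale(3)[OF H10_L2[OF u] ui])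
      also have "\<dots> \<le> (p - 1) / (2 * (1 + p)) * (c powr (1 + p) * dirichlet u) + c powr (1 + p) * power_integral u / (1 + p)\<^sup>2"
        using c2 p dirichlet_nonneg[of u] by (intro add_right_mono mult_left_mono mult_right_mono) auto
      also have "\<dots> = c powr (1 + p) * ((p - 1) / (2 * (1 + p)) * dirichlet u + power_integral u / (1 + p)\<^sup>2)"
        by (simp add: distrib_left)
      also have "\<dots> \<le> c powr (1 + p) * E"
      proof (rule mult_left_mono)
        have "0 \<le> I_fun U p u / (1 + p)" using I p by simp
        then show "(p - 1) / (2 * (1 + p)) * dirichlet u + power_integral u / (1 + p)\<^sup>2 \<le> E"
          using J J_fun_I_fun[of u] by linarith
      qed simp
      also have "\<dots> < \<kappa> powr (1 + p) * E"
        using c c\<kappa> E q by (intro mult_strict_right_mono powr_less_mono2) auto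
      finally show False using \<kappa>E by simp
    qed
    then have "\<kappa> powr (1 + p) * (log_integral u + ln \<kappa> * power_integral u) \<le> \<kappa>\<^sup>2 * dirichlet u"
      using I_fun_scale[OF uH ui, of \<kappa>] \<kappa> by simp
    also have "\<kappa>\<^sup>2 = \<kappa> powr (1 + p) * \<kappa> powr (1 - p)"
      using \<kappa> by (simp add: powr_add[symmetric])
    finally have "log_integral u + ln \<kappa> * power_integral u \<le> \<kappa> powr (1 - p) * dirichlet u"
      using \<kappa> by (simp add: mult.assoc)
    moreover have "0 \<le> ln \<kappa> * power_integral u" using \<kappa> by (simp add: power_integral_nonneg)
    ultimately show ?thesis by (simp add: I_fun_eq left_diff_distrib)
  qed
  then show ?thesis by (simp add: \<kappa>_def)
qed

end

section \<open>Energy, invariance and decay along a solution\<close>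

context potential_well_solution
begin

text \<open>\<open>force_deviation\<close> with the increment w itself puts the squared norm of w on
  the favourable side. Dropping it and dividing by b - a leaves a quadratic bound for
  \<open>- force (v a) w\<close>, the first order part of the increment of J.\<close>

lemma J_fun_nonincreasing:
  assumes "0 \<le> s" "s \<le> t" "t < T"
  shows "J_fun U p (v t) \<le> J_fun U p (v s)"
proof (rule nonincreasing_if_quadratic_increments[OF _ assms(2)])
  fix a b assume ab: "s \<le> a" "a < b" "b \<le> t"
  define w where "w = (\<lambda>x. v b x - v a x)"
  have H: "v a \<in> H10 U" "v b \<in> H10 U" "H1_norm U (v a) \<le> bound" "H1_norm U (v b) \<le> bound"
    using ab assms by (auto intro: v_H10 v_bound)
  have w: "w \<in> H10 U" unfolding w_def by (intro H10_diff H)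
  have wn: "H1_norm U w \<le> speed * (b - a)"
    unfolding w_def using v_Lipschitz[of a b] ab assms by simp
  have "(b - a) * - force (v a) w \<le> (b - a)\<^sup>2 * (Lip * speed * H1_norm U w)"
    using force_deviation[of a b w] ab assms w H1_norm_power2[of w] zero_le_power2[of "H1_norm U w"]
    by (simp add: w_def[symmetric] abs_le_iff)
  also have "\<dots> \<le> (b - a)\<^sup>2 * (Lip * speed * (speed * (b - a)))"
    using wn Lip_nonneg speed_nonneg by (intro mult_left_mono) auto
  finally have "(b - a) * - force (v a) w \<le> (b - a) * (Lip * speed\<^sup>2 * (b - a)\<^sup>2)"
    by (simp add: power2_eq_square mult_ac)
  then have F: "- force (v a) w \<le> Lip * speed\<^sup>2 * (b - a)\<^sup>2"
    using ab by (simp only: mult_le_cancel_left_pos diff_gt_0_iff_gt)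
  have "J_fun U p (v b) - J_fun U p (v a) \<le> - force (v a) w + Lip * (H1_norm U w)\<^sup>2"
    using J_fun_Lip[OF H(2,1,4,3)] by (simp add: w_def[symmetric] abs_le_iff)
  also have "Lip * (H1_norm U w)\<^sup>2 \<le> Lip * (speed * (b - a))\<^sup>2"
    using wn Lip_nonneg by (intro mult_left_mono power_mono H1_norm_nonneg)
  finally show "J_fun U p (v b) - J_fun U p (v a) \<le> 2 * Lip * speed\<^sup>2 * (b - a)\<^sup>2"
    using F by (simp add: power_mult_distrib)
qed

text \<open>The functional and its argument are varied one after the other; either change costs
  \<open>speed\<close> times the norm of the increment.\<close>

lemma I_fun_Lipschitz:
  assumes s: "0 \<le> s" "s < T" and t: "0 \<le> t" "t < T"
  shows "\<bar>I_fun U p (v t) - I_fun U p (v s)\<bar> \<le> 2 * speed\<^sup>2 * \<bar>t - s\<bar>"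
proof -
  define w where "w = (\<lambda>x. v t x - v s x)"
  have H: "v s \<in> H10 U" "v t \<in> H10 U" "H1_norm U (v s) \<le> bound" "H1_norm U (v t) \<le> bound"
    using s t by (auto intro: v_H10 v_bound)
  have w: "w \<in> H10 U" unfolding w_def by (intro H10_diff H)
  have wn: "H1_norm U w \<le> speed * \<bar>t - s\<bar>" unfolding w_def by (rule v_Lipschitz[OF s t])
  have "\<bar>force (v t) (v t) - force (v s) (v t)\<bar> \<le> Lip * H1_norm U w * H1_norm U (v t)"
    unfolding w_def by (rule force_Lip[OF H(2,1,2,4,3)])
  also have "\<dots> \<le> Lip * H1_norm U w * bound"
    using H Lip_nonneg by (intro mult_left_mono mult_nonneg_nonneg H1_norm_nonneg) auto
  also have "\<dots> = speed * H1_norm U w" by (simp add: speed_def)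
  finally have "\<bar>force (v t) (v t) - force (v s) (v t)\<bar> \<le> speed * H1_norm U w" .
  moreover have "\<bar>force (v s) w\<bar> \<le> speed * H1_norm U w" by (rule force_speed[OF H(1,3) w])
  moreover have "force (v s) w = force (v s) (v t) - force (v s) (v s)"
    unfolding w_def by (rule force_diff[OF H(1,2,1)])
  ultimately have "\<bar>I_fun U p (v t) - I_fun U p (v s)\<bar> \<le> 2 * (speed * H1_norm U w)"
    unfolding I_fun_force by linarith
  also have "\<dots> \<le> 2 * (speed * (speed * \<bar>t - s\<bar>))" using wn speed_nonneg by (intro mult_left_mono) auto
  finally show ?thesis by (simp add: power2_eq_square mult.assoc)
qed

lemma I_fun_continuous: "continuous_on {0..<T} (\<lambda>t. I_fun U p (v t))"
  unfolding continuous_on_iff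
proof (intro ballI allI impI)
  fix t and e :: real assume t: "t \<in> {0..<T}" and e: "e > 0"
  have K: "2 * speed\<^sup>2 + 1 > 0" by (simp add: add_nonneg_pos)
  show "\<exists>d>0. \<forall>s\<in>{0..<T}. dist s t < d \<longrightarrow> dist (I_fun U p (v s)) (I_fun U p (v t)) < e"
  proof (intro exI[of _ "e / (2 * speed\<^sup>2 + 1)"] conjI ballI impI)
    fix s assume s: "s \<in> {0..<T}" and d: "dist s t < e / (2 * speed\<^sup>2 + 1)"
    have "dist (I_fun U p (v s)) (I_fun U p (v t)) \<le> 2 * speed\<^sup>2 * \<bar>s - t\<bar>"
      unfolding dist_real_def using I_fun_Lipschitz[of t s] s t by simp
    also have "\<dots> \<le> (2 * speed\<^sup>2 + 1) * \<bar>s - t\<bar>" by (simp add: mult_right_mono)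
    also have "\<dots> < e" using d K by (simp add: dist_real_def pos_less_divide_eq mult.commute)
    finally show "dist (I_fun U p (v s)) (I_fun U p (v t)) < e" .
  qed (use e K in simp)
qed

text \<open>At the last time s with I \<ge> 0 one has I = 0. Energy below the depth excludes the
  Nehari manifold, so the gradient of \<open>v s\<close> vanishes; but then v remains for a while in
  the ball where I \<ge> 0, contradicting the choice of s.\<close>

lemma I_fun_invariant:
  assumes I0: "I_fun U p (v 0) \<ge> 0" and J0: "J_fun U p (v 0) < well_depth U p" and t: "0 \<le> t" "t < T"
  shows "I_fun U p (v t) \<ge> 0"
proof (rule ccontr)
  assume neg: "\<not> I_fun U p (v t) \<ge> 0"
  let ?I = "\<lambda>t. I_fun U p (v t)"
  have cont: "continuous_on {a..b} ?I" if "0 \<le> a" "b \<le> t" for a b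
    using that t by (intro continuous_on_subset[OF I_fun_continuous]) auto
  define S where "S = {0..t} \<inter> ?I -` {0..}"
  have "closed S" unfolding S_def by (intro continuous_closed_preimage cont) auto
  then have "compact S" unfolding S_def by (simp add: compact_eq_bounded_closed bounded_subset[of "{0..t}"])
  moreover have "0 \<in> S" using I0 t by (simp add: S_def)
  ultimately obtain s where s: "s \<in> S" "\<And>r. r \<in> S \<Longrightarrow> r \<le> s"
    using compact_attains_sup[of S] by blast
  have s0: "0 \<le> s" "s \<le> t" "?I s \<ge> 0" using s(1) by (auto simp: S_def)
  with neg have st: "s < t" by (cases "s = t") auto
  obtain r where r: "s \<le> r" "r \<le> t" "?I r = 0"
    using IVT2'[of ?I t 0 s] neg s0 cont[of s t] by auto
  then have "r \<in> S" using s0 by (simp add: S_def)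
  then have "r = s" using s(2) r by (simp add: antisym)
  then have Is: "?I s = 0" using r by simp
  have "J_fun U p (v s) < well_depth U p"
    using J_fun_nonincreasing[of 0 s] s0 t J0 by simp
  then have D: "dirichlet (v s) = 0"
    using well_depth_le[OF v_H10[of s] Is] s0 t by force
  obtain \<epsilon> where \<epsilon>: "\<epsilon> > 0" "\<And>u. u \<in> H10 U \<Longrightarrow> log_integrable u \<Longrightarrow> dirichlet u \<le> \<epsilon> \<Longrightarrow> I_fun U p u \<ge> 0"
    using I_fun_nonneg_small by metis
  \<comment> \<open>During time h the solution moves by at most sqrt \<epsilon>, so its gradient,
    zero at s, stays in the ball; \<open>speed + 1\<close> is positive even if \<open>speed\<close>
    is 0.\<close>
  define h where "h = min (t - s) (sqrt \<epsilon> / (speed + 1))"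
  have h: "h > 0" "h \<le> t - s" using st \<epsilon> speed_nonneg by (auto simp: h_def)
  have sh: "0 \<le> s + h" "s + h < T" using h s0 t by auto
  have "Lq_norm 2 U (grad U (v (s + h))) \<le> Lq_norm 2 U (grad U (v s)) + H1_norm U (\<lambda>x. v (s + h) x - v s x)"
    using sh s0 t st by (intro grad_norm_triangle_diff H10_H1 v_H10) auto
  also have "Lq_norm 2 U (grad U (v s)) = 0" using D dirichlet_eq[of "v s"] by simp
  also have "H1_norm U (\<lambda>x. v (s + h) x - v s x) \<le> speed * h"
    using v_Lipschitz[of s "s + h"] sh s0 t st h by simp
  also have "\<dots> \<le> (speed + 1) * (sqrt \<epsilon> / (speed + 1))"
    using h speed_nonneg by (intro mult_mono) (auto simp: h_def)
  also have "\<dots> = sqrt \<epsilon>" using speed_nonneg by simp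
  finally have "(Lq_norm 2 U (grad U (v (s + h))))\<^sup>2 \<le> (sqrt \<epsilon>)\<^sup>2"
    by (intro power_mono Lq_norm_nonneg) simp
  then have "?I (s + h) \<ge> 0"
    using \<epsilon> sh by (intro \<epsilon>(2) v_H10 H10_log_integrable) (auto simp: dirichlet_eq)
  then have "s + h \<in> S" using h s0 by (simp add: S_def)
  then show False using s(2)[of "s + h"] h by simp
qed

lemma H1_norm_decay:
  assumes c: "c \<ge> 0" "\<And>t. 0 \<le> t \<Longrightarrow> t < T \<Longrightarrow> c * (H1_norm U (v t))\<^sup>2 \<le> I_fun U p (v t)" and b: "0 \<le> b" "b < T"
  shows "H1_norm U (v b) \<le> H1_norm U (v 0) * exp (- c * b)"
proof -
  define g where "g t = (H1_norm U (v t))\<^sup>2" for t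
  have "g b \<le> g 0 * exp (- (2 * c) * b)"
  proof (rule exp_decay_if_quadratic_increments)
    fix s t assume st: "0 \<le> s" "s < t" "t \<le> b"
    define w where "w = (\<lambda>x. v t x - v s x)"
    have H: "v s \<in> H10 U" "v t \<in> H10 U" "H1_norm U (v s) \<le> bound"
      using st b by (auto intro: v_H10 v_bound)
    note H1 = H10_H1[OF H(1)] H10_H1[OF H(2)]
    have w: "w \<in> H1 U" unfolding w_def by (intro H1_diff H1)
    have wn: "H1_norm U w \<le> speed * (t - s)" unfolding w_def using v_Lipschitz[of s t] st b by simp
    have "g t - g s = H1_inner w (v t) + H1_inner w (v s)"
      using H1 by (simp add: g_def w_def H1_norm_power2 H1_inner_diff_left H1_inner_commute[of "v s" "v t"])
    \<comment> \<open>Expanding around the earlier time leaves the square of w, which the Lipschitz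
      bound makes quadratic in t - s.\<close>
    also have "\<dots> = 2 * H1_inner w (v s) + (H1_norm U w)\<^sup>2"
      using H1_inner_diff_right[OF H1(2,1) w] by (simp add: w_def[symmetric] H1_norm_power2)
    also have "H1_inner w (v s) \<le> (t - s) * force (v s) (v s) + (t - s)\<^sup>2 * (Lip * speed * H1_norm U (v s))"
      using force_deviation[of s t "v s"] st b H by (simp add: w_def[symmetric] abs_le_iff)
    also have "(t - s)\<^sup>2 * (Lip * speed * H1_norm U (v s)) \<le> (t - s)\<^sup>2 * (Lip * speed * bound)"
      using H Lip_nonneg speed_nonneg by (intro mult_left_mono) auto
    also have "(H1_norm U w)\<^sup>2 \<le> speed\<^sup>2 * (t - s)\<^sup>2"
      using power_mono[OF wn H1_norm_nonneg, of 2] by (simp add: power_mult_distrib)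
    also have "(t - s) * force (v s) (v s) \<le> (t - s) * (- c * g s)"
      using c(2)[of s] st b by (intro mult_left_mono) (auto simp: I_fun_force g_def)
    finally show "g t - g s \<le> - (2 * c) * (t - s) * g s + (2 * Lip * speed * bound + speed\<^sup>2) * (t - s)\<^sup>2"
      by (simp add: algebra_simps)
  qed (use c b Lip_nonneg speed_nonneg bound_nonneg in \<open>auto simp: g_def\<close>)
  also have "\<dots> = (H1_norm U (v 0) * exp (- c * b))\<^sup>2"
    by (simp add: g_def power_mult_distrib exp_double[symmetric] mult.assoc)
  finally show ?thesis
    unfolding g_def by (rule power2_le_imp_le) (simp add: H1_norm_nonneg)
qed

text \<open>The T-dependent constants \<open>bound\<close>, \<open>Lip\<close> and
  \<open>speed\<close> enter only the quadratic errors and disappear in the limit. Rate and factor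
  are thus the same for every T, although the solution is assumed bounded only on finite time
  intervals.\<close>

lemma exponential_decay:
  assumes I0: "I_fun U p (v 0) \<ge> 0" and J0: "J_fun U p (v 0) \<le> E" "E < well_depth U p"
    and c: "c \<ge> 0"
    and coercive: "\<And>u. u \<in> H10 U \<Longrightarrow> I_fun U p u \<ge> 0 \<Longrightarrow> J_fun U p u \<le> E \<Longrightarrow> c * (H1_norm U u)\<^sup>2 \<le> I_fun U p u"
    and t: "0 \<le> t" "t < T"
  shows "v t \<in> H10 U \<and> H1_norm U (v t) \<le> H1_norm U (v 0) * exp (- c * t)"
proof (intro conjI v_H10 H1_norm_decay t c)
  fix s assume s: "0 \<le> s" "s < T"
  show "c * (H1_norm U (v s))\<^sup>2 \<le> I_fun U p (v s)"
  proof (rule coercive)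
    show "v s \<in> H10 U" using s by (rule v_H10)
    show "I_fun U p (v s) \<ge> 0"
      by (rule I_fun_invariant[OF I0 le_less_trans[OF J0] s])
    show "J_fun U p (v s) \<le> E"
      by (rule order_trans[OF J_fun_nonincreasing[OF order_refl s] J0(1)])
  qed
qed

end

text \<open>An equality of functions, not just almost everywhere: both sides are chosen by the same
  predicate.\<close>

lemma grad_cong_AE:
  assumes "AE x in lebesgue_on U. u x = w x"
    "u \<in> borel_measurable (lebesgue_on U)" "w \<in> borel_measurable (lebesgue_on U)" "U \<in> sets lebesgue"
  shows "grad U u = grad U w"
proof -
  have "weak_gradient U u g \<longleftrightarrow> weak_gradient U w g" for g
  proof -
    have "(\<integral>x. u x * frechet_derivative \<phi> (at x) b \<partial>lebesgue_on U) = (\<integral>x. w x * frechet_derivative \<phi> (at x) b \<partial>lebesgue_on U)"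
      if "\<phi> \<in> test_functions U" "b \<in> Basis" for \<phi> b
      using assms test_measurable_on[OF test_derivative[OF that], of U]
      by (intro integral_cong_AE) auto
    then show ?thesis by (simp add: weak_gradient_def)
  qed
  then show ?thesis by (simp add: grad_def)
qed

text \<open>Needed because the initial condition identifies \<open>v 0\<close> with
  \<open>v0\<close> only almost everywhere.\<close>

lemma (in log_functionals) functionals_cong_AE:
  assumes ae: "AE x in lebesgue_on U. u x = w x" and u: "u \<in> L2_space U" and w: "w \<in> L2_space U"
  shows "I_fun U p u = I_fun U p w" "J_fun U p u = J_fun U p w"
proof -
  note [measurable] = L2_spaceD(1)[OF u] L2_spaceD(1)[OF w]
  have "dirichlet u = dirichlet w"
    unfolding dirichlet_def using grad_cong_AE[OF ae _ _ U_sets] L2_spaceD(1)[OF u] L2_spaceD(1)[OF w] by simp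
  moreover have "log_integral u = log_integral w"
    unfolding log_integral_def by (rule integral_cong_AE) (use ae in \<open>auto elim: eventually_mono\<close>)
  moreover have "power_integral u = power_integral w"
    unfolding power_integral_def by (rule integral_cong_AE) (use ae in \<open>auto elim: eventually_mono\<close>)
  ultimately show "I_fun U p u = I_fun U p w" "J_fun U p u = J_fun U p w"
    by (simp_all add: I_fun_eq J_fun_eq)
qed

theorem theorem4p1:
  fixes U :: "(real ^ 'n) set"
    and p :: real
    and v0 :: "real ^ 'n \<Rightarrow> real"
    and v :: "real \<Rightarrow> real ^ 'n \<Rightarrow> real"
  assumes "p > 1"
    and "smooth_bounded_domain U"
    and "v0 \<in> H10 U"
    and "I_fun U p v0 > 0"
    and "J_fun U p v0 < well_depth U p"
    and "global_weak_solution U p v0 v"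
  shows "\<exists>\<mu>>0. \<exists>C>0. \<forall>t\<ge>0. v t \<in> H10 U \<and> H1_norm U (v t) \<le> C * exp (- \<mu> * t)"
proof -
  interpret log_functionals U p
    using assms(1,2) by unfold_locales (auto simp: smooth_bounded_domain_def)
  define E where "E = J_fun U p v0"
  have "0 < I_fun U p v0 / (1 + p)" using assms(1,4) by simp
  moreover have "0 \<le> (p - 1) / (2 * (1 + p)) * dirichlet v0" using assms(1) dirichlet_nonneg[of v0] by simp
  moreover have "0 \<le> power_integral v0 / (1 + p)\<^sup>2" by (simp add: power_integral_nonneg)
  ultimately have E: "0 < E" "E < well_depth U p"
    using assms(5) J_fun_I_fun[of v0] unfolding E_def by linarith+
  interpret log_potential_well U p
    using E by unfold_locales simp
  have sol: "weak_solution U p v0 T v" if "T > 0" for T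
    using assms(6) that by (simp add: global_weak_solution_def)
  have v0: "I_fun U p (v 0) = I_fun U p v0" "J_fun U p (v 0) = E"
  proof -
    have "AE x in lebesgue_on U. v 0 x = v0 x" "v 0 \<in> L2_space U"
      using sol[of 1] by (auto simp: weak_solution_def L2_continuous_on_def)
    from functionals_cong_AE[OF this H10_L2[OF assms(3)]]
    show "I_fun U p (v 0) = I_fun U p v0" "J_fun U p (v 0) = E" by (simp_all add: E_def)
  qed
  obtain C where C: "C > 0" "\<And>u. u \<in> H10 U \<Longrightarrow> L2_inner U u u \<le> C * dirichlet u"
    using Poincare by metis
  define k where "k = 1 - ((well_depth U p / E) powr (1 / (1 + p))) powr (1 - p)"
  have "(well_depth U p / E) powr (1 / (1 + p)) > 1"
    using E assms(1) by (intro gr_one_powr) auto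
  then have "((well_depth U p / E) powr (1 / (1 + p))) powr (1 - p) < 1"
    using assms(1) by (intro powr_less_one) auto
  then have k: "k > 0" by (simp add: k_def)
  \<comment> \<open>By Poincare the squared H^1 norm is at most 1 + C times the gradient term, for
    which k is the coercivity constant.\<close>
  define c where "c = k / (1 + C)"
  have c: "c > 0" using k C by (simp add: c_def)
  have coercive: "c * (H1_norm U u)\<^sup>2 \<le> I_fun U p u"
    if u: "u \<in> H10 U" "I_fun U p u \<ge> 0" "J_fun U p u \<le> E" for u
  proof -
    have "(H1_norm U u)\<^sup>2 \<le> (1 + C) * dirichlet u"
      using C(2)[OF u(1)] by (simp add: H1_norm_power2 H1_inner_def dirichlet_def[symmetric] distrib_right)
    then have "c * (H1_norm U u)\<^sup>2 \<le> c * ((1 + C) * dirichlet u)" using c by (intro mult_left_mono) auto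
    also have "\<dots> = k * dirichlet u" using C(1) by (simp add: c_def)
    also have "\<dots> \<le> I_fun U p u" unfolding k_def by (rule I_fun_coercive[OF u E])
    finally show ?thesis .
  qed
  have main: "v t \<in> H10 U \<and> H1_norm U (v t) \<le> H1_norm U (v 0) * exp (- c * t)" if t: "t \<ge> 0" for t
  proof -
    have S: "potential_well_solution U p v0 (t + 1) v"
      using t sol[of "t + 1"] log_potential_well_axioms
      by (intro potential_well_solution.intro potential_well_solution_axioms.intro) simp_all
    have "I_fun U p (v 0) \<ge> 0" "J_fun U p (v 0) \<le> E" "c \<ge> 0" "t < t + 1"
      using assms(4) v0 c by simp_all
    note init = this
    show ?thesis
      by (rule potential_well_solution.exponential_decay[OF S init(1,2) E(2) init(3) coercive t init(4)])
  qed
  show ?thesis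
  \<comment> \<open>Adding 1 keeps the factor positive even if the norm of \<open>v 0\<close> is
    0.\<close>
  proof (rule exI[of _ c], rule conjI[OF c], rule exI[of _ "H1_norm U (v 0) + 1"], intro conjI allI impI)
    show "H1_norm U (v 0) + 1 > 0" using H1_norm_nonneg[of "v 0"] by linarith
    fix t :: real assume t: "t \<ge> 0"
    show "v t \<in> H10 U" using main[OF t] by simp
    have "H1_norm U (v t) \<le> H1_norm U (v 0) * exp (- c * t)" using main[OF t] by simp
    also have "\<dots> \<le> (H1_norm U (v 0) + 1) * exp (- c * t)" by (intro mult_right_mono) auto
    finally show "H1_norm U (v t) \<le> (H1_norm U (v 0) + 1) * exp (- c * t)" .
  qed
qed

end
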